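(* Suppose that $\lambda_{\text{met}}\le\lambda^\varepsilon_{\text{cer}}=\lambda_{\text{met}}+\varepsilon D_c$ (i.e. $D_c\ge0$), and let $(\lambda^{\varepsilon,\text{dummy}}(n))_{n\in\mathbb{N}}$ be the sequence of dummy material parameters given by the two dimensional embedded cell algorithm with constant shear modulus $\mu>0$. Then there exists an $\varepsilon_0>0$ such that for all $\varepsilon\in(0,\varepsilon_0)$ the sequence $(\lambda^{\varepsilon,\text{dummy}}(n))_{n\in\mathbb{N}}$ converges monotonically to some $\lambda^{\varepsilon,\text{dummy}}\in[\lambda_{\text{met}},\lambda^\varepsilon_{\text{cer}}]$.
   Context: Let $\Omega=(0,1)^2$ and $\Gamma_1=\{x\in\partial\Omega:x_2\in\{0,1\}\}$. For $u\in H^1(\Omega)^2$ write $(u)_i$ for its components, $\nabla^su=(\nabla u+(\nabla u)^T)/2$, $\operatorname{tr}$ for the trace of a matrix, and $A:B=\operatorname{tr}(A^TB)$. For $l\in\mathbb{R}$ let $\mathcal{W}_l$ be the set of $u\in H^1(\Omega)^2$ with $\int_\Omega(u)_1dx=0$ and, in the trace sense, $(u)_2=l$ on $\{x_2=1\}$ and $(u)_2=0$ on $\{x_2=0\}$, with the $H^1$-norm. For material parameters $\lambda,\mu$ (first Lamé parameter and shear modulus) the solution of the tensile test is the unique $u\in\mathcal{W}_l$ with $\int_\Omega\lambda\operatorname{tr}(\nabla^su)\operatorname{tr}(\nabla^sv)+2\mu\nabla^su:\nabla^sv\,dx=0$ for all $v\in\mathcal{W}_0$, and the tensile force is $F[\lambda,\mu,l]=\int_\Omega\lambda\operatorname{tr}(\nabla^su)+2\mu\,\partial_2(u)_2\,dx$.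 Material: constants $\lambda_{\text{met}}>0$, $\mu>0$, $D_c$ independent of $\varepsilon$; for $\varepsilon>0$, $\lambda^\varepsilon_{\text{cer}}=\lambda_{\text{met}}+\varepsilon D_c$. $\Omega=\Omega_m\cup\Omega_c$ is a disjoint decomposition into metal and ceramic regions; $|\cdot|$ is area. Embedded cell geometry: with $\bar x=(0.5,0.5)^T$ and closed balls $B_r(\bar x)$, $\widetilde\Omega_c=B_{r_1}(\bar x)$, $\widetilde\Omega_m=B_{r_2}(\bar x)\setminus B_{r_1}(\bar x)$, $\widetilde\Omega_{\text{dummy}}=\Omega\setminus(\widetilde\Omega_m\cup\widetilde\Omega_c)$, where $0<r_1\le r_2\le0.1$ are chosen such that $|\Omega_c|/|\Omega_m|=|\widetilde\Omega_c|/|\widetilde\Omega_m|$. Two dimensional embedded cell algorithm (deformation length $l>0$): $\lambda^{\varepsilon,\text{dummy}}(0)=|\Omega_c|\lambda^\varepsilon_{\text{cer}}+|\Omega_m|\lambda_{\text{met}}$; for $n=1,2,\dots$ put $\lambda^{n-1}=\chi_{\widetilde\Omega_c}\lambda^\varepsilon_{\text{cer}}+\chi_{\widetilde\Omega_m}\lambda_{\text{met}}+\chi_{\widetilde\Omega_{\text{dummy}}}\lambda^{\varepsilon,\text{dummy}}(n-1)$, $F^n=F[\lambda^{n-1},\mu,l]$, and $\lambda^{\varepsilon,\text{dummy}}(n)=(F^n-2\mu l)\left(2l-\frac{F^n}{2\mu}\right)^{-1}$. *)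

theory Defs
  imports "HOL-Analysis.Analysis"
begin

type_synonym plane = "real ^ 2"

definition Omega :: "plane set"
  where "Omega = {x. \<forall>i. 0 < x $ i \<and> x $ i < 1}"

definition pd :: "2 \<Rightarrow> (plane \<Rightarrow> real) \<Rightarrow> plane \<Rightarrow> real"
  where "pd i f x = frechet_derivative f (at x) (axis i 1)"

primrec C_k :: "nat \<Rightarrow> (plane \<Rightarrow> real) \<Rightarrow> bool" where
  "C_k 0 f \<longleftrightarrow> continuous_on UNIV f"
| "C_k (Suc k) f \<longleftrightarrow> (\<forall>x. f differentiable (at x)) \<and> (\<forall>i. C_k k (pd i f))"

definition smooth :: "(plane \<Rightarrow> real) \<Rightarrow> bool"
  where "smooth f \<longleftrightarrow> (\<forall>k. C_k k f)"

definition test_function :: "(plane \<Rightarrow> real) \<Rightarrow> bool"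
  where "test_function \<phi> \<longleftrightarrow>
    smooth \<phi> \<and> compact (closure {x. \<phi> x \<noteq> 0}) \<and> closure {x. \<phi> x \<noteq> 0} \<subseteq> Omega"

definition L2 :: "(plane \<Rightarrow> real) set"
  where "L2 = {f. set_borel_measurable lborel Omega f \<and>
                  set_integrable lborel Omega (\<lambda>x. (f x)\<^sup>2)}"

definition is_weak_pd :: "2 \<Rightarrow> (plane \<Rightarrow> real) \<Rightarrow> (plane \<Rightarrow> real) \<Rightarrow> bool"
  where "is_weak_pd i f g \<longleftrightarrow>
    (\<forall>\<phi>. test_function \<phi> \<longrightarrow>
      (LINT x:Omega|lborel. f x * pd i \<phi> x) = - (LINT x:Omega|lborel. g x * \<phi> x))"

definition H1 :: "(plane \<Rightarrow> real) set"
  where "H1 = {f \<in> L2. \<forall>i. \<exists>g\<in>L2. is_weak_pd i f g}"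

text \<open>Functions are not quotiented by almost-everywhere equality. The weak partial
  derivative is determined only almost everywhere, so a representative is chosen; it is used
  under integrals over \<^const>\<open>Omega\<close> only.\<close>

definition weak_pd :: "2 \<Rightarrow> (plane \<Rightarrow> real) \<Rightarrow> plane \<Rightarrow> real"
  where "weak_pd i f = (SOME g. g \<in> L2 \<and> is_weak_pd i f g)"

definition H1_norm :: "(plane \<Rightarrow> real) \<Rightarrow> real"
  where "H1_norm f = sqrt (LINT x:Omega|lborel. (f x)\<^sup>2 + (\<Sum>i\<in>UNIV. (weak_pd i f x)\<^sup>2))"

text \<open>The trace is the continuous extension to \<^const>\<open>H1\<close>, with values in the square
  integrable functions on the boundary, of the restriction of functions smooth up to the
  boundary. Thus \<open>g\<close> is the trace of \<open>f\<close> on the edge \<open>x\<^sub>2 = c\<close> (with \<open>c = 0\<close> or \<open>c = 1\<close>),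
  parametrised by the first coordinate, if some smooth functions converge to \<open>f\<close> in
  \<^const>\<open>H1\<close> while their restrictions to the edge converge to \<open>g\<close> in the square mean.\<close>

definition has_edge_trace :: "(plane \<Rightarrow> real) \<Rightarrow> real \<Rightarrow> (real \<Rightarrow> real) \<Rightarrow> bool"
  where "has_edge_trace f c g \<longleftrightarrow> f \<in> H1 \<and>
    (\<exists>\<phi> :: nat \<Rightarrow> plane \<Rightarrow> real. (\<forall>k. smooth (\<phi> k)) \<and>
      (\<lambda>k. H1_norm (\<lambda>x. \<phi> k x - f x)) \<longlonglongrightarrow> 0 \<and>
      (\<lambda>k. LINT s:{0<..<1}|lborel. (\<phi> k (vector [s, c]) - g s)\<^sup>2) \<longlonglongrightarrow> 0)"

definition weak_grad :: "(plane \<Rightarrow> plane) \<Rightarrow> plane \<Rightarrow> real ^ 2 ^ 2"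
  where "weak_grad u x = (\<chi> i j. weak_pd j (\<lambda>y. u y $ i) x)"

definition sym_grad :: "(plane \<Rightarrow> plane) \<Rightarrow> plane \<Rightarrow> real ^ 2 ^ 2"
  where "sym_grad u x = (1 / 2) *\<^sub>R (weak_grad u x + transpose (weak_grad u x))"

definition frobenius :: "real ^ 2 ^ 2 \<Rightarrow> real ^ 2 ^ 2 \<Rightarrow> real"
  where "frobenius A B = trace (transpose A ** B)"

definition W :: "real \<Rightarrow> (plane \<Rightarrow> plane) set"
  where "W l = {u. (\<forall>i. (\<lambda>x. u x $ i) \<in> H1) \<and>
                   (LINT x:Omega|lborel. u x $ 1) = 0 \<and>
                   has_edge_trace (\<lambda>x. u x $ 2) 1 (\<lambda>_. l) \<and>
                   has_edge_trace (\<lambda>x. u x $ 2) 0 (\<lambda>_. 0)}"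

definition tensile_solution ::
    "(plane \<Rightarrow> real) \<Rightarrow> (plane \<Rightarrow> real) \<Rightarrow> real \<Rightarrow> (plane \<Rightarrow> plane) \<Rightarrow> bool"
  where "tensile_solution lam mu l u \<longleftrightarrow> u \<in> W l \<and>
    (\<forall>v\<in>W 0. (LINT x:Omega|lborel.
        lam x * trace (sym_grad u x) * trace (sym_grad v x)
        + 2 * mu x * frobenius (sym_grad u x) (sym_grad v x)) = 0)"

text \<open>The solution is unique up to null sets; hence the description is of the value of
  the force, which does not depend on the representative of the solution.\<close>

definition tensile_force :: "(plane \<Rightarrow> real) \<Rightarrow> (plane \<Rightarrow> real) \<Rightarrow> real \<Rightarrow> real"
  where "tensile_force lam mu l = (THE F. \<exists>u. tensile_solution lam mu l u \<and>
    F = (LINT x:Omega|lborel.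
          lam x * trace (sym_grad u x) + 2 * mu x * weak_pd 2 (\<lambda>y. u y $ 2) x))"

definition cell_center :: plane
  where "cell_center = vector [1/2, 1/2]"

definition cell_cer :: "real \<Rightarrow> plane set"
  where "cell_cer r1 = cball cell_center r1"

definition cell_met :: "real \<Rightarrow> real \<Rightarrow> plane set"
  where "cell_met r1 r2 = cball cell_center r2 - cball cell_center r1"

definition cell_dummy :: "real \<Rightarrow> real \<Rightarrow> plane set"
  where "cell_dummy r1 r2 = Omega - (cell_met r1 r2 \<union> cell_cer r1)"

text \<open>Areas are compared in \<^typ>\<open>ennreal\<close>, so that the degenerate case \<open>r1 = r2\<close>, where
  \<^term>\<open>cell_met r1 r2\<close> is empty, matches exactly a null metal region (both ratios are
  infinite) rather than being governed by the convention \<open>a / 0 = 0\<close> of the reals.\<close>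

definition embedded_cell_geometry ::
    "plane set \<Rightarrow> plane set \<Rightarrow> real \<Rightarrow> real \<Rightarrow> bool"
  where "embedded_cell_geometry Om_m Om_c r1 r2 \<longleftrightarrow>
    Om_m \<in> sets lebesgue \<and> Om_c \<in> sets lebesgue \<and>
    Om_m \<inter> Om_c = {} \<and> Om_m \<union> Om_c = Omega \<and>
    0 < r1 \<and> r1 \<le> r2 \<and> r2 \<le> 1 / 10 \<and>
    emeasure lebesgue Om_c / emeasure lebesgue Om_m =
      emeasure lebesgue (cell_cer r1) / emeasure lebesgue (cell_met r1 r2)"

definition lam_cer :: "real \<Rightarrow> real \<Rightarrow> real \<Rightarrow> real"
  where "lam_cer lam_met D_c eps = lam_met + eps * D_c"

definition cell_lam :: "real \<Rightarrow> real \<Rightarrow> real \<Rightarrow> real \<Rightarrow> real \<Rightarrow> plane \<Rightarrow> real"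
  where "cell_lam r1 r2 lcer lmet ldummy x =
    indicator (cell_cer r1) x * lcer + indicator (cell_met r1 r2) x * lmet
    + indicator (cell_dummy r1 r2) x * ldummy"

primrec lam_dummy ::
    "plane set \<Rightarrow> plane set \<Rightarrow> real \<Rightarrow> real \<Rightarrow> real \<Rightarrow> real \<Rightarrow> real \<Rightarrow> real \<Rightarrow> real \<Rightarrow> nat \<Rightarrow> real"
  where
  "lam_dummy Om_m Om_c r1 r2 lam_met D_c mu l eps 0 =
     measure lebesgue Om_c * lam_cer lam_met D_c eps + measure lebesgue Om_m * lam_met"
| "lam_dummy Om_m Om_c r1 r2 lam_met D_c mu l eps (Suc n) =
     (let F = tensile_force
                (cell_lam r1 r2 (lam_cer lam_met D_c eps) lam_met
                  (lam_dummy Om_m Om_c r1 r2 lam_met D_c mu l eps n))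
                (\<lambda>_. mu) l
      in (F - 2 * mu * l) * inverse (2 * l - F / (2 * mu)))"

end

theory Submission imports Defs begin

text \<open>The tensile force is a minimal energy. Let \<open>a(u, v)\<close> be the bilinear form of the test with
coefficient \<open>lam\<close>, let \<open>u\<close> be its solution in \<open>W l\<close>, and let \<open>e x = (0, x\<^sub>2)\<close>, which lies in
\<open>W 1\<close>. The force is \<open>F = a(u, e)\<close>; since \<open>u - l e\<close> lies in \<open>W 0\<close>, this gives \<open>l F = a(u, u)\<close>,
and \<open>u\<close> minimises \<open>a(v, v)\<close> over \<open>W l\<close>. The energy of each fixed \<open>v\<close> grows with \<open>lam\<close>, so
\<open>F\<close> is monotone in \<open>lam\<close> (\<open>tensile_force_mono\<close>). For a constant coefficient \<open>c\<close> the solution is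
an affine field, and the update formula of the algorithm recovers \<open>c\<close> from the force
(\<open>identified_const\<close>). Hence one step of the algorithm is a monotone map of the interval
\<open>[lam_met, lam_cer]\<close> into itself: the coefficient of the cell lies between the two constants, and
so does the identified parameter. The initial value is a convex combination of the ends of the
interval, and iterating a monotone map from there gives a monotone bounded sequence
(\<open>monotone_iteration_converges\<close>).

The force is a definite description, so all of this rests on the existence of a solution. It is
obtained as the limit of a minimising sequence (\<open>minimiser_exists\<close>). Such a sequence is Cauchy in
the energy by the parallelogram identity, and the energy controls the full gradient on \<open>W 0\<close> by
an inequality of Korn (\<open>korn\<close>) together with inequalities of Poincare for the two components.

The proof of Korn's inequality is special to this geometry. Write \<open>u\<close>, \<open>v\<close> for the two components
and \<open>\<partial>\<^sub>i\<close> for derivatives; \<open>v\<close> vanishes on the horizontal edges, and \<open>\<partial>\<^sub>2 u\<close> has to be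
bounded by the strains \<open>\<partial>\<^sub>1 u\<close>, \<open>\<partial>\<^sub>2 v\<close> and \<open>\<partial>\<^sub>2 u + \<partial>\<^sub>1 v\<close>. If a smooth \<open>Q\<close> vanishes on the
whole boundary, then \<open>\<integral> \<partial>\<^sub>2 u \<partial>\<^sub>1 Q = \<integral> \<partial>\<^sub>1 u \<partial>\<^sub>2 Q\<close>, because both sides are
\<open>- \<integral> u \<partial>\<^sub>1 \<partial>\<^sub>2 Q\<close>. Smooth approximations \<open>f\<close> of \<open>v\<close> vanish on the horizontal edges only, so
one takes \<open>Q = f - lift f\<close>, where \<open>lift f\<close> agrees with \<open>f\<close> on the vertical edges and is obtained
by stretching the restrictions of \<open>f\<close> to two strips of width \<open>1/16\<close> along these edges over the
square. The stretching divides \<open>\<partial>\<^sub>1\<close> by 16 and increases the norm by a factor of at most 8, so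
that \<open>\<partial>\<^sub>1 (lift f)\<close> has at most half of the norm of \<open>\<partial>\<^sub>1 f\<close>, up to a multiple of the norm of
\<open>\<partial>\<^sub>2 f\<close>. Replacing \<open>\<partial>\<^sub>1 v\<close> by \<open>(\<partial>\<^sub>2 u + \<partial>\<^sub>1 v) - \<partial>\<^sub>2 u\<close> then leaves at least half of the
square of the norm of \<open>\<partial>\<^sub>2 u\<close> on one side and strains on the other.

Two approximation results support this. Weak derivatives, which are tested with functions of
compact support, may be tested with smooth functions that vanish on the two edges orthogonal to
the direction of derivation (\<open>weak_pd_boundary\<close>). A function whose traces on the horizontal edges
vanish is a limit of smooth functions that are exactly zero there (\<open>zero_trace_approx\<close>).\<close>

section \<open>Square integrable functions\<close>

definition sq_int :: "'a measure \<Rightarrow> ('a \<Rightarrow> real) set"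
  where "sq_int M = {f \<in> borel_measurable M. integrable M (\<lambda>x. (f x)\<^sup>2)}"

definition l2n :: "'a measure \<Rightarrow> ('a \<Rightarrow> real) \<Rightarrow> real"
  where "l2n M f = sqrt (\<integral>x. (f x)\<^sup>2 \<partial>M)"

lemma sq_int_measurable [measurable_dest]: "f \<in> sq_int M \<Longrightarrow> f \<in> borel_measurable M"
  and sq_int_integrable: "f \<in> sq_int M \<Longrightarrow> integrable M (\<lambda>x. (f x)\<^sup>2)"
  by (auto simp: sq_int_def)

lemma l2n_nonneg [simp]: "0 \<le> l2n M f"
  by (simp add: l2n_def)

lemma l2n_sq: "(l2n M f)\<^sup>2 = (\<integral>x. (f x)\<^sup>2 \<partial>M)"
  by (simp add: l2n_def)

lemma sq_int_mult_integrable: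
  assumes "f \<in> sq_int M" "g \<in> sq_int M"
  shows "integrable M (\<lambda>x. f x * g x)"
proof (rule Bochner_Integration.integrable_bound)
  show "integrable M (\<lambda>x. (f x)\<^sup>2 + (g x)\<^sup>2)"
    using assms by (auto intro: sq_int_integrable)
  show "AE x in M. norm (f x * g x) \<le> norm ((f x)\<^sup>2 + (g x)\<^sup>2)"
  proof (rule AE_I2)
    fix x
    have "2 * (\<bar>f x\<bar> * \<bar>g x\<bar>) \<le> (f x)\<^sup>2 + (g x)\<^sup>2"
      using sum_squares_bound[of "\<bar>f x\<bar>" "\<bar>g x\<bar>"] by simp
    moreover have "0 \<le> \<bar>f x\<bar> * \<bar>g x\<bar>" by simp
    ultimately show "norm (f x * g x) \<le> norm ((f x)\<^sup>2 + (g x)\<^sup>2)"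
      using abs_ge_self[of "(f x)\<^sup>2 + (g x)\<^sup>2"]
      unfolding real_norm_def abs_mult by linarith
  qed
qed (use assms in \<open>auto simp: sq_int_def\<close>)

lemma sq_int_add [intro]:
  assumes "f \<in> sq_int M" "g \<in> sq_int M"
  shows "(\<lambda>x. f x + g x) \<in> sq_int M"
  using assms sq_int_mult_integrable[OF assms]
  by (auto simp: sq_int_def power2_sum mult.assoc)

lemma sq_int_scale [intro]: "f \<in> sq_int M \<Longrightarrow> (\<lambda>x. c * f x) \<in> sq_int M"
  by (auto simp: sq_int_def power_mult_distrib)

lemma sq_int_diff [intro]:
  assumes "f \<in> sq_int M" "g \<in> sq_int M"
  shows "(\<lambda>x. f x - g x) \<in> sq_int M"
  using sq_int_add[OF assms(1) sq_int_scale[OF assms(2), of "-1"]] by simp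

lemma sq_int_zero [simp]: "(\<lambda>x. 0) \<in> sq_int M"
  by (simp add: sq_int_def)

lemma l2n_scale: "l2n M (\<lambda>x. c * f x) = \<bar>c\<bar> * l2n M f"
  by (simp add: l2n_def power_mult_distrib real_sqrt_mult)

lemma l2n_uminus: "l2n M (\<lambda>x. - f x) = l2n M f"
  by (simp add: l2n_def)

lemma l2n_minus_commute: "l2n M (\<lambda>x. f x - g x) = l2n M (\<lambda>x. g x - f x)"
  by (simp add: l2n_def power2_commute)

lemma l2n_cong_AE:
  assumes "f \<in> borel_measurable M" "g \<in> borel_measurable M" "AE x in M. f x = g x"
  shows "l2n M f = l2n M g"
proof -
  have "(\<integral>x. (f x)\<^sup>2 \<partial>M) = (\<integral>x. (g x)\<^sup>2 \<partial>M)"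
    using assms by (intro integral_cong_AE) auto
  then show ?thesis by (simp add: l2n_def)
qed

lemma l2n_mono:
  assumes "g \<in> sq_int M" "f \<in> borel_measurable M" "\<And>x. x \<in> space M \<Longrightarrow> \<bar>f x\<bar> \<le> \<bar>g x\<bar>"
  shows "f \<in> sq_int M" "l2n M f \<le> l2n M g"
proof -
  have le: "(f x)\<^sup>2 \<le> (g x)\<^sup>2" if "x \<in> space M" for x
    using assms(3)[OF that] by (simp add: abs_le_square_iff)
  have "integrable M (\<lambda>x. (f x)\<^sup>2)"
    by (rule Bochner_Integration.integrable_bound[OF sq_int_integrable[OF assms(1)]])
       (use le assms(2) in auto)
  then show "f \<in> sq_int M" using assms(2) by (simp add: sq_int_def)
  show "l2n M f \<le> l2n M g"
    unfolding l2n_def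
    by (intro real_sqrt_le_mono integral_mono)
       (use le \<open>integrable M (\<lambda>x. (f x)\<^sup>2)\<close> sq_int_integrable[OF assms(1)] in auto)
qed

lemma l2n_Cauchy_Schwarz:
  assumes "f \<in> sq_int M" "g \<in> sq_int M"
  shows "\<bar>\<integral>x. f x * g x \<partial>M\<bar> \<le> l2n M f * l2n M g"
proof -
  define A B C where "A = (\<integral>x. (f x)\<^sup>2 \<partial>M)" and "B = (\<integral>x. (g x)\<^sup>2 \<partial>M)"
    and "C = (\<integral>x. f x * g x \<partial>M)"
  \<comment> \<open>the integral of the square of \<open>f + t * g\<close>; its discriminant as a polynomial in \<open>t\<close> is the claim\<close>
  have q: "0 \<le> A + 2 * t * C + t\<^sup>2 * B" for t
  proof -
    have "0 \<le> (\<integral>x. (f x + t * g x)\<^sup>2 \<partial>M)" by simp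
    also have "(\<integral>x. (f x + t * g x)\<^sup>2 \<partial>M) =
        (\<integral>x. ((f x)\<^sup>2 + (2 * t) * (f x * g x)) + t\<^sup>2 * (g x)\<^sup>2 \<partial>M)"
      by (intro Bochner_Integration.integral_cong) (auto simp: power2_eq_square algebra_simps)
    also have "\<dots> = A + 2 * t * C + t\<^sup>2 * B"
      using assms sq_int_mult_integrable[OF assms]
      by (simp add: sq_int_integrable A_def B_def C_def)
    finally show ?thesis .
  qed
  have B0: "0 \<le> B" "0 \<le> A" by (simp_all add: B_def A_def)
  have "C\<^sup>2 \<le> A * B"
  proof (cases "B = 0")
    case True
    have "C = 0"
    proof (rule ccontr)
      assume "C \<noteq> 0"
      then show False using q[of "- (A + 1) / (2 * C)"] True by (simp add: field_simps)
    qed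
    then show ?thesis using B0 by simp
  next
    case False
    then show ?thesis using q[of "- C / B"] B0 by (simp add: field_simps power2_eq_square)
  qed
  then have "sqrt (C\<^sup>2) \<le> sqrt (A * B)" by (rule real_sqrt_le_mono)
  then show ?thesis by (simp add: real_sqrt_mult l2n_def A_def B_def C_def)
qed

lemma l2n_sq_add:
  assumes "f \<in> sq_int M" "g \<in> sq_int M"
  shows "(l2n M (\<lambda>x. f x + g x))\<^sup>2 = (l2n M f)\<^sup>2 + 2 * (\<integral>x. f x * g x \<partial>M) + (l2n M g)\<^sup>2"
proof -
  have "(l2n M (\<lambda>x. f x + g x))\<^sup>2 = (\<integral>x. (f x)\<^sup>2 + 2 * (f x * g x) + (g x)\<^sup>2 \<partial>M)"
    unfolding l2n_sq by (intro Bochner_Integration.integral_cong) (auto simp: power2_eq_square algebra_simps)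
  then show ?thesis
    using assms sq_int_mult_integrable[OF assms] by (simp add: sq_int_integrable l2n_sq)
qed

lemma l2n_triangle:
  assumes "f \<in> sq_int M" "g \<in> sq_int M"
  shows "l2n M (\<lambda>x. f x + g x) \<le> l2n M f + l2n M g"
proof -
  have "(l2n M (\<lambda>x. f x + g x))\<^sup>2 \<le> (l2n M f + l2n M g)\<^sup>2"
    using l2n_Cauchy_Schwarz[OF assms] unfolding l2n_sq_add[OF assms] power2_sum by linarith
  then show ?thesis by (rule power2_le_imp_le) simp
qed

lemma l2n_triangle_diff:
  assumes "f \<in> sq_int M" "g \<in> sq_int M"
  shows "l2n M (\<lambda>x. f x - g x) \<le> l2n M f + l2n M g"
  using l2n_triangle[OF assms(1) sq_int_scale[OF assms(2), of "-1"]] by (simp add: l2n_uminus)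

lemma l2n_triangle3:
  assumes "f \<in> sq_int M" "g \<in> sq_int M" "h \<in> sq_int M"
  shows "l2n M (\<lambda>x. f x - h x) \<le> l2n M (\<lambda>x. f x - g x) + l2n M (\<lambda>x. g x - h x)"
  using l2n_triangle[of "\<lambda>x. f x - g x" M "\<lambda>x. g x - h x"] assms by auto

lemma l2n_diff_norms:
  assumes "f \<in> sq_int M" "g \<in> sq_int M"
  shows "\<bar>l2n M f - l2n M g\<bar> \<le> l2n M (\<lambda>x. f x - g x)"
  using l2n_triangle3[OF assms sq_int_zero] l2n_triangle3[OF assms(2,1) sq_int_zero]
  by (simp add: l2n_minus_commute[of M f g])

lemma l2n_tendsto_norm:
  assumes "\<And>k. f k \<in> sq_int M" "g \<in> sq_int M" "(\<lambda>k. l2n M (\<lambda>x. f k x - g x)) \<longlonglongrightarrow> 0"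
  shows "(\<lambda>k. l2n M (f k)) \<longlonglongrightarrow> l2n M g"
proof (rule LIM_zero_cancel, rule Lim_null_comparison[OF _ assms(3)])
  show "\<forall>\<^sub>F k in sequentially. norm (l2n M (f k) - l2n M g) \<le> l2n M (\<lambda>x. f k x - g x)"
    using l2n_diff_norms[OF assms(1,2)] by (intro always_eventually) auto
qed

lemma l2n_tendsto_integral:
  assumes f: "\<And>k. f k \<in> sq_int M" "f' \<in> sq_int M" "(\<lambda>k. l2n M (\<lambda>x. f k x - f' x)) \<longlonglongrightarrow> 0"
    and g: "\<And>k. g k \<in> sq_int M" "g' \<in> sq_int M" "(\<lambda>k. l2n M (\<lambda>x. g k x - g' x)) \<longlonglongrightarrow> 0"
  shows "(\<lambda>k. \<integral>x. f k x * g k x \<partial>M) \<longlonglongrightarrow> (\<integral>x. f' x * g' x \<partial>M)"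
proof (rule LIM_zero_cancel)
  let ?r = "\<lambda>k. l2n M (\<lambda>x. f k x - f' x) * l2n M (g k) + l2n M f' * l2n M (\<lambda>x. g k x - g' x)"
  have "?r \<longlonglongrightarrow> 0 * l2n M g' + l2n M f' * 0"
    by (intro tendsto_intros f g l2n_tendsto_norm)
  then have r: "?r \<longlonglongrightarrow> 0" by simp
  have "norm ((\<integral>x. f k x * g k x \<partial>M) - (\<integral>x. f' x * g' x \<partial>M)) \<le> ?r k" for k
  proof -
    have "(\<integral>x. f k x * g k x \<partial>M) - (\<integral>x. f' x * g' x \<partial>M) =
        (\<integral>x. f k x * g k x - f' x * g' x \<partial>M)"
      using f g by (simp add: sq_int_mult_integrable)
    also have "\<dots> = (\<integral>x. (f k x - f' x) * g k x + f' x * (g k x - g' x) \<partial>M)"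
      by (intro Bochner_Integration.integral_cong) (auto simp: algebra_simps)
    also have "\<dots> = (\<integral>x. (f k x - f' x) * g k x \<partial>M) + (\<integral>x. f' x * (g k x - g' x) \<partial>M)"
      by (intro Bochner_Integration.integral_add sq_int_mult_integrable f g sq_int_diff)
    finally have eq: "(\<integral>x. f k x * g k x \<partial>M) - (\<integral>x. f' x * g' x \<partial>M) =
        (\<integral>x. (f k x - f' x) * g k x \<partial>M) + (\<integral>x. f' x * (g k x - g' x) \<partial>M)" .
    show ?thesis
      unfolding eq real_norm_def
      by (rule order_trans[OF abs_triangle_ineq])
         (intro add_mono l2n_Cauchy_Schwarz f g sq_int_diff)
  qed
  then show "(\<lambda>k. (\<integral>x. f k x * g k x \<partial>M) - (\<integral>x. f' x * g' x \<partial>M)) \<longlonglongrightarrow> 0"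
    by (intro Lim_null_comparison[OF _ r] always_eventually) auto
qed

lemma l2n_tendsto_integral_right:
  assumes f: "\<And>k. f k \<in> sq_int M" "f' \<in> sq_int M" "(\<lambda>k. l2n M (\<lambda>x. f k x - f' x)) \<longlonglongrightarrow> 0"
    and g: "g \<in> sq_int M"
  shows "(\<lambda>k. \<integral>x. f k x * g x \<partial>M) \<longlonglongrightarrow> (\<integral>x. f' x * g x \<partial>M)"
  by (rule l2n_tendsto_integral[OF f]) (use g in \<open>auto simp: l2n_def\<close>)

lemma (in finite_measure) bounded_sq_int:
  assumes "f \<in> borel_measurable M" "\<And>x. x \<in> space M \<Longrightarrow> \<bar>f x\<bar> \<le> B"
  shows "f \<in> sq_int M"
proof -
  have "integrable M (\<lambda>x. (f x)\<^sup>2)"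
  proof (rule integrable_const_bound[where B = "B\<^sup>2"])
    show "AE x in M. norm ((f x)\<^sup>2) \<le> B\<^sup>2"
    proof (rule AE_I2)
      fix x assume "x \<in> space M"
      then show "norm ((f x)\<^sup>2) \<le> B\<^sup>2"
        using power_mono[OF assms(2), of x 2] by simp
    qed
  qed (use assms(1) in measurable)
  then show ?thesis using assms(1) by (simp add: sq_int_def)
qed

lemma (in finite_measure) sq_int_one: "(\<lambda>x. 1) \<in> sq_int M"
  by (rule bounded_sq_int[of _ 1]) auto

lemma (in finite_measure) sq_int_integrable1:
  assumes "f \<in> sq_int M"
  shows "integrable M f"
  using sq_int_mult_integrable[OF assms sq_int_one] by simp

lemma l2n_dominated_tendsto:
  assumes g: "g \<in> sq_int M" and f: "\<And>k. f k \<in> borel_measurable M"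
    and bd: "\<And>k x. x \<in> space M \<Longrightarrow> \<bar>f k x\<bar> \<le> \<bar>g x\<bar>"
    and lim: "AE x in M. (\<lambda>k. f k x) \<longlonglongrightarrow> 0"
  shows "(\<lambda>k. l2n M (f k)) \<longlonglongrightarrow> 0"
proof -
  have "(\<lambda>k. \<integral>x. (f k x)\<^sup>2 \<partial>M) \<longlonglongrightarrow> (\<integral>x. 0 \<partial>M)"
  proof (rule integral_dominated_convergence)
    show "integrable M (\<lambda>x. (g x)\<^sup>2)" using g by (rule sq_int_integrable)
    show "AE x in M. (\<lambda>i. (f i x)\<^sup>2) \<longlonglongrightarrow> 0"
      using lim by eventually_elim (auto intro: tendsto_eq_intros)
    show "AE x in M. norm ((f i x)\<^sup>2) \<le> (g x)\<^sup>2" for i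
      using bd by (intro AE_I2) (auto simp: abs_le_square_iff)
  qed (use f in auto)
  then have "(\<lambda>k. sqrt (\<integral>x. (f k x)\<^sup>2 \<partial>M)) \<longlonglongrightarrow> sqrt 0"
    by (intro tendsto_real_sqrt) simp
  then show ?thesis by (simp add: l2n_def)
qed

lemma nn_integral_sq:
  assumes "f \<in> sq_int M"
  shows "(\<integral>\<^sup>+x. ennreal ((f x)\<^sup>2) \<partial>M) = ennreal ((l2n M f)\<^sup>2)"
  unfolding l2n_sq using assms by (intro nn_integral_eq_integral) (auto simp: sq_int_integrable)

text \<open>The argument of Riesz and Fischer: along a subsequence the successive distances are
summable, so that it converges almost everywhere, and Fatou's lemma bounds the distance to the
pointwise limit. Finiteness of the measure turns bounds for the norm into bounds for the integral
of the absolute value, which is how the almost everywhere summability is obtained.\<close>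

lemma (in finite_measure) sq_int_complete:
  assumes f: "\<And>k. f k \<in> sq_int M"
    and cauchy: "\<And>e. e > 0 \<Longrightarrow> \<exists>N. \<forall>m\<ge>N. \<forall>n\<ge>N. l2n M (\<lambda>x. f m x - f n x) < e"
  obtains g where "g \<in> sq_int M" "(\<lambda>k. l2n M (\<lambda>x. f k x - g x)) \<longlonglongrightarrow> 0"
proof -
  note [measurable] = f[THEN sq_int_measurable]
  have "\<forall>j. \<exists>N. \<forall>m\<ge>N. \<forall>n\<ge>N. l2n M (\<lambda>x. f m x - f n x) < (1/2)^j"
    using cauchy by simp
  then obtain N where N: "\<And>j m n. m \<ge> N j \<Longrightarrow> n \<ge> N j \<Longrightarrow> l2n M (\<lambda>x. f m x - f n x) < (1/2)^j"
    by metis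
  \<comment> \<open>a maximum over all earlier indices makes the subsequence nondecreasing\<close>
  define r where "r j = Max (N ` {..j})" for j
  have rN: "r j \<ge> N j" for j by (auto simp: r_def)
  have rmono: "r i \<le> r j" if "i \<le> j" for i j
    unfolding r_def using that by (intro Max_mono) auto
  define d where "d j x = f (r (Suc j)) x - f (r j) x" for j x
  have d: "d j \<in> sq_int M" for j unfolding d_def using f by auto
  note [measurable] = d[THEN sq_int_measurable]
  have dn: "l2n M (d j) \<le> (1/2)^j" for j
    unfolding d_def using N[of j "r (Suc j)" "r j"] rmono[of j "Suc j"] rN[of j]
    by simp
  have d1: "(\<integral>\<^sup>+x. ennreal \<bar>d j x\<bar> \<partial>M) \<le> ennreal (l2n M (\<lambda>x. 1) * (1/2)^j)" for j
  proof -
    have ab: "(\<lambda>x. \<bar>d j x\<bar>) \<in> sq_int M" using d[of j] by (auto simp: sq_int_def)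
    have "(\<integral>\<^sup>+x. ennreal \<bar>d j x\<bar> \<partial>M) = ennreal (\<integral>x. \<bar>d j x\<bar> \<partial>M)"
      by (intro nn_integral_eq_integral sq_int_integrable1 ab) auto
    also have "(\<integral>x. \<bar>d j x\<bar> \<partial>M) \<le> l2n M (\<lambda>x. \<bar>d j x\<bar>) * l2n M (\<lambda>x. 1)"
      using l2n_Cauchy_Schwarz[OF ab sq_int_one] by simp
    also have "l2n M (\<lambda>x. \<bar>d j x\<bar>) = l2n M (d j)" by (simp add: l2n_def)
    also have "l2n M (d j) * l2n M (\<lambda>x. 1) \<le> (1/2)^j * l2n M (\<lambda>x. 1)"
      by (intro mult_right_mono dn) simp
    finally show ?thesis by (simp add: mult.commute ennreal_leI)
  qed
  have "(\<integral>\<^sup>+x. (\<Sum>j. ennreal \<bar>d j x\<bar>) \<partial>M) = (\<Sum>j. \<integral>\<^sup>+x. ennreal \<bar>d j x\<bar> \<partial>M)"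
    by (rule nn_integral_suminf) measurable
  also have "\<dots> \<le> (\<Sum>j. ennreal (l2n M (\<lambda>x. 1) * (1/2)^j))"
    by (intro suminf_le d1) auto
  also have "\<dots> = ennreal (\<Sum>j. l2n M (\<lambda>x. 1) * (1/2)^j)"
    by (intro suminf_ennreal2 summable_mult summable_geometric) auto
  also have "\<dots> < \<infinity>" by simp
  finally have fin: "(\<integral>\<^sup>+x. (\<Sum>j. ennreal \<bar>d j x\<bar>) \<partial>M) \<noteq> \<infinity>" by auto
  have "AE x in M. (\<Sum>j. ennreal \<bar>d j x\<bar>) \<noteq> \<infinity>"
    by (rule nn_integral_noteq_infinite[OF _ fin]) measurable
  then have conv: "AE x in M. convergent (\<lambda>j. f (r j) x)"
  proof eventually_elim
    case (elim x)
    then have "summable (\<lambda>j. \<bar>d j x\<bar>)"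
      by (intro summable_suminf_not_top) auto
    then have "summable (\<lambda>j. d j x)" by (rule summable_rabs_cancel)
    then have "(\<lambda>n. \<Sum>j<n. d j x) \<longlonglongrightarrow> (\<Sum>j. d j x)" by (rule summable_LIMSEQ)
    moreover have "(\<Sum>j<n. d j x) = f (r n) x - f (r 0) x" for n
      unfolding d_def by (rule sum_lessThan_telescope)
    ultimately have "(\<lambda>n. (f (r n) x - f (r 0) x) + f (r 0) x) \<longlonglongrightarrow> (\<Sum>j. d j x) + f (r 0) x"
      by (intro tendsto_intros) simp
    then show ?case by (auto simp: convergent_def)
  qed
  define g where "g x = lim (\<lambda>j. f (r j) x)" for x
  have gm [measurable]: "g \<in> borel_measurable M"
    unfolding g_def by measurable
  have glim: "AE x in M. (\<lambda>j. f (r j) x) \<longlonglongrightarrow> g x"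
    using conv by eventually_elim (simp add: g_def convergent_LIMSEQ_iff)
  have fatou: "(\<integral>\<^sup>+x. ennreal ((f m x - g x)\<^sup>2) \<partial>M) \<le> ennreal (((1/2)^i)\<^sup>2)" if m: "m \<ge> N i" for m i
  proof -
    have "(\<integral>\<^sup>+x. ennreal ((f m x - g x)\<^sup>2) \<partial>M) =
        (\<integral>\<^sup>+x. liminf (\<lambda>j. ennreal ((f m x - f (r j) x)\<^sup>2)) \<partial>M)"
    proof (rule nn_integral_cong_AE)
      show "AE x in M. ennreal ((f m x - g x)\<^sup>2) = liminf (\<lambda>j. ennreal ((f m x - f (r j) x)\<^sup>2))"
        using glim
      proof eventually_elim
        case (elim x)
        have "(\<lambda>j. ennreal ((f m x - f (r j) x)\<^sup>2)) \<longlonglongrightarrow> ennreal ((f m x - g x)\<^sup>2)"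
          by (intro tendsto_ennrealI tendsto_intros elim)
        then show ?case by (rule lim_imp_Liminf[OF sequentially_bot, symmetric])
      qed
    qed
    also have "\<dots> \<le> liminf (\<lambda>j. \<integral>\<^sup>+x. ennreal ((f m x - f (r j) x)\<^sup>2) \<partial>M)"
      by (rule nn_integral_liminf) measurable
    also have "\<dots> \<le> ennreal (((1/2)^i)\<^sup>2)"
    proof (rule Liminf_le)
      show "\<forall>\<^sub>F j in sequentially. (\<integral>\<^sup>+x. ennreal ((f m x - f (r j) x)\<^sup>2) \<partial>M) \<le> ennreal (((1/2)^i)\<^sup>2)"
        using eventually_ge_at_top[of i]
      proof eventually_elim
        case (elim j)
        have "l2n M (\<lambda>x. f m x - f (r j) x) < (1/2)^i"
          using N[of i m "r j"] m rN[of i] rmono[OF elim] by simp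
        then show ?case
          by (subst nn_integral_sq) (auto intro!: ennreal_leI power_mono sq_int_diff f)
      qed
    qed auto
    finally show ?thesis .
  qed
  have "(\<lambda>x. f (N 0) x - g x) \<in> sq_int M"
  proof -
    have "integrable M (\<lambda>x. (f (N 0) x - g x)\<^sup>2)"
      using le_less_trans[OF fatou[of 0 "N 0"] ennreal_less_top]
      by (intro integrableI_bounded) auto
    then show ?thesis by (simp add: sq_int_def)
  qed
  from sq_int_diff[OF f[of "N 0"] this] have g: "g \<in> sq_int M" by simp
  have le: "l2n M (\<lambda>x. f m x - g x) \<le> (1/2)^i" if "m \<ge> N i" for m i
  proof -
    have "ennreal ((l2n M (\<lambda>x. f m x - g x))\<^sup>2) \<le> ennreal (((1/2)^i)\<^sup>2)"
      using fatou[OF that] by (subst nn_integral_sq[symmetric]) (auto intro!: sq_int_diff f g)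
    then show ?thesis by (auto intro: power2_le_imp_le)
  qed
  have "(\<lambda>k. l2n M (\<lambda>x. f k x - g x)) \<longlonglongrightarrow> 0"
  proof (rule LIMSEQ_I)
    fix e :: real assume "e > 0"
    then obtain i where "(1/2::real)^i < e" using real_arch_pow_inv[of e "1/2"] by auto
    then have "\<forall>m\<ge>N i. norm (l2n M (\<lambda>x. f m x - g x) - 0) < e"
      using le_less_trans[OF le] by simp
    then show "\<exists>no. \<forall>m\<ge>no. norm (l2n M (\<lambda>x. f m x - g x) - 0) < e" ..
  qed
  with g show ?thesis by (rule that)
qed

section \<open>Smooth functions of two variables\<close>

lemma pd_eqI: "(f has_derivative f') (at x) \<Longrightarrow> pd i f x = f' (axis i 1)"
  unfolding pd_def by (metis frechet_derivative_at)

lemma pd_works: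
  assumes "f differentiable (at x)"
  shows "(f has_derivative frechet_derivative f (at x)) (at x)"
  using assms frechet_derivative_works by blast

lemma pd_add:
  assumes "f differentiable (at x)" "g differentiable (at x)"
  shows "pd i (\<lambda>x. f x + g x) x = pd i f x + pd i g x"
  using pd_eqI[OF has_derivative_add[OF pd_works[OF assms(1)] pd_works[OF assms(2)]]]
  by (simp add: pd_def)

lemma pd_mult:
  assumes "f differentiable (at x)" "g differentiable (at x)"
  shows "pd i (\<lambda>x. f x * g x) x = pd i f x * g x + f x * pd i g x"
  using pd_eqI[OF has_derivative_mult[OF pd_works[OF assms(1)] pd_works[OF assms(2)]]]
  by (simp add: pd_def)

lemma pd_const [simp]: "pd i (\<lambda>x. c) x = 0"
  using pd_eqI[OF has_derivative_const[of c "at x"]] by simp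

lemma pd_const_fun [simp]: "pd i (\<lambda>x. c) = (\<lambda>x. 0)"
  by (rule ext) simp


lemma has_derivative_nth: "((\<lambda>x. x $ i) has_derivative (\<lambda>h. h $ i)) (at (x :: plane))"
  by (rule bounded_linear.has_derivative[OF bounded_linear_vec_nth]) simp

lemma has_derivative_coord:
  assumes "(h has_real_derivative h') (at (x $ i))"
  shows "((\<lambda>x. h (x $ i)) has_derivative (\<lambda>v. v $ i * h')) (at (x :: plane))"
  using has_derivative_compose[OF has_derivative_nth, where g = h and g' = "\<lambda>y. y * h'"]
    assms by (simp add: has_field_derivative_def has_derivative_at_withinI mult_commute_abs)

lemma pd_coord:
  assumes "(h has_real_derivative h') (at (x $ i))"
  shows "pd j (\<lambda>x. h (x $ i)) x = (if i = j then h' else 0)"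
  using pd_eqI[OF has_derivative_coord[OF assms]] by (simp add: axis_def)

lemma C_k_differentiable: "C_k (Suc k) f \<Longrightarrow> f differentiable (at x)"
  by simp

lemma C_k_lower: "C_k (Suc k) f \<Longrightarrow> C_k k f"
proof (induction k arbitrary: f)
  case 0
  then show ?case
    by (auto intro!: continuous_at_imp_continuous_on differentiable_imp_continuous_within)
qed auto

lemma C_k_add: "C_k k f \<Longrightarrow> C_k k g \<Longrightarrow> C_k k (\<lambda>x. f x + g x)"
proof (induction k arbitrary: f g)
  case 0
  then show ?case by (auto intro: continuous_intros)
next
  case (Suc k)
  then have "pd i (\<lambda>x. f x + g x) = (\<lambda>x. pd i f x + pd i g x)" for i
    by (intro ext pd_add) auto
  then show ?case using Suc by auto
qed

lemma C_k_mult: "C_k k f \<Longrightarrow> C_k k g \<Longrightarrow> C_k k (\<lambda>x. f x * g x)"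
proof (induction k arbitrary: f g)
  case 0
  then show ?case by (auto intro: continuous_intros)
next
  case (Suc k)
  then have eq: "pd i (\<lambda>x. f x * g x) = (\<lambda>x. pd i f x * g x + f x * pd i g x)" for i
    by (intro ext pd_mult) auto
  have "C_k k f" "C_k k g" using Suc.prems by (auto intro: C_k_lower)
  then show ?case using Suc by (auto simp: eq intro!: C_k_add)
qed

lemma C_k_const: "C_k k (\<lambda>x. c)"
  by (induction k arbitrary: c) auto

lemma smooth_differentiable: "smooth f \<Longrightarrow> f differentiable (at x)"
  unfolding smooth_def by (metis C_k_differentiable)

lemma smooth_pd [intro]: "smooth f \<Longrightarrow> smooth (pd i f)"
  unfolding smooth_def by (meson C_k.simps(2))

lemma smooth_continuous: "smooth f \<Longrightarrow> continuous_on S f"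
  unfolding smooth_def by (metis C_k.simps(1) continuous_on_subset subset_UNIV)

lemma smooth_add [intro]: "smooth f \<Longrightarrow> smooth g \<Longrightarrow> smooth (\<lambda>x. f x + g x)"
  by (simp add: smooth_def C_k_add)

lemma smooth_mult [intro]: "smooth f \<Longrightarrow> smooth g \<Longrightarrow> smooth (\<lambda>x. f x * g x)"
  by (simp add: smooth_def C_k_mult)

lemma smooth_const [intro, simp]: "smooth (\<lambda>x. c)"
  by (simp add: smooth_def C_k_const)

lemma smooth_diff [intro]:
  assumes "smooth f" "smooth g"
  shows "smooth (\<lambda>x. f x - g x)"
  using smooth_add[OF assms(1) smooth_mult[OF smooth_const[of "-1"] assms(2)]] by simp

lemma smooth_power [intro]: "smooth f \<Longrightarrow> smooth (\<lambda>x. (f x) ^ n)"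
  by (induction n) auto

lemma pd_diff:
  assumes "f differentiable (at x)" "g differentiable (at x)"
  shows "pd i (\<lambda>x. f x - g x) x = pd i f x - pd i g x"
  using pd_eqI[OF has_derivative_diff[OF pd_works[OF assms(1)] pd_works[OF assms(2)]]]
  by (simp add: pd_def)

text \<open>The sequence \<open>D\<close> lists the derivatives of all orders, which is what the induction on the
order of differentiability consumes.\<close>

lemma smooth_coord:
  assumes "\<And>n t. (D n has_real_derivative D (Suc n) t) (at t)"
  shows "smooth (\<lambda>x. D n (x $ i))"
  unfolding smooth_def
proof
  fix k
  show "C_k k (\<lambda>x. D n (x $ i))"
  proof (induction k arbitrary: n)
    case 0
    have "isCont (D n) t" for t using assms DERIV_isCont by blast
    then have c1: "continuous_on UNIV (D n)" by (simp add: continuous_at_imp_continuous_on)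
    have c2: "continuous_on UNIV (\<lambda>x :: plane. x $ i)" by (intro continuous_intros)
    show ?case using continuous_on_compose2[OF c1 c2] by simp
  next
    case (Suc k)
    have "pd j (\<lambda>x. D n (x $ i)) = (if i = j then (\<lambda>x. D (Suc n) (x $ i)) else (\<lambda>x. 0))" for j
      by (rule ext) (simp add: pd_coord[OF assms])
    moreover have "(\<lambda>x. D n (x $ i)) differentiable (at x)" for x :: plane
      using has_derivative_coord[OF assms] by (auto simp: differentiable_def)
    ultimately show ?case using Suc C_k_const[of k 0] by auto
  qed
qed

lemma smooth_nth [intro, simp]: "smooth (\<lambda>x. x $ i)"
proof -
  have "smooth (\<lambda>x. (case (0::nat) of 0 \<Rightarrow> (\<lambda>t. t) | Suc 0 \<Rightarrow> (\<lambda>t. 1) | _ \<Rightarrow> (\<lambda>t. 0 :: real)) (x $ i))"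
    by (rule smooth_coord) (auto split: nat.split intro!: derivative_eq_intros)
  then show ?thesis by simp
qed

lemma smooth_exp_coord [intro, simp]: "smooth (\<lambda>x. exp (a * x $ i))"
proof -
  have "smooth (\<lambda>x. (\<lambda>n t. a ^ n * exp (a * t)) 0 (x $ i))"
    by (rule smooth_coord) (auto intro!: derivative_eq_intros)
  then show ?thesis by simp
qed

lemma pd_nth: "pd j (\<lambda>x. x $ i) x = (if i = j then 1 else 0)"
  by (rule pd_coord) (auto intro!: derivative_eq_intros)


definition axis_map :: "plane \<Rightarrow> plane \<Rightarrow> plane \<Rightarrow> plane"
  where "axis_map a b x = (\<chi> j. a $ j * x $ j + b $ j)"

lemma axis_map_nth [simp]: "axis_map a b x $ j = a $ j * x $ j + b $ j"
  by (simp add: axis_map_def)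

lemma has_derivative_axis_map: "(axis_map a b has_derivative (\<lambda>h. \<chi> j. a $ j * h $ j)) (at x)"
proof -
  have "axis_map a b = (\<lambda>x. (\<chi> j. a $ j * x $ j) + b)"
    by (auto simp: fun_eq_iff vec_eq_iff)
  moreover have bl: "bounded_linear (\<lambda>x :: plane. \<chi> j. a $ j * x $ j)"
    by (intro linear_conv_bounded_linear[THEN iffD1] linearI) (auto simp: vec_eq_iff algebra_simps)
  moreover have "((\<lambda>x :: plane. (\<chi> j. a $ j * x $ j) + b) has_derivative (\<lambda>h. \<chi> j. a $ j * h $ j)) (at x)"
    by (intro has_derivative_add_const bounded_linear_imp_has_derivative bl)
  ultimately show ?thesis by simp
qed

lemma pd_axis_map:
  assumes "f differentiable (at (axis_map a b x))"
  shows "pd i (\<lambda>x. f (axis_map a b x)) x = a $ i * pd i f (axis_map a b x)"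
    "(\<lambda>x. f (axis_map a b x)) differentiable (at x)"
proof -
  let ?D = "frechet_derivative f (at (axis_map a b x))"
  have D: "((\<lambda>x. f (axis_map a b x)) has_derivative (\<lambda>h. ?D (\<chi> j. a $ j * h $ j))) (at x)"
    using has_derivative_compose[OF has_derivative_axis_map pd_works[OF assms]] .
  then show "(\<lambda>x. f (axis_map a b x)) differentiable (at x)" by (auto simp: differentiable_def)
  have "(\<chi> j. a $ j * axis i 1 $ j) = a $ i *\<^sub>R axis i (1::real)"
    by (auto simp: vec_eq_iff axis_def)
  moreover have "?D (c *\<^sub>R v) = c * ?D v" for c v
    using linear_frechet_derivative[OF assms] by (simp add: linear_cmul)
  ultimately show "pd i (\<lambda>x. f (axis_map a b x)) x = a $ i * pd i f (axis_map a b x)"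
    using pd_eqI[OF D, of i] by (simp add: pd_def)
qed

lemma smooth_axis_map:
  assumes "smooth f"
  shows "smooth (\<lambda>x. f (axis_map a b x))"
proof -
  have "C_k k (\<lambda>x. f (axis_map a b x))" if "C_k k f" for k f
    using that
  proof (induction k arbitrary: f)
    case 0
    have c1: "continuous_on UNIV (axis_map a b)"
      by (meson continuous_at_imp_continuous_on has_derivative_continuous has_derivative_axis_map)
    have c2: "continuous_on UNIV f" using 0 by simp
    show ?case using continuous_on_compose2[OF c2 c1] by simp
  next
    case (Suc k)
    then have "pd i (\<lambda>x. f (axis_map a b x)) = (\<lambda>x. a $ i * pd i f (axis_map a b x))" for i
      by (intro ext pd_axis_map) auto
    then show ?case using Suc by (auto intro!: C_k_mult C_k_const pd_axis_map)
  qed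
  then show ?thesis using assms by (simp add: smooth_def)
qed


lemma pd_line:
  assumes "f differentiable (at (x + t *\<^sub>R axis i 1))"
  shows "((\<lambda>t. f (x + t *\<^sub>R axis i 1)) has_real_derivative pd i f (x + t *\<^sub>R axis i 1)) (at t)"
proof -
  let ?y = "x + t *\<^sub>R axis i (1::real)"
  have "((\<lambda>t. f (x + t *\<^sub>R axis i 1)) has_derivative (\<lambda>s. frechet_derivative f (at ?y) (s *\<^sub>R axis i 1))) (at t)"
    by (rule has_derivative_compose[where f = "\<lambda>t. x + t *\<^sub>R axis i 1"])
       (use pd_works[OF assms] in \<open>auto intro!: derivative_eq_intros\<close>)
  moreover have "frechet_derivative f (at ?y) (s *\<^sub>R axis i 1) = s * pd i f ?y" for s
    using linear_frechet_derivative[OF assms] by (simp add: linear_cmul pd_def)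
  ultimately show ?thesis by (simp add: has_field_derivative_def mult_commute_abs)
qed

text \<open>The mean value theorem, once in each direction. The left side is symmetric in \<open>i\<close> and \<open>j\<close>,
the right side names a mixed derivative in one order; this is the source of \<open>pd_commute\<close>.\<close>

lemma pd_difference_quotient:
  assumes "smooth f" "h > 0"
  obtains a b where "a \<in> {0<..<h}" "b \<in> {0<..<h}"
    "f (x + h *\<^sub>R axis i 1 + h *\<^sub>R axis j 1) - f (x + h *\<^sub>R axis i 1) - f (x + h *\<^sub>R axis j 1) + f x
      = h\<^sup>2 * pd j (pd i f) (x + a *\<^sub>R axis i 1 + b *\<^sub>R axis j 1)"
proof -
  let ?e = "axis i (1::real) :: plane" and ?d = "axis j (1::real) :: plane"
  have df: "f differentiable (at y)" "pd i f differentiable (at y)" for y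
    using assms(1) by (auto intro: smooth_differentiable)
  let ?g = "\<lambda>s. f ((x + h *\<^sub>R ?d) + s *\<^sub>R ?e) - f (x + s *\<^sub>R ?e)"
  have "\<exists>a>0. a < h \<and> ?g h - ?g 0 =
      (h - 0) * (pd i f ((x + h *\<^sub>R ?d) + a *\<^sub>R ?e) - pd i f (x + a *\<^sub>R ?e))"
    by (rule MVT2[OF assms(2)]) (intro DERIV_diff pd_line df)
  then obtain a where a: "0 < a" "a < h"
    "?g h - ?g 0 = (h - 0) * (pd i f ((x + h *\<^sub>R ?d) + a *\<^sub>R ?e) - pd i f (x + a *\<^sub>R ?e))"
    by blast
  have "\<exists>b>0. b < h \<and> pd i f ((x + a *\<^sub>R ?e) + h *\<^sub>R ?d) - pd i f ((x + a *\<^sub>R ?e) + 0 *\<^sub>R ?d) =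
      (h - 0) * pd j (pd i f) ((x + a *\<^sub>R ?e) + b *\<^sub>R ?d)"
    by (rule MVT2[OF assms(2)]) (intro pd_line df)
  then obtain b where b: "0 < b" "b < h"
    "pd i f ((x + a *\<^sub>R ?e) + h *\<^sub>R ?d) - pd i f ((x + a *\<^sub>R ?e) + 0 *\<^sub>R ?d) =
      (h - 0) * pd j (pd i f) ((x + a *\<^sub>R ?e) + b *\<^sub>R ?d)"
    by blast
  show thesis
  proof (rule that)
    show "a \<in> {0<..<h}" "b \<in> {0<..<h}" using a b by auto
    have "f (x + h *\<^sub>R ?e + h *\<^sub>R ?d) - f (x + h *\<^sub>R ?e) - f (x + h *\<^sub>R ?d) + f x = ?g h - ?g 0"
      by (simp add: algebra_simps)
    also have "\<dots> = h * (h * pd j (pd i f) (x + a *\<^sub>R ?e + b *\<^sub>R ?d))"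
      using a(3) b(3) by (simp add: algebra_simps)
    finally show "f (x + h *\<^sub>R ?e + h *\<^sub>R ?d) - f (x + h *\<^sub>R ?e) - f (x + h *\<^sub>R ?d) + f x
      = h\<^sup>2 * pd j (pd i f) (x + a *\<^sub>R ?e + b *\<^sub>R ?d)" by (simp add: power2_eq_square)
  qed
qed

lemma pd_commute:
  assumes "smooth f"
  shows "pd i (pd j f) x = pd j (pd i f) x"
proof -
  let ?e = "\<lambda>i. axis i (1::real) :: plane"
  define h where "h n = 1 / real (Suc n)" for n
  have h: "h n > 0" for n by (simp add: h_def)
  have h0: "h \<longlonglongrightarrow> 0" unfolding h_def using LIMSEQ_inverse_real_of_nat by (simp add: inverse_eq_divide)
  let ?D = "\<lambda>n. (f (x + h n *\<^sub>R ?e i + h n *\<^sub>R ?e j) - f (x + h n *\<^sub>R ?e i) - f (x + h n *\<^sub>R ?e j) + f x) / (h n)\<^sup>2"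
  have lim: "D \<longlonglongrightarrow> pd j (pd i f) x"
    if D: "\<And>n. \<exists>a\<in>{0<..<h n}. \<exists>b\<in>{0<..<h n}. D n = pd j (pd i f) (x + a *\<^sub>R ?e i + b *\<^sub>R ?e j)"
    for D i j
  proof -
    obtain a b where ab: "\<And>n. a n \<in> {0<..<h n}" "\<And>n. b n \<in> {0<..<h n}"
      "\<And>n. D n = pd j (pd i f) (x + a n *\<^sub>R ?e i + b n *\<^sub>R ?e j)"
      using D by metis
    have "a \<longlonglongrightarrow> 0"
      by (rule tendsto_sandwich[OF _ _ tendsto_const h0]) (use ab(1) in \<open>auto intro!: always_eventually less_imp_le\<close>)
    moreover have "b \<longlonglongrightarrow> 0"
      by (rule tendsto_sandwich[OF _ _ tendsto_const h0]) (use ab(2) in \<open>auto intro!: always_eventually less_imp_le\<close>)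
    ultimately have "(\<lambda>n. x + a n *\<^sub>R ?e i + b n *\<^sub>R ?e j) \<longlonglongrightarrow> x + 0 *\<^sub>R ?e i + 0 *\<^sub>R ?e j"
      by (intro tendsto_intros)
    moreover have "isCont (pd j (pd i f)) x"
      using assms by (auto intro!: differentiable_imp_continuous_within smooth_differentiable)
    ultimately show ?thesis
      unfolding ab(3) by (auto intro: isCont_tendsto_compose)
  qed
  have hn: "h n \<noteq> 0" for n using h[of n] by simp
  have "?D \<longlonglongrightarrow> pd j (pd i f) x"
  proof (rule lim)
    fix n
    obtain a b where ab: "a \<in> {0<..<h n}" "b \<in> {0<..<h n}"
      "f (x + h n *\<^sub>R ?e i + h n *\<^sub>R ?e j) - f (x + h n *\<^sub>R ?e i) - f (x + h n *\<^sub>R ?e j) + f x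
      = (h n)\<^sup>2 * pd j (pd i f) (x + a *\<^sub>R ?e i + b *\<^sub>R ?e j)"
      using pd_difference_quotient[OF assms h] .
    have "?D n = pd j (pd i f) (x + a *\<^sub>R ?e i + b *\<^sub>R ?e j)"
      unfolding ab(3) using hn[of n] by simp
    with ab(1,2) show "\<exists>a\<in>{0<..<h n}. \<exists>b\<in>{0<..<h n}. ?D n = pd j (pd i f) (x + a *\<^sub>R ?e i + b *\<^sub>R ?e j)"
      by blast
  qed
  moreover have "?D \<longlonglongrightarrow> pd i (pd j f) x"
  proof (rule lim)
    fix n
    obtain a b where ab: "a \<in> {0<..<h n}" "b \<in> {0<..<h n}"
      "f (x + h n *\<^sub>R ?e j + h n *\<^sub>R ?e i) - f (x + h n *\<^sub>R ?e j) - f (x + h n *\<^sub>R ?e i) + f x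
      = (h n)\<^sup>2 * pd i (pd j f) (x + a *\<^sub>R ?e j + b *\<^sub>R ?e i)"
      using pd_difference_quotient[OF assms h] .
    have eq: "f (x + h n *\<^sub>R ?e i + h n *\<^sub>R ?e j) - f (x + h n *\<^sub>R ?e i) - f (x + h n *\<^sub>R ?e j) + f x
      = (h n)\<^sup>2 * pd i (pd j f) (x + a *\<^sub>R ?e j + b *\<^sub>R ?e i)"
      using ab(3) by (simp add: add_ac)
    have "?D n = pd i (pd j f) (x + a *\<^sub>R ?e j + b *\<^sub>R ?e i)"
      unfolding eq using hn[of n] by simp
    with ab(1,2) show "\<exists>a\<in>{0<..<h n}. \<exists>b\<in>{0<..<h n}. ?D n = pd i (pd j f) (x + a *\<^sub>R ?e j + b *\<^sub>R ?e i)"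
      by blast
  qed
  ultimately show ?thesis using LIMSEQ_unique by blast
qed

text \<open>The classical function \<open>exp (-1/t)\<close>, extended by zero, with a power of \<open>1/t\<close> as a factor. The
powers are included because they make the family closed under differentiation, up to linear
combinations.\<close>

definition flat :: "nat \<Rightarrow> real \<Rightarrow> real"
  where "flat m t = (if t > 0 then inverse t ^ m * exp (- inverse t) else 0)"

lemma flat_derivative:
  "(flat m has_real_derivative (flat (m + 2) t - real m * flat (m + 1) t)) (at t)"
proof -
  consider "t > 0" | "t < 0" | "t = 0" by linarith
  then show ?thesis
  proof cases
    case 1
    have "((\<lambda>t. inverse t ^ m * exp (- inverse t)) has_real_derivative
        (flat (m + 2) t - real m * flat (m + 1) t)) (at t)"
    proof -
      have "real m * inverse t ^ (m - Suc 0) * (inverse t * inverse t) = real m * inverse t ^ (m + 1)"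
        by (cases m) (auto simp: algebra_simps)
      then show ?thesis
        using 1 by (auto intro!: derivative_eq_intros simp: flat_def algebra_simps)
    qed
    then show ?thesis
      by (rule DERIV_cong_ev[THEN iffD1, rotated -1, OF _ refl _ refl])
         (use 1 in \<open>auto simp: flat_def eventually_nhds intro!: exI[of _ "{0<..}"]\<close>)
  next
    case 2
    have "((\<lambda>t. 0) has_real_derivative (flat (m + 2) t - real m * flat (m + 1) t)) (at t)"
      using 2 by (auto simp: flat_def)
    then show ?thesis
      by (rule DERIV_cong_ev[THEN iffD1, rotated -1, OF _ refl _ refl])
         (use 2 in \<open>auto simp: flat_def eventually_nhds intro!: exI[of _ "{..<0}"]\<close>)
  next
    case 3
    \<comment> \<open>with \<open>y = 1/h\<close> the difference quotient from the right becomes \<open>y ^ (m + 1) * exp (- y)\<close>\<close>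
    have "((\<lambda>y. y ^ (m + 1) / exp y) \<longlongrightarrow> (0::real)) at_top"
      by (rule tendsto_power_div_exp_0)
    then have "((\<lambda>h. inverse h ^ (m + 1) / exp (inverse h)) \<longlongrightarrow> (0::real)) (at_right 0)"
      by (rule filterlim_compose) (rule filterlim_inverse_at_top_right)
    then have R: "((\<lambda>h. (flat m (0 + h) - flat m 0) / h) \<longlongrightarrow> 0) (at_right 0)"
      by (rule Lim_transform_eventually)
         (auto simp: flat_def eventually_at_right_less exp_minus field_simps
           intro!: eventually_at_rightI[of 0 1])
    have L: "((\<lambda>h. (flat m (0 + h) - flat m 0) / h) \<longlongrightarrow> 0) (at_left 0)"
      by (rule Lim_transform_eventually[OF tendsto_const])
         (auto simp: flat_def intro!: eventually_at_leftI[of "-1" 0])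
    from L R show ?thesis
      unfolding 3 DERIV_def by (simp add: filterlim_split_at flat_def)
  qed
qed

lemma smooth_flat [intro]: "smooth (\<lambda>x. flat m (a * x $ i + b))"
  unfolding smooth_def
proof
  fix k
  show "C_k k (\<lambda>x. flat m (a * x $ i + b))"
  proof (induction k arbitrary: m)
    case 0
    have c1: "continuous_on UNIV (flat m)"
      by (meson DERIV_isCont continuous_at_imp_continuous_on flat_derivative)
    have c2: "continuous_on UNIV (\<lambda>x :: plane. a * x $ i + b)" by (intro continuous_intros)
    show ?case using continuous_on_compose2[OF c1 c2] by simp
  next
    case (Suc k)
    let ?D = "\<lambda>t. (flat (m + 2) (a * t + b) - real m * flat (m + 1) (a * t + b)) * a"
    have D: "((\<lambda>t. flat m (a * t + b)) has_real_derivative ?D t) (at t)" for t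
    proof -
      have "((\<lambda>t. a * t + b) has_real_derivative a) (at t)"
        by (auto intro!: derivative_eq_intros)
      from DERIV_chain'[OF this flat_derivative] show ?thesis .
    qed
    have "pd j (\<lambda>x. flat m (a * x $ i + b)) =
        (\<lambda>x. (if i = j then a else 0) * (flat (m + 2) (a * x $ i + b) + (- real m) * flat (m + 1) (a * x $ i + b)))" for j
      by (rule ext) (simp add: pd_coord[OF D])
    moreover have "(\<lambda>x. flat m (a * x $ i + b)) differentiable (at x)" for x :: plane
      using has_derivative_coord[OF D] by (auto simp: differentiable_def)
    moreover have "C_k k (\<lambda>x. (if i = j then a else 0) *
        (flat (m + 2) (a * x $ i + b) + (- real m) * flat (m + 1) (a * x $ i + b)))" for j
      by (intro C_k_mult C_k_add C_k_const Suc.IH)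
    ultimately show ?case by (simp only: C_k.simps) blast
  qed
qed

section \<open>Integration over the unit square\<close>

abbreviation OM :: "plane measure"
  where "OM \<equiv> restrict_space lborel Omega"

lemma Omega_box: "Omega = box 0 1"
  by (auto simp: Omega_def mem_box_cart)

lemma Omega_sets [measurable, simp]: "Omega \<in> sets borel" "Omega \<in> sets lborel"
  by (auto simp: Omega_box)

lemma Basis_plane: "(Basis :: plane set) = {axis 1 1, axis 2 1}"
  by (auto simp: Basis_vec_def) (metis exhaust_2)

lemma prod_Basis_plane:
  fixes f :: "plane \<Rightarrow> 'a::comm_monoid_mult"
  shows "(\<Prod>b\<in>Basis. f b) = f (axis 1 1) * f (axis 2 1 :: plane)"
proof -
  have "axis 1 1 \<noteq> (axis 2 1 :: plane)" by (simp add: axis_eq_axis)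
  then show ?thesis unfolding Basis_plane by simp
qed

lemma emeasure_Omega: "emeasure lborel Omega = 1"
proof -
  have "(0::plane) \<bullet> b \<le> 1 \<bullet> b" if "b \<in> Basis" for b
    using that by (auto simp: Basis_vec_def inner_axis)
  from emeasure_lborel_box[OF this] show ?thesis
    by (simp add: Omega_box prod_Basis_plane inner_axis)
qed

lemma space_OM [simp]: "space OM = Omega"
  by (simp add: space_restrict_space)

interpretation OM: finite_measure OM
  by standard (simp add: emeasure_restrict_space emeasure_Omega Int_absorb2)

lemma measure_OM: "measure OM Omega = 1"
  by (subst measure_restrict_space) (auto simp: measure_def emeasure_Omega)

lemma LINT_Omega: "(LINT x:Omega|lborel. F x) = (\<integral>x. F x \<partial>OM)" for F :: "plane \<Rightarrow> real"
  by (simp add: set_lebesgue_integral_def integral_restrict_space)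

lemma L2_sq_int: "L2 = sq_int OM"
  by (auto simp: L2_def sq_int_def set_borel_measurable_def set_integrable_def
      borel_measurable_restrict_space_iff integrable_restrict_space)

lemma Omega_cbox: "x \<in> Omega \<Longrightarrow> x \<in> cbox 0 1"
  using box_subset_cbox[of 0 "1::plane"] by (auto simp: Omega_box)

lemma continuous_bounded_cbox:
  assumes "continuous_on UNIV (f :: plane \<Rightarrow> real)"
  obtains B where "B > 0" "\<And>x. x \<in> cbox 0 1 \<Longrightarrow> \<bar>f x\<bar> \<le> B"
proof -
  have "compact (f ` cbox 0 1)"
    by (intro compact_continuous_image continuous_on_subset[OF assms]) auto
  then obtain B where "B > 0" "\<And>y. y \<in> f ` cbox 0 1 \<Longrightarrow> norm y \<le> B"
    using compact_imp_bounded bounded_pos by metis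
  then show ?thesis by (intro that[of B]) auto
qed

lemma continuous_measurable_OM:
  "continuous_on UNIV (f :: plane \<Rightarrow> real) \<Longrightarrow> f \<in> borel_measurable OM"
  by (intro measurable_restrict_space1) (simp add: borel_measurable_continuous_onI)

lemma continuous_sq_int:
  assumes "continuous_on UNIV (f :: plane \<Rightarrow> real)"
  shows "f \<in> sq_int OM"
proof -
  obtain B where B: "\<And>x. x \<in> cbox 0 1 \<Longrightarrow> \<bar>f x\<bar> \<le> B"
    using continuous_bounded_cbox[OF assms] by metis
  show ?thesis
    by (rule OM.bounded_sq_int[of _ B]) (use B Omega_cbox assms in \<open>auto intro: continuous_measurable_OM\<close>)
qed

lemma smooth_sq_int: "smooth f \<Longrightarrow> f \<in> sq_int OM"
  by (rule continuous_sq_int) (rule smooth_continuous)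

lemma smooth_integrable: "smooth f \<Longrightarrow> integrable OM f"
  by (intro OM.sq_int_integrable1 smooth_sq_int)

text \<open>Points given by their coordinates, as a map from pairs under which Lebesgue measure on the
plane is the image of the product measure.\<close>

definition pt :: "real \<Rightarrow> real \<Rightarrow> plane"
  where "pt s t = vector [s, t]"

lemma pt_nth [simp]: "pt s t $ 1 = s" "pt s t $ 2 = t"
  by (simp_all add: pt_def)

lemma pt_axis: "pt s t = s *\<^sub>R axis 1 1 + t *\<^sub>R axis 2 1"
  by (simp add: vec_eq_iff forall_2 axis_def)

lemma pt_collapse: "pt (x $ 1) (x $ 2) = x"
  by (simp add: vec_eq_iff forall_2)

lemma continuous_pt: "continuous_on UNIV (\<lambda>p. pt (fst p) (snd p))"
  unfolding pt_axis by (intro continuous_intros)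

lemma pt_Omega: "pt s t \<in> Omega \<longleftrightarrow> s \<in> {0<..<1} \<and> t \<in> {0<..<1}"
  by (auto simp: Omega_def forall_2)

lemma measurable_pt [measurable]: "(\<lambda>p. pt (fst p) (snd p)) \<in> borel_measurable (lborel \<Otimes>\<^sub>M lborel)"
proof -
  have "(\<lambda>p. pt (fst p) (snd p)) \<in> borel_measurable (borel :: (real \<times> real) measure)"
    by (rule borel_measurable_continuous_onI[OF continuous_pt])
  then show ?thesis by (simp add: lborel_prod)
qed

text \<open>The two measures agree on boxes, where both are the product of the side lengths.\<close>

lemma lborel_plane: "lborel = distr (lborel \<Otimes>\<^sub>M lborel) borel (\<lambda>p. pt (fst p) (snd p))"
proof (rule lborel_eqI)
  fix l u :: plane
  assume le: "\<And>b. b \<in> Basis \<Longrightarrow> l \<bullet> b \<le> u \<bullet> b"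
  have le': "l $ i \<le> u $ i" for i
    using le[of "axis i 1"] by (simp add: inner_axis)
  have "(\<lambda>p. pt (fst p) (snd p)) -` box l u \<inter> space (lborel \<Otimes>\<^sub>M lborel) = {l$1<..<u$1} \<times> {l$2<..<u$2}"
    by (auto simp: mem_box_cart forall_2 space_pair_measure)
  then show "emeasure (distr (lborel \<Otimes>\<^sub>M lborel) borel (\<lambda>p. pt (fst p) (snd p))) (box l u) =
      ennreal (\<Prod>b\<in>Basis. (u - l) \<bullet> b)"
    using le'
    by (subst emeasure_distr)
       (auto simp: lborel.emeasure_pair_measure_Times prod_Basis_plane inner_axis ennreal_mult)
qed simp

lemma
  fixes F :: "plane \<Rightarrow> real"
  assumes F: "continuous_on UNIV F"
  shows integral_OM_21: "(\<integral>x. F x \<partial>OM) =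
      (\<integral>s. indicator {0<..<1} s * (\<integral>t. F (pt s t) * indicator {0<..<1} t \<partial>lborel) \<partial>lborel)"
    and integral_OM_12: "(\<integral>x. F x \<partial>OM) =
      (\<integral>t. indicator {0<..<1} t * (\<integral>s. F (pt s t) * indicator {0<..<1} s \<partial>lborel) \<partial>lborel)"
proof -
  let ?I = "indicator {0<..<1::real} :: real \<Rightarrow> real"
  let ?G = "\<lambda>s t. ?I s * ?I t * F (pt s t)"
  have ind: "indicator Omega (pt s t) = ?I s * ?I t" for s t
    using pt_Omega[of s t] by (auto simp: indicator_def)
  have m: "(\<lambda>x. indicator Omega x * F x) \<in> borel_measurable borel"
    using borel_measurable_continuous_onI[OF F] by measurable
  have "integrable OM F" by (intro OM.sq_int_integrable1 continuous_sq_int F)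
  then have "integrable lborel (\<lambda>x. indicator Omega x * F x)"
    by (simp add: integrable_restrict_space)
  then have int: "integrable (lborel \<Otimes>\<^sub>M lborel) (case_prod ?G)"
    by (subst (asm) lborel_plane, subst (asm) integrable_distr_eq)
       (use m in \<open>auto simp: ind case_prod_unfold\<close>)
  have "(\<integral>x. F x \<partial>OM) = (\<integral>x. indicator Omega x * F x \<partial>lborel)"
    by (simp add: integral_restrict_space)
  also have "\<dots> = (\<integral>p. case_prod ?G p \<partial>(lborel \<Otimes>\<^sub>M lborel))"
    by (subst lborel_plane, subst integral_distr) (use m in \<open>auto simp: ind case_prod_unfold\<close>)
  finally have eq: "(\<integral>x. F x \<partial>OM) = (\<integral>p. case_prod ?G p \<partial>(lborel \<Otimes>\<^sub>M lborel))" .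
  show "(\<integral>x. F x \<partial>OM) = (\<integral>s. ?I s * (\<integral>t. F (pt s t) * ?I t \<partial>lborel) \<partial>lborel)"
    unfolding eq lborel_pair.integral_fst'[OF int, symmetric]
    by (simp add: mult.assoc mult.commute[of "F _"])
  have "(\<integral>x. F x \<partial>OM) = (\<integral>t. (\<integral>s. ?G s t \<partial>lborel) \<partial>lborel)"
    unfolding eq lborel_pair.integral_snd[OF int] ..
  also have "\<dots> = (\<integral>t. ?I t * (\<integral>s. F (pt s t) * ?I s \<partial>lborel) \<partial>lborel)"
    by (simp flip: integral_mult_right_zero add: mult_ac)
  finally show "(\<integral>x. F x \<partial>OM) = (\<integral>t. ?I t * (\<integral>s. F (pt s t) * ?I s \<partial>lborel) \<partial>lborel)" .
qed

lemma integral_FTC_open: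
  assumes "\<And>t. (h has_real_derivative h' t) (at t)" "\<And>t. isCont h' t"
  shows "(\<integral>t. h' t * indicator {0<..<1} t \<partial>lborel) = h 1 - h (0::real)"
proof -
  have c: "continuous_on UNIV h'" using assms(2) by (simp add: continuous_at_imp_continuous_on)
  have [measurable]: "h' \<in> borel_measurable borel" by (rule borel_measurable_continuous_onI[OF c])
  have "(\<integral>t. h' t * indicator {0<..<1} t \<partial>lborel) = (\<integral>t. h' t * indicator {0..1} t \<partial>lborel)"
    by (rule integral_cong_AE)
       (use AE_lborel_singleton[of "0::real"] AE_lborel_singleton[of "1::real"] in
         \<open>auto elim!: eventually_elim2 simp: indicator_def\<close>)
  also have "\<dots> = h 1 - h 0"
    by (rule integral_FTC_Icc_real) (use assms in auto)
  finally show ?thesis .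
qed

lemma smooth_isCont: "smooth f \<Longrightarrow> isCont f x"
  using smooth_differentiable differentiable_imp_continuous_within by blast

lemma pd1_line:
  assumes "smooth f"
  shows "((\<lambda>s. f (pt s t)) has_real_derivative pd 1 f (pt s t)) (at s)"
  using pd_line[of f "t *\<^sub>R axis 2 1" s 1] assms
  by (simp add: smooth_differentiable pt_axis add.commute)

lemma pd2_line:
  assumes "smooth f"
  shows "((\<lambda>t. f (pt s t)) has_real_derivative pd 2 f (pt s t)) (at t)"
  using pd_line[of f "s *\<^sub>R axis 1 1" t 2] assms
  by (simp add: smooth_differentiable pt_axis)

lemma integral_pd2:
  assumes "smooth f"
  shows "(\<integral>x. pd 2 f x \<partial>OM) =
    (\<integral>s. indicator {0<..<1} s * (f (pt s 1) - f (pt s 0)) \<partial>lborel)"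
proof -
  have "isCont (\<lambda>t. pd 2 f (pt s t)) t" for s t
    by (rule isCont_o2[OF _ smooth_isCont]) (use assms in \<open>auto simp: pt_axis intro!: continuous_intros\<close>)
  then show ?thesis
    by (subst integral_OM_21)
       (auto simp: integral_FTC_open[OF pd2_line[OF assms]] intro: smooth_continuous assms)
qed

lemma integral_pd1:
  assumes "smooth f"
  shows "(\<integral>x. pd 1 f x \<partial>OM) =
    (\<integral>t. indicator {0<..<1} t * (f (pt 1 t) - f (pt 0 t)) \<partial>lborel)"
proof -
  have "isCont (\<lambda>s. pd 1 f (pt s t)) s" for s t
    by (rule isCont_o2[OF _ smooth_isCont]) (use assms in \<open>auto simp: pt_axis intro!: continuous_intros\<close>)
  then show ?thesis
    by (subst integral_OM_12)
       (auto simp: integral_FTC_open[OF pd1_line[OF assms]] intro: smooth_continuous assms)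
qed

text \<open>By Fubini's theorem and the fundamental theorem of calculus the integral of a partial
derivative is a difference of integrals over the two edges orthogonal to its direction.\<close>

lemma integral_pd_zero:
  assumes f: "smooth f" and zero: "\<And>x. x \<in> cbox 0 1 \<Longrightarrow> x $ i \<in> {0, 1} \<Longrightarrow> f x = 0"
  shows "(\<integral>x. pd i f x \<partial>OM) = 0"
proof (cases "i = 1")
  case True
  have "f (pt 1 t) = 0" "f (pt 0 t) = 0" if "t \<in> {0<..<1}" for t
    using that True by (auto intro!: zero simp: mem_box_cart forall_2)
  then show ?thesis
    unfolding True integral_pd1[OF f] by (intro integral_eq_zero_AE AE_I2) (auto simp: indicator_def)
next
  case False
  then have i: "i = 2" using exhaust_2 by blast
  have "f (pt s 1) = 0" "f (pt s 0) = 0" if "s \<in> {0<..<1}" for s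
    using that i by (auto intro!: zero simp: mem_box_cart forall_2)
  then show ?thesis
    unfolding i integral_pd2[OF f] by (intro integral_eq_zero_AE AE_I2) (auto simp: indicator_def)
qed

lemma integral_parts_smooth:
  assumes f: "smooth f" and g: "smooth g"
    and zero: "\<And>x. x \<in> cbox 0 1 \<Longrightarrow> x $ i \<in> {0, 1} \<Longrightarrow> f x * g x = 0"
  shows "(\<integral>x. f x * pd i g x \<partial>OM) = - (\<integral>x. pd i f x * g x \<partial>OM)"
proof -
  have "pd i (\<lambda>x. f x * g x) = (\<lambda>x. pd i f x * g x + f x * pd i g x)"
    using f g by (intro ext pd_mult) (auto intro: smooth_differentiable)
  then have "(\<integral>x. pd i f x * g x + f x * pd i g x \<partial>OM) = 0"
    using integral_pd_zero[of "\<lambda>x. f x * g x" i] f g zero by auto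
  moreover have "integrable OM (\<lambda>x. pd i f x * g x)" "integrable OM (\<lambda>x. f x * pd i g x)"
    using f g by (auto intro!: smooth_integrable)
  ultimately show ?thesis by simp
qed

section \<open>Cutoffs and the boundary behaviour of weak derivatives\<close>

lemma flat_nonneg [simp]: "0 \<le> flat m t"
  by (simp add: flat_def)

lemma flat0_le_1: "flat 0 t \<le> 1"
  by (simp add: flat_def)

lemma exp_neg_quadratic: "0 \<le> y \<Longrightarrow> (y + y\<^sup>2) * exp (- y) \<le> (2::real)"
proof -
  assume y: "0 \<le> y"
  have "y + y\<^sup>2 \<le> 2 * (1 + y + y\<^sup>2 / 2)" using y by (simp add: algebra_simps)
  also have "\<dots> \<le> 2 * exp y" using exp_lower_Taylor_quadratic[OF y] by simp
  finally show ?thesis by (simp add: exp_minus field_simps)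
qed

text \<open>The derivative of \<open>flat 0\<close> is \<open>flat 2\<close>. With \<open>y = 1 / (n * t - 1)\<close> one has
\<open>n * t = 1 + 1 / y\<close>, so that the product on the left no longer depends on \<open>n\<close> other than through
\<open>y\<close>.\<close>

lemma flat2_eq:
  assumes "n * t - 1 > 0"
  shows "t * (n * flat 2 (n * t - 1)) =
    (inverse (n * t - 1) + (inverse (n * t - 1))\<^sup>2) * exp (- inverse (n * t - 1))"
proof -
  define y where "y = inverse (n * t - 1)"
  have y: "y > 0" "n * t = 1 + inverse y" using assms by (simp_all add: y_def)
  have "t * (n * flat 2 (n * t - 1)) = (n * t) * (y\<^sup>2 * exp (- y))"
    using assms by (simp add: flat_def y_def)
  also have "\<dots> = (y + y\<^sup>2) * exp (- y)"
    unfolding y(2) using y(1) by (simp add: field_simps power2_eq_square)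
  finally show ?thesis by (simp add: y_def)
qed

text \<open>Uniformly in \<open>n\<close>, the derivative of the cutoff \<open>flat 0 (n * t - 1)\<close> is at most of the size of
the reciprocal of the distance \<open>t\<close> to the edge. It can therefore be compensated by a factor that
vanishes on the edge.\<close>

lemma flat2_bound:
  assumes "t > 0" "n > 0"
  shows "t * (n * flat 2 (n * t - 1)) \<le> 2"
proof (cases "n * t - 1 > 0")
  case True
  then have "0 \<le> inverse (n * t - 1)" by simp
  from exp_neg_quadratic[OF this] show ?thesis unfolding flat2_eq[OF True] .
qed (simp add: flat_def)

lemma inverse_affine_tendsto_0:
  assumes "t > 0"
  shows "(\<lambda>n. inverse (real n * t - 1)) \<longlonglongrightarrow> 0"
proof (rule tendsto_inverse_0_at_top)
  have "filterlim (\<lambda>n. t * real n) at_top sequentially"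
    using assms by (intro filterlim_tendsto_pos_mult_at_top[OF tendsto_const] filterlim_real_sequentially)
  then have "filterlim (\<lambda>n. - 1 + t * real n) at_top sequentially"
    by (rule filterlim_tendsto_add_at_top[OF tendsto_const])
  then show "filterlim (\<lambda>n. real n * t - 1) at_top sequentially"
    by (simp add: mult.commute)
qed

lemma eventually_affine_pos:
  assumes "t > 0"
  shows "\<forall>\<^sub>F n in sequentially. real n * t - 1 > 0"
proof -
  obtain N where N: "1 / t < real N" using reals_Archimedean2 by blast
  show ?thesis using eventually_ge_at_top[of N]
  proof eventually_elim
    case (elim n)
    then have "1 / t < real n" using N by linarith
    then show ?case using assms by (simp add: field_simps)
  qed
qed

lemma flat0_tendsto:
  assumes "t > 0"
  shows "(\<lambda>n. flat 0 (real n * t - 1)) \<longlonglongrightarrow> 1"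
proof -
  have "(\<lambda>n. exp (- inverse (real n * t - 1))) \<longlonglongrightarrow> exp (- 0)"
    by (intro tendsto_intros inverse_affine_tendsto_0 assms)
  then have "(\<lambda>n. exp (- inverse (real n * t - 1))) \<longlonglongrightarrow> 1" by simp
  then show ?thesis
    by (rule Lim_transform_eventually)
       (use eventually_affine_pos[OF assms] in \<open>eventually_elim, simp add: flat_def\<close>)
qed

lemma flat2_tendsto:
  assumes "t > 0"
  shows "(\<lambda>n. real n * flat 2 (real n * t - 1)) \<longlonglongrightarrow> 0"
proof -
  let ?y = "\<lambda>n. inverse (real n * t - 1)"
  have "(\<lambda>n. (?y n + (?y n)\<^sup>2) * exp (- ?y n) / t) \<longlonglongrightarrow> (0 + 0\<^sup>2) * exp (- 0) / t"
    using assms by (intro tendsto_intros inverse_affine_tendsto_0) auto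
  then have "(\<lambda>n. (?y n + (?y n)\<^sup>2) * exp (- ?y n) / t) \<longlonglongrightarrow> 0" by simp
  then show ?thesis
    by (rule Lim_transform_eventually)
       (use eventually_affine_pos[OF assms] in \<open>eventually_elim,
          use assms in \<open>simp add: flat2_eq[symmetric]\<close>\<close>)
qed

text \<open>As \<open>n\<close> grows, these cutoffs tend to 1 in the open square, while each of them vanishes near the
boundary.\<close>

definition edge_cut :: "nat \<Rightarrow> 2 \<Rightarrow> plane \<Rightarrow> real"
  where "edge_cut n i x = flat 0 (real n * x $ i - 1) * flat 0 (real n * (1 - x $ i) - 1)"

definition cutoff :: "nat \<Rightarrow> plane \<Rightarrow> real"
  where "cutoff n x = edge_cut n 1 x * edge_cut n 2 x"

lemma smooth_edge_cut [intro]: "smooth (edge_cut n i)"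
proof -
  have "smooth (\<lambda>x. flat 0 (real n * x $ i + (- 1)) * flat 0 ((- real n) * x $ i + (real n - 1)))"
    by (intro smooth_mult smooth_flat)
  then show ?thesis unfolding edge_cut_def by (simp add: algebra_simps)
qed

lemma smooth_cutoff [intro]: "smooth (cutoff n)"
  unfolding cutoff_def by auto

lemma edge_cut_range: "0 \<le> edge_cut n i x" "edge_cut n i x \<le> 1"
  by (simp_all add: edge_cut_def mult_le_one flat0_le_1)

lemma cut_range: "0 \<le> cutoff n x" "cutoff n x \<le> 1"
  by (simp_all add: cutoff_def edge_cut_range mult_le_one)

lemma cut_tendsto:
  assumes "x \<in> Omega"
  shows "(\<lambda>n. cutoff n x) \<longlonglongrightarrow> 1"
proof -
  have "0 < x $ i" "0 < 1 - x $ i" for i using assms by (auto simp: Omega_def)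
  then have "(\<lambda>n. cutoff n x) \<longlonglongrightarrow> (1 * 1) * (1 * 1)"
    unfolding cutoff_def edge_cut_def by (intro tendsto_intros flat0_tendsto)
  then show ?thesis by simp
qed

lemma cut_support:
  assumes "n > 0" "cutoff n x \<noteq> 0"
  shows "1 / real n \<le> x $ i \<and> x $ i \<le> 1 - 1 / real n"
proof -
  have "i = 1 \<or> i = 2" by (rule exhaust_2)
  then have "real n * x $ i - 1 > 0" "real n * (1 - x $ i) - 1 > 0"
    using assms by (auto simp: cutoff_def edge_cut_def flat_def split: if_splits)
  then show ?thesis using assms by (simp add: field_simps)
qed

lemma test_function_cut:
  assumes "smooth \<psi>" "n > 0"
  shows "test_function (\<lambda>x. cutoff n x * \<psi> x)"
proof -
  let ?K = "cbox (\<chi> i. 1 / real n) (\<chi> i. 1 - 1 / real n) :: plane set"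
  have sub: "closure {x. cutoff n x * \<psi> x \<noteq> 0} \<subseteq> ?K"
    by (rule closure_minimal) (use cut_support[OF assms(2)] in \<open>auto simp: mem_box_cart\<close>)
  have "compact (closure {x. cutoff n x * \<psi> x \<noteq> 0})"
    using bounded_subset[OF bounded_cbox order_trans[OF closure_subset sub]]
    by (simp only: compact_closure)
  moreover have "?K \<subseteq> Omega"
  proof
    fix x assume x: "x \<in> ?K"
    have n: "0 < 1 / real n" using assms by simp
    have "0 < x $ i \<and> x $ i < 1" for i
    proof -
      have "1 / real n \<le> x $ i \<and> x $ i \<le> 1 - 1 / real n"
        using x by (simp only: mem_box_cart vec_lambda_beta)
      with n show ?thesis by linarith
    qed
    then show "x \<in> Omega" by (simp add: Omega_def)
  qed
  ultimately show ?thesis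
    using sub assms unfolding test_function_def by auto
qed

lemma pd_edge_cut:
  "pd j (edge_cut n i) x = (if i = j then
     real n * flat 2 (real n * x $ i - 1) * flat 0 (real n * (1 - x $ i) - 1)
     - flat 0 (real n * x $ i - 1) * (real n * flat 2 (real n * (1 - x $ i) - 1)) else 0)"
proof -
  have f0: "(flat 0 has_real_derivative flat 2 t) (at t)" for t
    using flat_derivative[of 0 t] by (simp add: numeral_2_eq_2)
  have a: "((\<lambda>t. real n * t - 1) has_real_derivative real n) (at t)" for t
    by (auto intro!: derivative_eq_intros)
  have b: "((\<lambda>t. real n * (1 - t) - 1) has_real_derivative - real n) (at t)" for t
    by (auto intro!: derivative_eq_intros)
  have "((\<lambda>t. flat 0 (real n * t - 1) * flat 0 (real n * (1 - t) - 1)) has_real_derivative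
     real n * flat 2 (real n * t - 1) * flat 0 (real n * (1 - t) - 1)
     - flat 0 (real n * t - 1) * (real n * flat 2 (real n * (1 - t) - 1))) (at t)" for t
    using DERIV_mult[OF DERIV_chain'[OF a f0] DERIV_chain'[OF b f0], of t]
    by (simp add: algebra_simps)
  from pd_coord[OF this] show ?thesis unfolding edge_cut_def by simp
qed

lemma pd_edge_cut_bound:
  assumes "x \<in> Omega" "n > 0"
  shows "\<bar>pd j (edge_cut n j) x\<bar> \<le> 2 / x $ j + 2 / (1 - x $ j)"
proof -
  have p: "0 < x $ j" "0 < 1 - x $ j" using assms by (auto simp: Omega_def)
  have q: "n * flat 2 (n * t - 1) \<le> 2 / t" if "t > 0" for t :: real
    using flat2_bound[OF that, of n] that assms by (simp add: field_simps)
  have "real n * flat 2 (real n * x $ j - 1) * flat 0 (real n * (1 - x $ j) - 1) \<le> 2 / x $ j * 1"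
    by (intro mult_mono q p flat0_le_1) (use p in auto)
  moreover have "flat 0 (real n * x $ j - 1) * (real n * flat 2 (real n * (1 - x $ j) - 1)) \<le> 1 * (2 / (1 - x $ j))"
    by (intro mult_mono q p flat0_le_1) (use p in auto)
  moreover have "0 \<le> real n * flat 2 (real n * x $ j - 1) * flat 0 (real n * (1 - x $ j) - 1)"
    "0 \<le> flat 0 (real n * x $ j - 1) * (real n * flat 2 (real n * (1 - x $ j) - 1))"
    by auto
  ultimately show ?thesis unfolding pd_edge_cut if_P[OF refl] by linarith
qed

lemma pd_edge_cut_tendsto:
  assumes "x \<in> Omega"
  shows "(\<lambda>n. pd j (edge_cut n j) x) \<longlonglongrightarrow> 0"
proof -
  have "0 < x $ j" "0 < 1 - x $ j" using assms by (auto simp: Omega_def)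
  then have "(\<lambda>n. pd j (edge_cut n j) x) \<longlonglongrightarrow> 0 * 1 - 1 * 0"
    unfolding pd_edge_cut if_P[OF refl] by (intro tendsto_intros flat0_tendsto flat2_tendsto)
  then show ?thesis by simp
qed

lemma pd_cut: "pd i (cutoff n) x = pd i (edge_cut n i) x * edge_cut n (if i = 1 then 2 else 1) x"
proof -
  have "edge_cut n k differentiable at x" for k by (intro smooth_differentiable smooth_edge_cut)
  then have "pd i (cutoff n) x = pd i (edge_cut n 1) x * edge_cut n 2 x + edge_cut n 1 x * pd i (edge_cut n 2) x"
    unfolding cutoff_def by (intro pd_mult)
  moreover have "i = 1 \<or> i = 2" by (rule exhaust_2)
  ultimately show ?thesis by (auto simp: pd_edge_cut)
qed

lemma vanishing_bound:
  assumes f: "smooth f" and zero: "\<And>x. x \<in> cbox 0 1 \<Longrightarrow> x $ i \<in> {0, 1} \<Longrightarrow> f x = 0"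
  obtains C where "C \<ge> 0" "\<And>x. x \<in> Omega \<Longrightarrow> \<bar>f x\<bar> \<le> C * x $ i"
    "\<And>x. x \<in> Omega \<Longrightarrow> \<bar>f x\<bar> \<le> C * (1 - x $ i)"
proof -
  obtain C where C: "C > 0" "\<And>x. x \<in> cbox 0 1 \<Longrightarrow> \<bar>pd i f x\<bar> \<le> C"
    using continuous_bounded_cbox[OF smooth_continuous[OF smooth_pd[OF f]]] by metis
  let ?e = "axis i (1::real)"
  have line: "\<bar>f x - f (x + h *\<^sub>R ?e)\<bar> \<le> C * \<bar>h\<bar>"
    if x: "x \<in> cbox 0 1" and h: "x + h *\<^sub>R ?e \<in> cbox 0 1" for x h
  proof -
    have seg: "x + (t * h) *\<^sub>R ?e \<in> cbox 0 1" if "0 \<le> t" "t \<le> 1" for t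
    proof -
      have "(1 - t) *\<^sub>R x + t *\<^sub>R (x + h *\<^sub>R ?e) \<in> cbox 0 1"
        using convexD[OF convex_box(1) x h, of "1 - t" t] that by simp
      then show ?thesis by (simp add: algebra_simps)
    qed
    have d: "((\<lambda>t. f (x + (t * h) *\<^sub>R ?e)) has_real_derivative pd i f (x + (t * h) *\<^sub>R ?e) * h) (at t)" for t
      by (rule DERIV_chain'[where g = "\<lambda>s. f (x + s *\<^sub>R ?e)" and f = "\<lambda>t. t * h"])
         (auto intro!: derivative_eq_intros pd_line smooth_differentiable f)
    have "\<exists>t>0. t < 1 \<and> f (x + (1 * h) *\<^sub>R ?e) - f (x + (0 * h) *\<^sub>R ?e) = (1 - 0) * (pd i f (x + (t * h) *\<^sub>R ?e) * h)"
      by (rule MVT2[where f = "\<lambda>t. f (x + (t * h) *\<^sub>R ?e)"]) (use d in auto)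
    then obtain t where t: "0 < t" "t < 1" "f (x + h *\<^sub>R ?e) - f x = pd i f (x + (t * h) *\<^sub>R ?e) * h"
      by auto
    have "\<bar>f (x + h *\<^sub>R ?e) - f x\<bar> \<le> C * \<bar>h\<bar>"
      unfolding t(3) abs_mult by (intro mult_right_mono C seg) (use t in auto)
    then show ?thesis by (simp add: abs_minus_commute)
  qed
  show thesis
  proof (rule that[of C])
    fix x assume "x \<in> Omega"
    then have x: "x \<in> cbox 0 1" "0 < x $ i" "x $ i < 1" by (auto simp: Omega_cbox Omega_def)
    have a: "x + (- x $ i) *\<^sub>R ?e \<in> cbox 0 1" "x + (1 - x $ i) *\<^sub>R ?e \<in> cbox 0 1"
      using x by (auto simp: mem_box_cart axis_def)
    have "f (x + (- x $ i) *\<^sub>R ?e) = 0" "f (x + (1 - x $ i) *\<^sub>R ?e) = 0"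
      by (intro zero a; simp)+
    then show "\<bar>f x\<bar> \<le> C * x $ i" "\<bar>f x\<bar> \<le> C * (1 - x $ i)"
      using line[OF x(1) a(1)] line[OF x(1) a(2)] x by auto
  qed (use C in simp)
qed

lemma cut_tendsto_l2:
  assumes f: "smooth \<psi>"
  shows "(\<lambda>n. l2n OM (\<lambda>x. cutoff (Suc n) x * \<psi> x - \<psi> x)) \<longlonglongrightarrow> 0"
proof (rule l2n_dominated_tendsto[of "\<psi>"])
  show "\<bar>cutoff (Suc n) x * \<psi> x - \<psi> x\<bar> \<le> \<bar>\<psi> x\<bar>" for n x
  proof -
    have "\<bar>cutoff (Suc n) x * \<psi> x - \<psi> x\<bar> = \<bar>cutoff (Suc n) x - 1\<bar> * \<bar>\<psi> x\<bar>"
      by (simp add: abs_mult[symmetric] left_diff_distrib)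
    also have "\<dots> \<le> 1 * \<bar>\<psi> x\<bar>"
      by (intro mult_right_mono) (use cut_range[of "Suc n" x] in auto)
    finally show ?thesis by simp
  qed
  have "(\<lambda>n. cutoff (Suc n) x * \<psi> x - \<psi> x) \<longlonglongrightarrow> 0" if "x \<in> Omega" for x
  proof -
    have "(\<lambda>n. cutoff (Suc n) x * \<psi> x - \<psi> x) \<longlonglongrightarrow> 1 * \<psi> x - \<psi> x"
      by (intro tendsto_intros LIMSEQ_Suc cut_tendsto that)
    then show ?thesis by simp
  qed
  then show "AE x in OM. (\<lambda>n. cutoff (Suc n) x * \<psi> x - \<psi> x) \<longlonglongrightarrow> 0" by (intro AE_I2) simp
qed (use f in \<open>auto intro!: smooth_sq_int continuous_measurable_OM smooth_continuous
  smooth_mult smooth_diff smooth_pd smooth_edge_cut smooth_cutoff\<close>)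

text \<open>In the product rule the derivative of the cutoff is at most the reciprocal of the distance to
the two edges, and \<open>\<psi>\<close> is at most a multiple of that distance. The product is bounded and tends to
zero pointwise, so that dominated convergence applies.\<close>

lemma pd_cut_tendsto_l2:
  assumes f: "smooth \<psi>" and zero: "\<And>x. x \<in> cbox 0 1 \<Longrightarrow> x $ i \<in> {0, 1} \<Longrightarrow> \<psi> x = 0"
  shows "(\<lambda>n. l2n OM (\<lambda>x. pd i (\<lambda>x. cutoff (Suc n) x * \<psi> x) x - pd i \<psi> x)) \<longlonglongrightarrow> 0"
proof -
  let ?k = "if i = 1 then 2 else 1 :: 2"
  have eq: "pd i (\<lambda>x. cutoff (Suc n) x * \<psi> x) x - pd i \<psi> x =
      pd i (edge_cut (Suc n) i) x * edge_cut (Suc n) ?k x * \<psi> x + (cutoff (Suc n) x * pd i \<psi> x - pd i \<psi> x)" for n x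
    by (subst pd_mult) (use f in \<open>auto intro: smooth_differentiable smooth_cutoff simp: pd_cut\<close>)
  obtain C where C: "C \<ge> 0" "\<And>x. x \<in> Omega \<Longrightarrow> \<bar>\<psi> x\<bar> \<le> C * x $ i"
    "\<And>x. x \<in> Omega \<Longrightarrow> \<bar>\<psi> x\<bar> \<le> C * (1 - x $ i)"
    using vanishing_bound[OF f zero] by metis
  let ?A = "\<lambda>n x. pd i (edge_cut (Suc n) i) x * edge_cut (Suc n) ?k x * \<psi> x"
  have A0: "(\<lambda>n. l2n OM (?A n)) \<longlonglongrightarrow> 0"
  proof (rule l2n_dominated_tendsto[of "\<lambda>x. 4 * C"])
    fix n x assume "x \<in> space OM"
    then have x: "x \<in> Omega" by simp
    then have p: "0 < x $ i" "0 < 1 - x $ i" by (auto simp: Omega_def)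
    have "\<bar>?A n x\<bar> \<le> \<bar>pd i (edge_cut (Suc n) i) x\<bar> * 1 * \<bar>\<psi> x\<bar>"
      unfolding abs_mult using edge_cut_range[of "Suc n" ?k x] by (intro mult_mono) auto
    also have "\<dots> \<le> (2 / x $ i + 2 / (1 - x $ i)) * \<bar>\<psi> x\<bar>"
      using pd_edge_cut_bound[OF x, of "Suc n" i] by (auto intro: mult_right_mono)
    also have "\<dots> = 2 / x $ i * \<bar>\<psi> x\<bar> + 2 / (1 - x $ i) * \<bar>\<psi> x\<bar>" by (rule distrib_right)
    also have "\<dots> \<le> 2 / x $ i * (C * x $ i) + 2 / (1 - x $ i) * (C * (1 - x $ i))"
      by (intro add_mono mult_left_mono C x) (use p in auto)
    also have "\<dots> = 4 * C" using p by simp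
    finally show "\<bar>?A n x\<bar> \<le> \<bar>4 * C\<bar>" by simp
  next
    have "(\<lambda>n. ?A n x) \<longlonglongrightarrow> 0" if x: "x \<in> Omega" for x
    proof (rule Lim_null_comparison)
      show "\<forall>\<^sub>F n in sequentially. norm (?A n x) \<le> \<bar>pd i (edge_cut (Suc n) i) x\<bar> * 1 * \<bar>\<psi> x\<bar>"
        unfolding real_norm_def abs_mult
        using edge_cut_range[of _ ?k x] by (intro always_eventually allI mult_mono) auto
      have "(\<lambda>n. \<bar>pd i (edge_cut (Suc n) i) x\<bar> * 1 * \<bar>\<psi> x\<bar>) \<longlonglongrightarrow> \<bar>0\<bar> * 1 * \<bar>\<psi> x\<bar>"
        by (intro tendsto_intros LIMSEQ_Suc pd_edge_cut_tendsto x)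
      then show "(\<lambda>n. \<bar>pd i (edge_cut (Suc n) i) x\<bar> * 1 * \<bar>\<psi> x\<bar>) \<longlonglongrightarrow> 0" by simp
    qed
    then show "AE x in OM. (\<lambda>n. ?A n x) \<longlonglongrightarrow> 0" by (intro AE_I2) simp
  qed (use f in \<open>auto intro!: smooth_sq_int continuous_measurable_OM smooth_continuous
  smooth_mult smooth_diff smooth_pd smooth_edge_cut smooth_cutoff\<close>)
  let ?B = "\<lambda>n x. cutoff (Suc n) x * pd i \<psi> x - pd i \<psi> x"
  have B0: "(\<lambda>n. l2n OM (?B n)) \<longlonglongrightarrow> 0"
    by (rule cut_tendsto_l2) (use f in auto)
  have le: "norm (l2n OM (\<lambda>x. ?A n x + ?B n x)) \<le> l2n OM (?A n) + l2n OM (?B n)" for n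
    using f by (auto intro!: l2n_triangle smooth_sq_int smooth_mult smooth_diff smooth_pd smooth_edge_cut smooth_cutoff)
  have lim: "(\<lambda>n. l2n OM (?A n) + l2n OM (?B n)) \<longlonglongrightarrow> 0"
    using tendsto_add[OF A0 B0] by simp
  show ?thesis
    unfolding eq by (rule Lim_null_comparison[OF always_eventually[OF allI[OF le]] lim])
qed

text \<open>Multiplying \<open>\<psi>\<close> with the cutoffs gives test functions. The cutoff along the other two edges is
constant in direction \<open>i\<close>, so only the behaviour of \<open>\<psi>\<close> at the edges orthogonal to \<open>i\<close> matters.\<close>

lemma weak_pd_boundary:
  assumes f: "f \<in> sq_int OM" and g: "g \<in> sq_int OM" and w: "is_weak_pd i f g"
    and s: "smooth \<psi>" and zero: "\<And>x. x \<in> cbox 0 1 \<Longrightarrow> x $ i \<in> {0, 1} \<Longrightarrow> \<psi> x = 0"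
  shows "(\<integral>x. f x * pd i \<psi> x \<partial>OM) = - (\<integral>x. g x * \<psi> x \<partial>OM)"
proof -
  have s': "smooth (\<lambda>x. cutoff (Suc n) x * \<psi> x)" for n using s by auto
  have A: "(\<lambda>n. \<integral>x. pd i (\<lambda>x. cutoff (Suc n) x * \<psi> x) x * f x \<partial>OM) \<longlonglongrightarrow> (\<integral>x. pd i \<psi> x * f x \<partial>OM)"
    by (rule l2n_tendsto_integral_right[OF _ _ pd_cut_tendsto_l2])
       (use f s s' zero in \<open>auto intro!: smooth_sq_int\<close>)
  have B: "(\<lambda>n. \<integral>x. (cutoff (Suc n) x * \<psi> x) * g x \<partial>OM) \<longlonglongrightarrow> (\<integral>x. \<psi> x * g x \<partial>OM)"
    by (rule l2n_tendsto_integral_right[OF _ _ cut_tendsto_l2])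
       (use g s s' in \<open>auto intro!: smooth_sq_int\<close>)
  have "(\<integral>x. pd i (\<lambda>x. cutoff (Suc n) x * \<psi> x) x * f x \<partial>OM) = - (\<integral>x. (cutoff (Suc n) x * \<psi> x) * g x \<partial>OM)" for n
    using w test_function_cut[OF s, of "Suc n"]
    unfolding is_weak_pd_def LINT_Omega by (simp add: mult.commute)
  with A have "(\<lambda>n. - (\<integral>x. (cutoff (Suc n) x * \<psi> x) * g x \<partial>OM)) \<longlonglongrightarrow> (\<integral>x. pd i \<psi> x * f x \<partial>OM)"
    by simp
  from LIMSEQ_unique[OF this tendsto_minus[OF B]] show ?thesis by (simp add: mult.commute)
qed

section \<open>Density of polynomials and Sobolev functions\<close>

text \<open>Polynomials in the two coordinates, in a form that exhibits the monomials. It is used both for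
smoothness and for the explicit primitives in the inequality of Poincare.\<close>

inductive monomial_sum :: "(plane \<Rightarrow> real) \<Rightarrow> bool" where
  monomial: "monomial_sum (\<lambda>x. c * (x $ 1 ^ m * x $ 2 ^ n))"
| add: "monomial_sum p \<Longrightarrow> monomial_sum q \<Longrightarrow> monomial_sum (\<lambda>x. p x + q x)"

lemma monomial_sum_mult:
  assumes "monomial_sum p" "monomial_sum q"
  shows "monomial_sum (\<lambda>x. p x * q x)"
  using assms(1)
proof induction
  case (monomial c m n)
  from assms(2) show ?case
  proof induction
    case (monomial d k l)
    have "(\<lambda>x. (c * (x $ 1 ^ m * x $ 2 ^ n)) * (d * (x $ 1 ^ k * x $ 2 ^ l))) =
        (\<lambda>x :: plane. (c * d) * (x $ 1 ^ (m + k) * x $ 2 ^ (n + l)))"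
      by (simp add: fun_eq_iff power_add)
    then show ?case using monomial_sum.monomial by simp
  next
    case (add p q)
    from add.IH show ?case unfolding distrib_left by (rule monomial_sum.add)
  qed
next
  case (add p q)
  from add.IH show ?case unfolding distrib_right by (rule monomial_sum.add)
qed

lemma real_polynomial_monomial_sum:
  fixes p :: "plane \<Rightarrow> real"
  assumes "real_polynomial_function p"
  shows "monomial_sum p"
  using assms
proof induction
  case (linear f)
  define a b where "a = f (axis 1 1)" and "b = f (axis 2 1)"
  have "f x = a * (x $ 1 ^ 1 * x $ 2 ^ 0) + b * (x $ 1 ^ 0 * x $ 2 ^ 1)" for x
  proof -
    have "x = x $ 1 *\<^sub>R axis 1 1 + x $ 2 *\<^sub>R axis 2 1" by (simp flip: pt_axis add: pt_collapse)
    then have "f x = f (x $ 1 *\<^sub>R axis 1 1 + x $ 2 *\<^sub>R axis 2 1)" by simp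
    also have "\<dots> = x $ 1 *\<^sub>R a + x $ 2 *\<^sub>R b"
      unfolding a_def b_def using linear by (simp only: linear_simps)
    finally show ?thesis by simp
  qed
  then have "f = (\<lambda>x. a * (x $ 1 ^ 1 * x $ 2 ^ 0) + b * (x $ 1 ^ 0 * x $ 2 ^ 1))" by (rule ext)
  moreover have "monomial_sum (\<lambda>x. a * (x $ 1 ^ 1 * x $ 2 ^ 0) + b * (x $ 1 ^ 0 * x $ 2 ^ 1))"
    by (intro monomial_sum.intros)
  ultimately show ?case by (simp only:)
next
  case (const c)
  then show ?case using monomial_sum.monomial[of c 0 0] by simp
qed (auto intro: monomial_sum.add monomial_sum_mult)

lemma real_polynomial_smooth:
  fixes p :: "plane \<Rightarrow> real"
  assumes "real_polynomial_function p"
  shows "smooth p"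
  using real_polynomial_monomial_sum[OF assms]
proof induction
  case (monomial c m n)
  show ?case by (intro smooth_mult smooth_power smooth_const smooth_nth)
next
  case (add p q)
  from add.IH show ?case by (rule smooth_add)
qed

text \<open>A Lebesgue measurable function is an almost everywhere limit of continuous functions.
Truncating these at the bound of \<open>f\<close> keeps them continuous and makes the convergence dominated.\<close>

lemma bounded_continuous_dense:
  assumes f: "f \<in> borel_measurable OM" and N: "N > 0" and bd: "\<And>x. \<bar>f x\<bar> \<le> N" and e: "e > 0"
  obtains h where "continuous_on UNIV h" "l2n OM (\<lambda>x. f x - h x) < e"
proof -
  define F where "F x = indicator Omega x * f x" for x
  have "F \<in> borel_measurable lborel"
    using f unfolding F_def by (simp add: borel_measurable_restrict_space_iff)
  then have "F \<in> borel_measurable lebesgue" by (rule measurable_completion)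
  then have "F measurable_on UNIV" by (rule lebesgue_measurable_imp_measurable_on) simp
  then obtain Z g where Z: "negligible Z" and g: "\<And>n. continuous_on UNIV (g n)"
    "\<And>x. x \<notin> Z \<Longrightarrow> (\<lambda>n. g n x) \<longlonglongrightarrow> F x"
    unfolding measurable_on_def by auto
  define h where "h n x = max (- N) (min N (g n x))" for n x
  have hc: "continuous_on UNIV (h n)" for n
    unfolding h_def by (intro continuous_intros g)
  have hN: "\<bar>h n x\<bar> \<le> N" for n x using N by (auto simp: h_def)
  have "AE x in lebesgue. x \<notin> Z"
    using Z by (intro AE_not_in) (simp add: negligible_iff_null_sets)
  then have "AE x in lborel. x \<notin> Z" by (simp add: AE_completion_iff)
  then have "AE x in lborel. x \<in> Omega \<longrightarrow> (\<lambda>n. f x - h n x) \<longlonglongrightarrow> 0"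
  proof eventually_elim
    case (elim x)
    show ?case
    proof
      assume x: "x \<in> Omega"
      have "(\<lambda>n. h n x) \<longlonglongrightarrow> max (- N) (min N (F x))"
        unfolding h_def by (intro tendsto_intros g elim)
      moreover have "max (- N) (min N (F x)) = f x" using x bd[of x] by (auto simp: F_def)
      ultimately have "(\<lambda>n. f x - h n x) \<longlonglongrightarrow> f x - f x" by (intro tendsto_intros) simp
      then show "(\<lambda>n. f x - h n x) \<longlonglongrightarrow> 0" by simp
    qed
  qed
  then have ae: "AE x in OM. (\<lambda>n. f x - h n x) \<longlonglongrightarrow> 0"
    by (subst AE_restrict_space_iff) auto
  have "(\<lambda>n. l2n OM (\<lambda>x. f x - h n x)) \<longlonglongrightarrow> 0"
  proof (rule l2n_dominated_tendsto[OF _ _ _ ae])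
    show "(\<lambda>x. 2 * N) \<in> sq_int OM" by (intro smooth_sq_int) simp
    show "(\<lambda>x. f x - h n x) \<in> borel_measurable OM" for n
      using f continuous_measurable_OM[OF hc[of n]] by measurable
    show "\<bar>f x - h n x\<bar> \<le> \<bar>2 * N\<bar>" for n x
      using bd[of x] hN[of n x] N by linarith
  qed
  then have "\<forall>\<^sub>F n in sequentially. l2n OM (\<lambda>x. f x - h n x) < e"
    using e by (rule order_tendstoD)
  then obtain n where "l2n OM (\<lambda>x. f x - h n x) < e" by (auto simp: eventually_sequentially)
  with hc show ?thesis by (rule that)
qed

text \<open>Truncation reduces to bounded functions, these are approximated by continuous ones, and those
by polynomials uniformly on the closed square.\<close>

lemma polynomial_dense:
  assumes f: "f \<in> sq_int OM" and e: "e > 0"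
  obtains p where "real_polynomial_function p" "l2n OM (\<lambda>x. f x - p x) < e"
proof -
  define c where "c n x = max (- real (Suc n)) (min (real (Suc n)) (f x))" for n x
  have cm: "c n \<in> borel_measurable OM" for n
    unfolding c_def using sq_int_measurable[OF f] by measurable
  have cb: "\<bar>c n x\<bar> \<le> real (Suc n)" for n x by (auto simp: c_def)
  have cs: "c n \<in> sq_int OM" for n by (rule OM.bounded_sq_int[OF cm cb])
  have "(\<lambda>n. l2n OM (\<lambda>x. f x - c n x)) \<longlonglongrightarrow> 0"
  proof (rule l2n_dominated_tendsto[OF f])
    show "(\<lambda>x. f x - c n x) \<in> borel_measurable OM" for n
      using sq_int_measurable[OF f] cm[of n] by measurable
    show "\<bar>f x - c n x\<bar> \<le> \<bar>f x\<bar>" for n x by (auto simp: c_def)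
    have "(\<lambda>n. f x - c n x) \<longlonglongrightarrow> 0" for x
    proof (rule tendsto_eventually)
      obtain M where M: "\<bar>f x\<bar> \<le> real M" using real_arch_simple by blast
      show "\<forall>\<^sub>F n in sequentially. f x - c n x = 0"
        using eventually_ge_at_top[of M]
      proof eventually_elim
        case (elim n)
        then have "\<bar>f x\<bar> \<le> real (Suc n)" using M by simp
        then show ?case by (auto simp: c_def)
      qed
    qed
    then show "AE x in OM. (\<lambda>n. f x - c n x) \<longlonglongrightarrow> 0" by simp
  qed
  then have "\<forall>\<^sub>F n in sequentially. l2n OM (\<lambda>x. f x - c n x) < e / 3"
    by (rule order_tendstoD) (use e in simp)
  then obtain n where n: "l2n OM (\<lambda>x. f x - c n x) < e / 3" by (auto simp: eventually_sequentially)
  have e3: "0 < e / 3" using e by simp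
  obtain h where h: "continuous_on UNIV h" "l2n OM (\<lambda>x. c n x - h x) < e / 3"
    by (rule bounded_continuous_dense[OF cm _ cb e3]) auto
  obtain p where p: "real_polynomial_function p" "\<And>x. x \<in> cbox 0 1 \<Longrightarrow> \<bar>h x - p x\<bar> < e / 3"
    by (rule Stone_Weierstrass_real_polynomial_function[OF compact_cbox continuous_on_subset[OF h(1)] e3]) auto
  have hs: "h \<in> sq_int OM" and ps: "p \<in> sq_int OM"
    using h p by (auto intro: continuous_sq_int smooth_sq_int real_polynomial_smooth)
  have "l2n OM (\<lambda>x. h x - p x) \<le> l2n OM (\<lambda>x. e / 3)"
  proof (rule l2n_mono)
    show "(\<lambda>x. e / 3) \<in> sq_int OM" by (intro smooth_sq_int) simp
    show "(\<lambda>x. h x - p x) \<in> borel_measurable OM" using hs ps by measurable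
    show "\<bar>h x - p x\<bar> \<le> \<bar>e / 3\<bar>" if "x \<in> space OM" for x
      using p(2)[of x] that e by (simp add: Omega_cbox)
  qed
  also have "l2n OM (\<lambda>x. e / 3) = e / 3" using e by (simp add: l2n_def measure_OM)
  finally have "l2n OM (\<lambda>x. h x - p x) \<le> e / 3" .
  then have "l2n OM (\<lambda>x. f x - p x) < e"
    using l2n_triangle3[OF f cs[of n] ps] l2n_triangle3[OF cs[of n] hs ps] n h(2) by linarith
  with p(1) show ?thesis by (rule that)
qed

lemma polynomial_dense_seq:
  assumes f: "f \<in> sq_int OM"
  obtains p where "\<And>k. real_polynomial_function (p k)" "(\<lambda>k. l2n OM (\<lambda>x. p k x - f x)) \<longlonglongrightarrow> 0"
proof -
  have "\<exists>p. real_polynomial_function p \<and> l2n OM (\<lambda>x. f x - p x) < inverse (real (Suc k))" for k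
  proof -
    have "inverse (real (Suc k)) > 0" by simp
    from polynomial_dense[OF f this] show ?thesis by metis
  qed
  then obtain p where p: "\<And>k. real_polynomial_function (p k)"
    "\<And>k. l2n OM (\<lambda>x. f x - p k x) < inverse (real (Suc k))" by metis
  have "(\<lambda>k. l2n OM (\<lambda>x. p k x - f x)) \<longlonglongrightarrow> 0"
    by (rule Lim_null_comparison[OF _ LIMSEQ_inverse_real_of_nat])
       (use p(2) in \<open>auto simp: l2n_minus_commute[of OM f] intro!: always_eventually less_imp_le\<close>)
  with p(1) show ?thesis by (rule that)
qed

lemma l2n_eq_0_AE:
  assumes "f \<in> sq_int M" "l2n M f = 0"
  shows "AE x in M. f x = 0"
proof -
  have "(\<integral>x. (f x)\<^sup>2 \<partial>M) = 0" using assms(2) by (simp add: l2n_def)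
  then have "AE x in M. (f x)\<^sup>2 = 0"
    by (subst (asm) integral_nonneg_eq_0_iff_AE) (use assms(1) in \<open>auto simp: sq_int_integrable\<close>)
  then show ?thesis by simp
qed

lemma test_function_smooth: "test_function \<phi> \<Longrightarrow> smooth \<phi>"
  by (simp add: test_function_def)

lemma test_function_sq_int:
  assumes "test_function \<phi>"
  shows "\<phi> \<in> sq_int OM" "pd i \<phi> \<in> sq_int OM"
  using test_function_smooth[OF assms] by (auto intro: smooth_sq_int)

lemma test_function_zero:
  assumes "test_function \<phi>" "x $ i \<in> {0, 1}"
  shows "\<phi> x = 0"
proof (rule ccontr)
  assume "\<phi> x \<noteq> 0"
  then have "x \<in> Omega" using assms(1) closure_subset[of "{x. \<phi> x \<noteq> 0}"]
    by (auto simp: test_function_def)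
  then have "0 < x $ i" "x $ i < 1" by (simp_all add: Omega_def)
  with assms(2) show False by auto
qed

text \<open>The fundamental lemma of the calculus of variations. The cutoffs turn orthogonality to test
functions into orthogonality to smooth functions, in particular to polynomials converging to \<open>h\<close>.\<close>

lemma test_functions_separate:
  assumes h: "h \<in> sq_int OM" and t: "\<And>\<phi>. test_function \<phi> \<Longrightarrow> (\<integral>x. h x * \<phi> x \<partial>OM) = 0"
  shows "AE x in OM. h x = 0"
proof -
  have s: "(\<integral>x. \<psi> x * h x \<partial>OM) = 0" if \<psi>: "smooth \<psi>" for \<psi>
  proof -
    have "(\<lambda>n. \<integral>x. (cutoff (Suc n) x * \<psi> x) * h x \<partial>OM) \<longlonglongrightarrow> (\<integral>x. \<psi> x * h x \<partial>OM)"
      by (rule l2n_tendsto_integral_right[OF _ _ cut_tendsto_l2])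
         (use h \<psi> in \<open>auto intro!: smooth_sq_int\<close>)
    moreover have "(\<integral>x. (cutoff (Suc n) x * \<psi> x) * h x \<partial>OM) = 0" for n
      using t[OF test_function_cut[OF \<psi>, of "Suc n"]] by (simp add: mult.commute)
    ultimately show ?thesis by (simp add: LIMSEQ_const_iff)
  qed
  obtain p where p: "\<And>k. real_polynomial_function (p k)" "(\<lambda>k. l2n OM (\<lambda>x. p k x - h x)) \<longlonglongrightarrow> 0"
    using polynomial_dense_seq[OF h] by metis
  have "(\<lambda>k. \<integral>x. p k x * h x \<partial>OM) \<longlonglongrightarrow> (\<integral>x. h x * h x \<partial>OM)"
    by (rule l2n_tendsto_integral_right[OF _ h p(2) h]) (intro smooth_sq_int real_polynomial_smooth p)
  then have "(\<integral>x. h x * h x \<partial>OM) = 0"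
    using s[OF real_polynomial_smooth[OF p(1)]] by (simp add: LIMSEQ_const_iff)
  then have "l2n OM h = 0" by (simp add: l2n_def power2_eq_square)
  with h show ?thesis by (rule l2n_eq_0_AE)
qed

lemma H1_sq_int: "f \<in> H1 \<Longrightarrow> f \<in> sq_int OM"
  by (simp add: H1_def L2_sq_int)

lemma H1_I:
  assumes "f \<in> sq_int OM" "\<And>i. g i \<in> sq_int OM" "\<And>i. is_weak_pd i f (g i)"
  shows "f \<in> H1"
  using assms by (auto simp: H1_def L2_sq_int)

lemma
  assumes "f \<in> H1"
  shows weak_pd_sq_int: "weak_pd i f \<in> sq_int OM"
    and weak_pd_is: "is_weak_pd i f (weak_pd i f)"
proof -
  have "\<exists>g. g \<in> L2 \<and> is_weak_pd i f g" using assms by (auto simp: H1_def)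
  from someI_ex[OF this] show "weak_pd i f \<in> sq_int OM" "is_weak_pd i f (weak_pd i f)"
    by (simp_all add: weak_pd_def L2_sq_int)
qed

lemma is_weak_pd_iff:
  "is_weak_pd i f g \<longleftrightarrow> (\<forall>\<phi>. test_function \<phi> \<longrightarrow> (\<integral>x. f x * pd i \<phi> x \<partial>OM) = - (\<integral>x. g x * \<phi> x \<partial>OM))"
  by (simp add: is_weak_pd_def LINT_Omega)

lemma weak_pd_unique:
  assumes f: "f \<in> H1" and g: "g \<in> sq_int OM" and w: "is_weak_pd i f g"
  shows "AE x in OM. weak_pd i f x = g x"
proof -
  have "AE x in OM. weak_pd i f x - g x = 0"
  proof (rule test_functions_separate)
    fix \<phi> assume t: "test_function \<phi>"
    have "(\<integral>x. (weak_pd i f x - g x) * \<phi> x \<partial>OM) = (\<integral>x. weak_pd i f x * \<phi> x \<partial>OM) - (\<integral>x. g x * \<phi> x \<partial>OM)"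
      by (simp add: left_diff_distrib sq_int_mult_integrable weak_pd_sq_int f g test_function_sq_int[OF t])
    also have "\<dots> = 0"
      using weak_pd_is[OF f, of i] w t unfolding is_weak_pd_iff by force
    finally show "(\<integral>x. (weak_pd i f x - g x) * \<phi> x \<partial>OM) = 0" .
  qed (use f g weak_pd_sq_int in auto)
  then show ?thesis by eventually_elim simp
qed

lemma
  assumes f: "f \<in> H1" and g: "g \<in> H1"
  shows H1_lincomb: "(\<lambda>x. a * f x + b * g x) \<in> H1"
    and weak_pd_lincomb: "AE x in OM. weak_pd i (\<lambda>x. a * f x + b * g x) x = a * weak_pd i f x + b * weak_pd i g x"
proof -
  let ?h = "\<lambda>x. a * f x + b * g x" and ?d = "\<lambda>i x. a * weak_pd i f x + b * weak_pd i g x"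
  have hs: "?h \<in> sq_int OM" by (intro sq_int_add sq_int_scale H1_sq_int f g)
  have ds: "?d i \<in> sq_int OM" for i by (intro sq_int_add sq_int_scale weak_pd_sq_int f g)
  have w: "is_weak_pd i ?h (?d i)" for i
    unfolding is_weak_pd_iff
  proof safe
    fix \<phi> assume t: "test_function \<phi>"
    note int = sq_int_mult_integrable[OF H1_sq_int[OF f] test_function_sq_int(2)[OF t]]
      sq_int_mult_integrable[OF H1_sq_int[OF g] test_function_sq_int(2)[OF t]]
      sq_int_mult_integrable[OF weak_pd_sq_int[OF f] test_function_sq_int(1)[OF t]]
      sq_int_mult_integrable[OF weak_pd_sq_int[OF g] test_function_sq_int(1)[OF t]]
    have "(\<integral>x. ?h x * pd i \<phi> x \<partial>OM) = a * (\<integral>x. f x * pd i \<phi> x \<partial>OM) + b * (\<integral>x. g x * pd i \<phi> x \<partial>OM)"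
      using int by (simp add: distrib_right mult.assoc)
    also have "\<dots> = - (a * (\<integral>x. weak_pd i f x * \<phi> x \<partial>OM) + b * (\<integral>x. weak_pd i g x * \<phi> x \<partial>OM))"
      using weak_pd_is[OF f, of i] weak_pd_is[OF g, of i] t unfolding is_weak_pd_iff by simp
    also have "a * (\<integral>x. weak_pd i f x * \<phi> x \<partial>OM) + b * (\<integral>x. weak_pd i g x * \<phi> x \<partial>OM) = (\<integral>x. ?d i x * \<phi> x \<partial>OM)"
      using int by (simp add: distrib_right mult.assoc)
    finally show "(\<integral>x. ?h x * pd i \<phi> x \<partial>OM) = - (\<integral>x. ?d i x * \<phi> x \<partial>OM)" .
  qed
  show "?h \<in> H1" by (rule H1_I[OF hs ds w])
  then show "AE x in OM. weak_pd i ?h x = ?d i x" by (rule weak_pd_unique[OF _ ds w])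
qed

lemma
  assumes f: "f \<in> H1" and g: "g \<in> H1"
  shows H1_diff: "(\<lambda>x. f x - g x) \<in> H1"
    and weak_pd_diff: "AE x in OM. weak_pd i (\<lambda>x. f x - g x) x = weak_pd i f x - weak_pd i g x"
  using H1_lincomb[OF f g, of 1 "-1"] weak_pd_lincomb[OF f g, of i 1 "-1"] by simp_all

lemma
  assumes f: "smooth f"
  shows smooth_H1: "f \<in> H1"
    and weak_pd_smooth: "AE x in OM. weak_pd i f x = pd i f x"
proof -
  have w: "is_weak_pd i f (pd i f)" for i
    unfolding is_weak_pd_iff
    by (intro allI impI integral_parts_smooth f test_function_smooth) (auto simp: test_function_zero)
  show "f \<in> H1"
    by (rule H1_I[OF _ _ w]) (use f in \<open>auto intro: smooth_sq_int\<close>)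
  then show "AE x in OM. weak_pd i f x = pd i f x"
    by (rule weak_pd_unique[OF _ _ w]) (use f in \<open>auto intro: smooth_sq_int\<close>)
qed

lemma
  assumes F: "\<And>k. F k \<in> H1" and f: "f \<in> sq_int OM" and g: "\<And>i. g i \<in> sq_int OM"
    and lim: "(\<lambda>k. l2n OM (\<lambda>x. F k x - f x)) \<longlonglongrightarrow> 0"
    and limd: "\<And>i. (\<lambda>k. l2n OM (\<lambda>x. weak_pd i (F k) x - g i x)) \<longlonglongrightarrow> 0"
  shows H1_closed: "f \<in> H1"
    and weak_pd_closed: "AE x in OM. weak_pd i f x = g i x"
proof -
  have w: "is_weak_pd i f (g i)" for i
    unfolding is_weak_pd_iff
  proof safe
    fix \<phi> assume t: "test_function \<phi>"
    have "(\<lambda>k. \<integral>x. F k x * pd i \<phi> x \<partial>OM) \<longlonglongrightarrow> (\<integral>x. f x * pd i \<phi> x \<partial>OM)"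
      by (rule l2n_tendsto_integral_right[OF H1_sq_int[OF F] f lim test_function_sq_int(2)[OF t]])
    moreover have "(\<lambda>k. - (\<integral>x. weak_pd i (F k) x * \<phi> x \<partial>OM)) \<longlonglongrightarrow> - (\<integral>x. g i x * \<phi> x \<partial>OM)"
      by (intro tendsto_minus l2n_tendsto_integral_right[OF weak_pd_sq_int[OF F] g limd test_function_sq_int(1)[OF t]])
    moreover have "(\<integral>x. F k x * pd i \<phi> x \<partial>OM) = - (\<integral>x. weak_pd i (F k) x * \<phi> x \<partial>OM)" for k
      using weak_pd_is[OF F, of i k] t unfolding is_weak_pd_iff by blast
    ultimately show "(\<integral>x. f x * pd i \<phi> x \<partial>OM) = - (\<integral>x. g i x * \<phi> x \<partial>OM)"
      using LIMSEQ_unique by simp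
  qed
  show "f \<in> H1" by (rule H1_I[OF f g w])
  then show "AE x in OM. weak_pd i f x = g i x" by (rule weak_pd_unique[OF _ g w])
qed

lemma H1_norm_sq:
  assumes "f \<in> H1"
  shows "(H1_norm f)\<^sup>2 = (l2n OM f)\<^sup>2 + (l2n OM (weak_pd 1 f))\<^sup>2 + (l2n OM (weak_pd 2 f))\<^sup>2"
proof -
  have "(H1_norm f)\<^sup>2 = (\<integral>x. (f x)\<^sup>2 + (\<Sum>i\<in>UNIV. (weak_pd i f x)\<^sup>2) \<partial>OM)"
    unfolding H1_norm_def LINT_Omega by (simp add: sum_nonneg)
  also have "\<dots> = (l2n OM f)\<^sup>2 + (l2n OM (weak_pd 1 f))\<^sup>2 + (l2n OM (weak_pd 2 f))\<^sup>2"
    using H1_sq_int[OF assms] weak_pd_sq_int[OF assms]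
    by (simp add: sum_2 sq_int_integrable l2n_sq)
  finally show ?thesis .
qed

lemma H1_norm_nonneg: "0 \<le> H1_norm f"
  unfolding H1_norm_def LINT_Omega by (simp add: sum_nonneg)

lemma H1_norm_bounds:
  assumes "f \<in> H1"
  shows "l2n OM f \<le> H1_norm f" "l2n OM (weak_pd i f) \<le> H1_norm f"
    "H1_norm f \<le> l2n OM f + l2n OM (weak_pd 1 f) + l2n OM (weak_pd 2 f)"
proof -
  note eq = H1_norm_sq[OF assms]
  show "l2n OM f \<le> H1_norm f"
    by (rule power2_le_imp_le) (auto simp: eq H1_norm_nonneg)
  have "i = 1 \<or> i = 2" by (rule exhaust_2)
  then have "(l2n OM (weak_pd i f))\<^sup>2 \<le> (H1_norm f)\<^sup>2"
    unfolding eq by (elim disjE) simp_all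
  then show "l2n OM (weak_pd i f) \<le> H1_norm f"
    by (rule power2_le_imp_le) (rule H1_norm_nonneg)
  show "H1_norm f \<le> l2n OM f + l2n OM (weak_pd 1 f) + l2n OM (weak_pd 2 f)"
  proof (rule power2_le_imp_le)
    have "0 \<le> l2n OM f * l2n OM (weak_pd 1 f)" "0 \<le> l2n OM f * l2n OM (weak_pd 2 f)"
      "0 \<le> l2n OM (weak_pd 1 f) * l2n OM (weak_pd 2 f)"
      by (intro mult_nonneg_nonneg l2n_nonneg)+
    then show "(H1_norm f)\<^sup>2 \<le> (l2n OM f + l2n OM (weak_pd 1 f) + l2n OM (weak_pd 2 f))\<^sup>2"
      unfolding eq power2_sum distrib_left distrib_right by simp
  qed (intro add_nonneg_nonneg l2n_nonneg)
qed

text \<open>Convergence in \<^const>\<open>H1\<close> in terms of weak derivatives of the single functions; the weak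
derivative of the difference, which occurs in the norm, is only almost everywhere the difference.\<close>

lemma H1_norm_tendsto_iff:
  assumes F: "\<And>k. F k \<in> H1" and f: "f \<in> H1"
  shows "(\<lambda>k. H1_norm (\<lambda>x. F k x - f x)) \<longlonglongrightarrow> 0 \<longleftrightarrow>
    (\<lambda>k. l2n OM (\<lambda>x. F k x - f x)) \<longlonglongrightarrow> 0 \<and>
    (\<forall>i. (\<lambda>k. l2n OM (\<lambda>x. weak_pd i (F k) x - weak_pd i f x)) \<longlonglongrightarrow> 0)"
proof -
  have eq: "l2n OM (weak_pd i (\<lambda>x. F k x - f x)) = l2n OM (\<lambda>x. weak_pd i (F k) x - weak_pd i f x)" for i k
    by (rule l2n_cong_AE)
       (use weak_pd_diff[OF F f] weak_pd_sq_int[OF H1_diff[OF F f]] weak_pd_sq_int[OF F] weak_pd_sq_int[OF f]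
         in \<open>auto intro!: sq_int_measurable sq_int_diff\<close>)
  note b = H1_norm_bounds[OF H1_diff[OF F f], unfolded eq]
  show ?thesis
  proof safe
    assume *: "(\<lambda>k. H1_norm (\<lambda>x. F k x - f x)) \<longlonglongrightarrow> 0"
    show "(\<lambda>k. l2n OM (\<lambda>x. F k x - f x)) \<longlonglongrightarrow> 0"
      by (rule Lim_null_comparison[OF always_eventually[OF allI] *]) (use b(1) in simp)
    show "(\<lambda>k. l2n OM (\<lambda>x. weak_pd i (F k) x - weak_pd i f x)) \<longlonglongrightarrow> 0" for i
      by (rule Lim_null_comparison[OF always_eventually[OF allI] *]) (use b(2) in simp)
  next
    assume *: "(\<lambda>k. l2n OM (\<lambda>x. F k x - f x)) \<longlonglongrightarrow> 0"
      "\<forall>i. (\<lambda>k. l2n OM (\<lambda>x. weak_pd i (F k) x - weak_pd i f x)) \<longlonglongrightarrow> 0"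
    have "(\<lambda>k. l2n OM (\<lambda>x. F k x - f x) + l2n OM (\<lambda>x. weak_pd 1 (F k) x - weak_pd 1 f x)
        + l2n OM (\<lambda>x. weak_pd 2 (F k) x - weak_pd 2 f x)) \<longlonglongrightarrow> 0 + 0 + 0"
      by (intro tendsto_add) (use * in auto)
    then have lim: "(\<lambda>k. l2n OM (\<lambda>x. F k x - f x) + l2n OM (\<lambda>x. weak_pd 1 (F k) x - weak_pd 1 f x)
        + l2n OM (\<lambda>x. weak_pd 2 (F k) x - weak_pd 2 f x)) \<longlonglongrightarrow> 0" by simp
    show "(\<lambda>k. H1_norm (\<lambda>x. F k x - f x)) \<longlonglongrightarrow> 0"
      by (rule Lim_null_comparison[OF always_eventually[OF allI] lim])
         (use b(3) H1_norm_nonneg in simp)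
  qed
qed

section \<open>Edge traces and smooth approximation\<close>

text \<open>Lebesgue measure on the parameter interval of an edge.\<close>

abbreviation EM :: "real measure"
  where "EM \<equiv> restrict_space lborel {0<..<1}"

interpretation EM: finite_measure EM
  by standard (simp add: emeasure_restrict_space space_restrict_space)

lemma LINT_edge: "(LINT s:{0<..<1}|lborel. h s) = (\<integral>s. h s \<partial>EM)" for h :: "real \<Rightarrow> real"
  by (simp add: set_lebesgue_integral_def integral_restrict_space)

lemma continuous_sq_int_EM:
  assumes "continuous_on UNIV (h :: real \<Rightarrow> real)"
  shows "h \<in> sq_int EM"
proof -
  have "compact (h ` {0..1})"
    by (intro compact_continuous_image continuous_on_subset[OF assms]) auto
  then obtain B where B: "\<And>y. y \<in> h ` {0..1} \<Longrightarrow> norm y \<le> B"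
    using compact_imp_bounded bounded_pos by metis
  have "h \<in> borel_measurable EM"
    by (intro measurable_restrict_space1) (simp add: borel_measurable_continuous_onI assms)
  then show ?thesis
    by (rule EM.bounded_sq_int[of _ B]) (use B in \<open>auto simp: space_restrict_space\<close>)
qed

lemma continuous_edge:
  assumes "smooth f"
  shows "continuous_on UNIV (\<lambda>s. f (pt s c))"
proof -
  have c1: "continuous_on UNIV (\<lambda>s. pt s c)" unfolding pt_axis by (intro continuous_intros)
  show ?thesis using continuous_on_compose2[OF smooth_continuous[OF assms, of UNIV] c1] by simp
qed

lemma edge_sq_int: "smooth f \<Longrightarrow> (\<lambda>s. f (pt s c)) \<in> sq_int EM"
  by (intro continuous_sq_int_EM continuous_edge)

lemma edge_const_sq_int: "(\<lambda>s. c) \<in> sq_int EM"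
  by (intro continuous_sq_int_EM) auto

definition smooth_approx :: "(nat \<Rightarrow> plane \<Rightarrow> real) \<Rightarrow> (plane \<Rightarrow> real) \<Rightarrow> bool"
  where "smooth_approx \<phi> f \<longleftrightarrow> f \<in> H1 \<and> (\<forall>k. smooth (\<phi> k)) \<and>
    (\<lambda>k. l2n OM (\<lambda>x. \<phi> k x - f x)) \<longlonglongrightarrow> 0 \<and>
    (\<forall>i. (\<lambda>k. l2n OM (\<lambda>x. pd i (\<phi> k) x - weak_pd i f x)) \<longlonglongrightarrow> 0)"

lemma smooth_approxD:
  assumes "smooth_approx \<phi> f"
  shows "f \<in> H1" "smooth (\<phi> k)" "(\<lambda>k. l2n OM (\<lambda>x. \<phi> k x - f x)) \<longlonglongrightarrow> 0"
    "(\<lambda>k. l2n OM (\<lambda>x. pd i (\<phi> k) x - weak_pd i f x)) \<longlonglongrightarrow> 0"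
  using assms by (auto simp: smooth_approx_def)

lemma smooth_approx_iff:
  assumes f: "f \<in> H1" and s: "\<And>k. smooth (\<phi> k)"
  shows "smooth_approx \<phi> f \<longleftrightarrow> (\<lambda>k. H1_norm (\<lambda>x. \<phi> k x - f x)) \<longlonglongrightarrow> 0"
proof -
  have "l2n OM (\<lambda>x. weak_pd i (\<phi> k) x - weak_pd i f x) = l2n OM (\<lambda>x. pd i (\<phi> k) x - weak_pd i f x)" for i k
  proof (rule l2n_cong_AE)
    show "AE x in OM. weak_pd i (\<phi> k) x - weak_pd i f x = pd i (\<phi> k) x - weak_pd i f x"
      using weak_pd_smooth[OF s[of k]] by eventually_elim simp
  qed (intro sq_int_measurable sq_int_diff weak_pd_sq_int smooth_H1 smooth_sq_int smooth_pd s f)+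
  then show ?thesis
    unfolding H1_norm_tendsto_iff[OF smooth_H1[OF s] f] by (simp add: smooth_approx_def f s)
qed

text \<open>Constant traces suffice, as only these are prescribed in \<^const>\<open>W\<close>.\<close>

lemma edge_trace_iff:
  "has_edge_trace f c (\<lambda>_. p) \<longleftrightarrow>
    (\<exists>\<phi>. smooth_approx \<phi> f \<and> (\<lambda>k. l2n EM (\<lambda>s. \<phi> k (pt s c) - p)) \<longlonglongrightarrow> 0)"
proof -
  have eq: "(\<lambda>k. LINT s:{0<..<1}|lborel. (\<phi> k (vector [s, c]) - p)\<^sup>2) \<longlonglongrightarrow> 0 \<longleftrightarrow>
      (\<lambda>k. l2n EM (\<lambda>s. \<phi> k (pt s c) - p)) \<longlonglongrightarrow> 0" (is "?A \<longleftrightarrow> ?B") for \<phi> :: "nat \<Rightarrow> plane \<Rightarrow> real"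
  proof
    assume ?A
    then have "(\<lambda>k. sqrt (LINT s:{0<..<1}|lborel. (\<phi> k (vector [s, c]) - p)\<^sup>2)) \<longlonglongrightarrow> sqrt 0"
      by (rule tendsto_real_sqrt)
    then show ?B by (simp add: LINT_edge l2n_def pt_def)
  next
    assume ?B
    then have "(\<lambda>k. (l2n EM (\<lambda>s. \<phi> k (pt s c) - p))\<^sup>2) \<longlonglongrightarrow> 0\<^sup>2" by (rule tendsto_power)
    then show ?A by (simp add: LINT_edge l2n_sq pt_def)
  qed
  show ?thesis
  proof
    assume "has_edge_trace f c (\<lambda>_. p)"
    then obtain \<phi> where "f \<in> H1" "\<And>k. smooth (\<phi> k)" "(\<lambda>k. H1_norm (\<lambda>x. \<phi> k x - f x)) \<longlonglongrightarrow> 0"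
      "(\<lambda>k. l2n EM (\<lambda>s. \<phi> k (pt s c) - p)) \<longlonglongrightarrow> 0"
      unfolding has_edge_trace_def eq by blast
    then show "\<exists>\<phi>. smooth_approx \<phi> f \<and> (\<lambda>k. l2n EM (\<lambda>s. \<phi> k (pt s c) - p)) \<longlonglongrightarrow> 0"
      using smooth_approx_iff by blast
  next
    assume "\<exists>\<phi>. smooth_approx \<phi> f \<and> (\<lambda>k. l2n EM (\<lambda>s. \<phi> k (pt s c) - p)) \<longlonglongrightarrow> 0"
    then obtain \<phi> where \<phi>: "smooth_approx \<phi> f" "(\<lambda>k. l2n EM (\<lambda>s. \<phi> k (pt s c) - p)) \<longlonglongrightarrow> 0" by blast
    have "(\<lambda>k. H1_norm (\<lambda>x. \<phi> k x - f x)) \<longlonglongrightarrow> 0"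
      using smooth_approx_iff[of f \<phi>, OF smooth_approxD(1)[OF \<phi>(1)]] smooth_approxD(2)[OF \<phi>(1)] \<phi>(1)
      by blast
    with \<phi> show "has_edge_trace f c (\<lambda>_. p)"
      unfolding has_edge_trace_def eq using smooth_approxD(1,2)[OF \<phi>(1)] by blast
  qed
qed

text \<open>The exponential \<open>exp (- n * d)\<close>, where \<open>d\<close> is the distance to the edge \<open>x\<^sub>2 = c\<close> for \<open>c = 0\<close> or
\<open>c = 1\<close>. The factor \<open>1 - layer c n x\<close> vanishes exactly on that edge.\<close>

definition layer :: "real \<Rightarrow> real \<Rightarrow> plane \<Rightarrow> real"
  where "layer c n x = exp (- n * c) * exp (- n * (1 - 2 * c) * x $ 2)"

lemma smooth_layer [intro]: "smooth (layer c n)"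
  unfolding layer_def by (intro smooth_mult smooth_const smooth_exp_coord)

lemma pd_layer: "pd i (layer c n) x = (if i = 2 then - n * (1 - 2 * c) * layer c n x else 0)"
proof -
  have "((\<lambda>t. exp (- n * c) * exp (- n * (1 - 2 * c) * t)) has_real_derivative
      - n * (1 - 2 * c) * (exp (- n * c) * exp (- n * (1 - 2 * c) * t))) (at t)" for t
    by (auto intro!: derivative_eq_intros)
  from pd_coord[OF this] show ?thesis unfolding layer_def by auto
qed

lemma layer_edge: "c \<in> {0, 1} \<Longrightarrow> x $ 2 = c \<Longrightarrow> layer c n x = 1"
  by (auto simp: layer_def simp flip: exp_add)

lemma layer_range:
  assumes "c \<in> {0, 1}" "n \<ge> 0" "x \<in> Omega"
  shows "0 \<le> layer c n x" "layer c n x \<le> 1"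
proof -
  have "0 < x $ 2" "x $ 2 < 1" using assms by (auto simp: Omega_def)
  then have "- n * c + - n * (1 - 2 * c) * x $ 2 \<le> 0"
    using assms by (auto simp: mult_nonneg_nonneg mult_left_le algebra_simps)
  then show "layer c n x \<le> 1" unfolding layer_def by (simp flip: exp_add)
  show "0 \<le> layer c n x" by (simp add: layer_def)
qed

lemma layer_tendsto:
  assumes "c \<in> {0, 1}" "x \<in> Omega"
  shows "(\<lambda>n. layer c (real n) x) \<longlonglongrightarrow> 0"
proof -
  define d where "d = c + (1 - 2 * c) * x $ 2"
  have d: "d > 0" using assms by (auto simp: d_def Omega_def)
  have "(\<lambda>n. exp (- d) ^ n) \<longlonglongrightarrow> 0" using d by (intro LIMSEQ_power_zero) simp
  moreover have "layer c (real n) x = exp (- d) ^ n" for n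
    unfolding layer_def d_def exp_of_nat_mult[symmetric] exp_add[symmetric]
    by (simp add: algebra_simps)
  ultimately show ?thesis by simp
qed

text \<open>The left side is the dangerous term in the derivative of \<open>(1 - layer c n x) * \<phi> x\<close>. Integrating
the derivative of \<open>(layer c n x * \<phi> x)\<^sup>2\<close> over the square bounds it by the values on the edge and by
the derivative of \<open>\<phi>\<close> in the layer. The factor \<open>sqrt n\<close> is harmless when the values on the edge tend
to zero for fixed \<open>n\<close>.\<close>

lemma layer_estimate:
  assumes \<phi>: "smooth \<phi>" and c: "c \<in> {0, 1}" and n: "n > 0"
  shows "l2n OM (\<lambda>x. n * (layer c n x * \<phi> x)) \<le>
    sqrt n * l2n EM (\<lambda>s. \<phi> (pt s c)) + l2n OM (\<lambda>x. layer c n x * pd 2 \<phi> x)"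
proof -
  let ?w = "layer c n"
  let ?a = "\<lambda>x. ?w x * \<phi> x" and ?b = "\<lambda>x. ?w x * pd 2 \<phi> x"
  let ?\<psi> = "\<lambda>x. ?a x * ?a x"
  define X Y E Z where "X = l2n OM ?a" and "Y = l2n OM ?b" and "E = l2n EM (\<lambda>s. \<phi> (pt s c))"
    and "Z = (\<integral>x. ?a x * ?b x \<partial>OM)"
  have sa: "smooth ?a" and sb: "smooth ?b" using \<phi> by auto
  have s\<psi>: "smooth ?\<psi>" using sa by auto
  have pda: "pd 2 ?a x = - n * (1 - 2 * c) * ?a x + ?b x" for x
    by (subst pd_mult) (use \<phi> in \<open>auto simp: pd_layer algebra_simps intro: smooth_differentiable smooth_layer\<close>)
  have "pd 2 ?\<psi> x = - 2 * n * (1 - 2 * c) * (?a x)\<^sup>2 + 2 * (?a x * ?b x)" for x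
  proof -
    have "pd 2 ?\<psi> x = pd 2 ?a x * ?a x + ?a x * pd 2 ?a x"
      by (intro pd_mult smooth_differentiable sa)
    then show ?thesis unfolding pda by (simp add: algebra_simps power2_eq_square)
  qed
  then have "(\<integral>x. pd 2 ?\<psi> x \<partial>OM) = (\<integral>x. - 2 * n * (1 - 2 * c) * (?a x)\<^sup>2 + 2 * (?a x * ?b x) \<partial>OM)"
    by simp
  also have "\<dots> = (\<integral>x. - 2 * n * (1 - 2 * c) * (?a x)\<^sup>2 \<partial>OM) + (\<integral>x. 2 * (?a x * ?b x) \<partial>OM)"
    by (intro Bochner_Integration.integral_add Bochner_Integration.integrable_mult_right
        sq_int_integrable sq_int_mult_integrable smooth_sq_int sa sb)
  also have "\<dots> = - 2 * n * (1 - 2 * c) * X\<^sup>2 + 2 * Z"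
    by (simp only: Bochner_Integration.integral_mult_right_zero X_def Z_def l2n_sq)
  finally have I: "(\<integral>x. pd 2 ?\<psi> x \<partial>OM) = - 2 * n * (1 - 2 * c) * X\<^sup>2 + 2 * Z" .
  have "(\<integral>x. pd 2 ?\<psi> x \<partial>OM) = (\<integral>s. indicator {0<..<1} s * (?\<psi> (pt s 1) - ?\<psi> (pt s 0)) \<partial>lborel)"
    by (rule integral_pd2[OF s\<psi>])
  also have "\<dots> = (\<integral>s. ?\<psi> (pt s 1) - ?\<psi> (pt s 0) \<partial>EM)"
    by (simp add: integral_restrict_space)
  also have "\<dots> = (\<integral>s. ?\<psi> (pt s 1) \<partial>EM) - (\<integral>s. ?\<psi> (pt s 0) \<partial>EM)"
    by (intro Bochner_Integration.integral_diff EM.sq_int_integrable1 edge_sq_int s\<psi>)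
  finally have "- 2 * n * (1 - 2 * c) * X\<^sup>2 + 2 * Z =
    (\<integral>s. ?\<psi> (pt s 1) \<partial>EM) - (\<integral>s. ?\<psi> (pt s 0) \<partial>EM)" using I by simp
  moreover define P where "P t = (\<integral>s. ?\<psi> (pt s t) \<partial>EM)" for t
  ultimately have J: "- 2 * n * (1 - 2 * c) * X\<^sup>2 + 2 * Z = P 1 - P 0" by simp
  have pos: "0 \<le> P t" for t unfolding P_def by (rule Bochner_Integration.integral_nonneg) simp
  have e: "P c = E\<^sup>2"
    unfolding E_def l2n_sq P_def
    by (intro Bochner_Integration.integral_cong) (auto simp: layer_edge[OF c] power2_eq_square)
  have "\<bar>Z\<bar> \<le> X * Y"
    unfolding X_def Y_def Z_def by (intro l2n_Cauchy_Schwarz smooth_sq_int sa sb)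
  \<comment> \<open>the edge opposite to \<open>x\<^sub>2 = c\<close> contributes with a favourable sign in both cases\<close>
  moreover have "2 * (n * X\<^sup>2) \<le> E\<^sup>2 + 2 * \<bar>Z\<bar>"
  proof (cases "c = 0")
    case True
    then show ?thesis using J e pos[of 1] by simp
  next
    case False
    then have "c = 1" using c by simp
    then show ?thesis using J e pos[of 0] by simp
  qed
  ultimately have "2 * n * X\<^sup>2 \<le> E\<^sup>2 + 2 * (X * Y)" by linarith
  then have "n * (2 * n * X\<^sup>2) \<le> n * (E\<^sup>2 + 2 * (X * Y))" using n by (intro mult_left_mono) auto
  then have "(n * X)\<^sup>2 + (n * X - Y)\<^sup>2 \<le> n * E\<^sup>2 + Y\<^sup>2"
    by (simp add: power2_eq_square algebra_simps)
  then have "(n * X)\<^sup>2 \<le> n * E\<^sup>2 + Y\<^sup>2" using zero_le_power2[of "n * X - Y"] by linarith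
  also have "\<dots> \<le> (sqrt n * E + Y)\<^sup>2"
    using n by (simp add: power2_sum power_mult_distrib E_def Y_def)
  finally have "n * X \<le> sqrt n * E + Y"
    by (rule power2_le_imp_le) (use n in \<open>simp add: E_def Y_def\<close>)
  then show ?thesis unfolding X_def Y_def E_def l2n_scale using n by simp
qed

lemma l2n_mult_le:
  assumes f: "f \<in> sq_int OM" and g: "smooth g" and b: "\<And>x. x \<in> Omega \<Longrightarrow> \<bar>g x\<bar> \<le> 1"
  shows "(\<lambda>x. g x * f x) \<in> sq_int OM" "l2n OM (\<lambda>x. g x * f x) \<le> l2n OM f"
proof -
  have m: "(\<lambda>x. g x * f x) \<in> borel_measurable OM"
    using sq_int_measurable[OF f] sq_int_measurable[OF smooth_sq_int[OF g]]
    by (intro borel_measurable_times)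
  have "\<bar>g x * f x\<bar> \<le> \<bar>f x\<bar>" if "x \<in> space OM" for x
    using b[of x] that by (auto simp: abs_mult intro: mult_left_le_one_le)
  from l2n_mono[OF f m this]
  show "(\<lambda>x. g x * f x) \<in> sq_int OM" "l2n OM (\<lambda>x. g x * f x) \<le> l2n OM f" by auto
qed

lemma layer_l2_tendsto:
  assumes f: "f \<in> sq_int OM" and c: "c \<in> {0, 1}"
  shows "(\<lambda>n. l2n OM (\<lambda>x. layer c (real n) x * f x)) \<longlonglongrightarrow> 0"
proof (rule l2n_dominated_tendsto[OF f])
  show "(\<lambda>x. layer c (real n) x * f x) \<in> borel_measurable OM" for n
    using sq_int_measurable[OF f] sq_int_measurable[OF smooth_sq_int[OF smooth_layer]]
    by (intro borel_measurable_times)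
  show "\<bar>layer c (real n) x * f x\<bar> \<le> \<bar>f x\<bar>" if "x \<in> space OM" for n x
    using layer_range[OF c, of "real n" x] that by (auto simp: abs_mult intro: mult_left_le_one_le)
  have "(\<lambda>n. layer c (real n) x * f x) \<longlonglongrightarrow> 0" if "x \<in> Omega" for x
    using tendsto_mult_right[OF layer_tendsto[OF c that], of "f x"] by simp
  then show "AE x in OM. (\<lambda>n. layer c (real n) x * f x) \<longlonglongrightarrow> 0" by (intro AE_I2) simp
qed

lemma layer_l2_le:
  assumes f: "f \<in> sq_int OM" and c: "c \<in> {0, 1}" and n: "n \<ge> 0"
  shows "(\<lambda>x. layer c n x * f x) \<in> sq_int OM" "l2n OM (\<lambda>x. layer c n x * f x) \<le> l2n OM f"
  using l2n_mult_le[OF f smooth_layer, of c n] layer_range[OF c n] by auto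

lemma layer_cut_error:
  assumes g: "g \<in> sq_int OM" and h: "h \<in> sq_int OM" and c: "c \<in> {0, 1}" and n: "n \<ge> 0"
  shows "l2n OM (\<lambda>x. (1 - layer c n x) * h x - g x) \<le>
    2 * l2n OM (\<lambda>x. h x - g x) + l2n OM (\<lambda>x. layer c n x * g x)"
proof -
  have d: "(\<lambda>x. h x - g x) \<in> sq_int OM" using g h by auto
  note lg = layer_l2_le[OF g c n] and ld = layer_l2_le[OF d c n]
  have "l2n OM (\<lambda>x. (1 - layer c n x) * h x - g x) =
      l2n OM (\<lambda>x. ((h x - g x) - layer c n x * (h x - g x)) - layer c n x * g x)"
    by (simp add: algebra_simps)
  also have "\<dots> \<le> (l2n OM (\<lambda>x. h x - g x) + l2n OM (\<lambda>x. layer c n x * (h x - g x))) + l2n OM (\<lambda>x. layer c n x * g x)"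
    by (rule order_trans[OF l2n_triangle_diff]) (intro sq_int_diff d ld lg add_right_mono l2n_triangle_diff)+
  also have "\<dots> \<le> 2 * l2n OM (\<lambda>x. h x - g x) + l2n OM (\<lambda>x. layer c n x * g x)"
    using ld(2) by simp
  finally show ?thesis .
qed

text \<open>The smooth functions \<open>\<phi> k\<close> are multiplied by \<open>1 - layer c n x\<close>. For fixed \<open>n\<close> the error tends, as
\<open>k\<close> grows, to a quantity that involves only the parts of \<open>f\<close> and its derivatives in the layer, and
this tends to zero as \<open>n\<close> grows. A diagonal choice of \<open>k\<close> finishes the proof.\<close>
lemma approx_vanishing_on_edge:
  assumes \<phi>: "smooth_approx \<phi> f" and c: "c \<in> {0, 1}"
    and E: "(\<lambda>k. l2n EM (\<lambda>s. \<phi> k (pt s c))) \<longlonglongrightarrow> 0"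
  obtains F where "smooth_approx F f" "\<And>k x. x $ 2 = c \<Longrightarrow> F k x = 0"
proof -
  note \<phi>s = smooth_approxD(2)[OF \<phi>]
  have fH: "f \<in> H1" and fs: "f \<in> sq_int OM" and ds: "weak_pd i f \<in> sq_int OM" for i
    using smooth_approxD(1)[OF \<phi>] by (auto intro: H1_sq_int weak_pd_sq_int)
  define G where "G n k x = (1 - layer c (real n) x) * \<phi> k x" for n k x
  have Gs: "smooth (G n k)" for n k
    unfolding G_def using \<phi>s by (intro smooth_mult smooth_diff smooth_const smooth_layer)
  define \<delta> where "\<delta> k = l2n OM (\<lambda>x. \<phi> k x - f x) + (\<Sum>i\<in>UNIV. l2n OM (\<lambda>x. pd i (\<phi> k) x - weak_pd i f x))" for k
  have \<delta>0: "\<delta> \<longlonglongrightarrow> 0"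
  proof -
    have "\<delta> \<longlonglongrightarrow> 0 + (\<Sum>i\<in>(UNIV::2 set). 0)"
      unfolding \<delta>_def by (intro tendsto_add tendsto_sum smooth_approxD[OF \<phi>])
    then show ?thesis by simp
  qed
  have \<delta>f: "l2n OM (\<lambda>x. \<phi> k x - f x) \<le> \<delta> k" for k
    by (simp add: \<delta>_def sum_nonneg)
  have \<delta>d: "l2n OM (\<lambda>x. pd i (\<phi> k) x - weak_pd i f x) \<le> \<delta> k" for i k
  proof -
    have "l2n OM (\<lambda>x. pd i (\<phi> k) x - weak_pd i f x) \<le> (\<Sum>i\<in>UNIV. l2n OM (\<lambda>x. pd i (\<phi> k) x - weak_pd i f x))"
      by (rule member_le_sum[where f = "\<lambda>i. l2n OM (\<lambda>x. pd i (\<phi> k) x - weak_pd i f x)"]) auto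
    then show ?thesis unfolding \<delta>_def using l2n_nonneg[of OM "\<lambda>x. \<phi> k x - f x"] by linarith
  qed
  define a where "a n = l2n OM (\<lambda>x. layer c (real n) x * f x)
      + (\<Sum>i\<in>UNIV. 2 * l2n OM (\<lambda>x. layer c (real n) x * weak_pd i f x))" for n
  have a0: "a \<longlonglongrightarrow> 0"
  proof -
    have "a \<longlonglongrightarrow> 0 + (\<Sum>i\<in>(UNIV::2 set). 2 * 0)"
      unfolding a_def by (intro tendsto_add tendsto_sum tendsto_mult tendsto_const layer_l2_tendsto fs ds c)
    then show ?thesis by simp
  qed
  have af: "l2n OM (\<lambda>x. layer c (real n) x * f x) \<le> a n" for n
    by (simp add: a_def sum_nonneg)
  have ad: "2 * l2n OM (\<lambda>x. layer c (real n) x * weak_pd i f x) \<le> a n" for i n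
  proof -
    have "2 * l2n OM (\<lambda>x. layer c (real n) x * weak_pd i f x) \<le> (\<Sum>i\<in>UNIV. 2 * l2n OM (\<lambda>x. layer c (real n) x * weak_pd i f x))"
      by (rule member_le_sum[where f = "\<lambda>i. 2 * l2n OM (\<lambda>x. layer c (real n) x * weak_pd i f x)"]) auto
    then show ?thesis unfolding a_def using l2n_nonneg[of OM "\<lambda>x. layer c (real n) x * f x"] by linarith
  qed
  \<comment> \<open>a bound for all errors at once; the last term is what remains as \<open>k\<close> grows\<close>
  define B where "B n k = 3 * \<delta> k + sqrt (real n) * l2n EM (\<lambda>s. \<phi> k (pt s c)) + a n" for n k
  have \<delta>pos: "0 \<le> \<delta> k" for k by (simp add: \<delta>_def sum_nonneg)
  have Gf: "l2n OM (\<lambda>x. G n k x - f x) \<le> B n k" for n k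
  proof -
    have "l2n OM (\<lambda>x. G n k x - f x) \<le> 2 * l2n OM (\<lambda>x. \<phi> k x - f x) + l2n OM (\<lambda>x. layer c (real n) x * f x)"
      unfolding G_def by (intro layer_cut_error smooth_sq_int \<phi>s fs c) simp
    moreover have "0 \<le> sqrt (real n) * l2n EM (\<lambda>s. \<phi> k (pt s c))" by simp
    ultimately show ?thesis using \<delta>f[of k] af[of n] \<delta>pos[of k] unfolding B_def by linarith
  qed
  have Gd: "l2n OM (\<lambda>x. pd i (G n k) x - weak_pd i f x) \<le> B n k" if n: "n > 0" for i n k
  proof -
    have eq: "pd i (G n k) x = (1 - layer c (real n) x) * pd i (\<phi> k) x - pd i (layer c (real n)) x * \<phi> k x" for x
      unfolding G_def
      by (subst pd_mult) (use \<phi>s in \<open>auto simp: pd_diff smooth_differentiable[OF smooth_layer]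
        smooth_differentiable[OF smooth_const] intro!: smooth_differentiable smooth_diff\<close>)
    have 1: "l2n OM (\<lambda>x. (1 - layer c (real n) x) * pd i (\<phi> k) x - weak_pd i f x)
        \<le> 2 * l2n OM (\<lambda>x. pd i (\<phi> k) x - weak_pd i f x) + l2n OM (\<lambda>x. layer c (real n) x * weak_pd i f x)"
      by (intro layer_cut_error smooth_sq_int smooth_pd \<phi>s ds c) simp
    have 2: "l2n OM (\<lambda>x. pd i (layer c (real n)) x * \<phi> k x) \<le>
        sqrt (real n) * l2n EM (\<lambda>s. \<phi> k (pt s c)) + \<delta> k + l2n OM (\<lambda>x. layer c (real n) x * weak_pd i f x)"
    proof (cases "i = 2")
      case True
      have "l2n OM (\<lambda>x. pd i (layer c (real n)) x * \<phi> k x) = l2n OM (\<lambda>x. real n * (layer c (real n) x * \<phi> k x))"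
        unfolding l2n_def
        by (rule arg_cong[where f = sqrt], rule Bochner_Integration.integral_cong)
           (use c True in \<open>auto simp: pd_layer power2_eq_square\<close>)
      also have "\<dots> \<le> sqrt (real n) * l2n EM (\<lambda>s. \<phi> k (pt s c)) + l2n OM (\<lambda>x. layer c (real n) x * pd 2 (\<phi> k) x)"
        by (intro layer_estimate \<phi>s c) (use n in simp)
      also have "l2n OM (\<lambda>x. layer c (real n) x * pd 2 (\<phi> k) x) =
          l2n OM (\<lambda>x. layer c (real n) x * (pd 2 (\<phi> k) x - weak_pd 2 f x) + layer c (real n) x * weak_pd 2 f x)"
        by (simp add: algebra_simps)
      also have "\<dots> \<le> l2n OM (\<lambda>x. layer c (real n) x * (pd 2 (\<phi> k) x - weak_pd 2 f x)) + l2n OM (\<lambda>x. layer c (real n) x * weak_pd 2 f x)"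
        by (intro l2n_triangle layer_l2_le sq_int_diff smooth_sq_int smooth_pd \<phi>s ds c) simp_all
      also have "l2n OM (\<lambda>x. layer c (real n) x * (pd 2 (\<phi> k) x - weak_pd 2 f x)) \<le> l2n OM (\<lambda>x. pd 2 (\<phi> k) x - weak_pd 2 f x)"
        by (intro layer_l2_le sq_int_diff smooth_sq_int smooth_pd \<phi>s ds c) simp
      finally show ?thesis using \<delta>d[of 2 k] True by simp
    next
      case False
      then have "l2n OM (\<lambda>x. pd i (layer c (real n)) x * \<phi> k x) = 0" by (simp add: pd_layer l2n_def)
      then show ?thesis using \<delta>pos[of k] by simp
    qed
    have "l2n OM (\<lambda>x. pd i (G n k) x - weak_pd i f x) =
        l2n OM (\<lambda>x. ((1 - layer c (real n) x) * pd i (\<phi> k) x - weak_pd i f x) - pd i (layer c (real n)) x * \<phi> k x)"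
      unfolding eq by (simp add: algebra_simps)
    also have "\<dots> \<le> l2n OM (\<lambda>x. (1 - layer c (real n) x) * pd i (\<phi> k) x - weak_pd i f x)
        + l2n OM (\<lambda>x. pd i (layer c (real n)) x * \<phi> k x)"
      by (intro l2n_triangle_diff sq_int_diff ds smooth_sq_int smooth_mult smooth_diff smooth_const smooth_layer smooth_pd \<phi>s)
    finally show ?thesis
      using 1 2 \<delta>d[of i k] ad[of n i] unfolding B_def by linarith
  qed
  have "\<exists>k. B (Suc n) k < a (Suc n) + inverse (real (Suc n))" for n
  proof -
    have "(\<lambda>k. B (Suc n) k) \<longlonglongrightarrow> 3 * 0 + sqrt (real (Suc n)) * 0 + a (Suc n)"
      unfolding B_def by (intro tendsto_add tendsto_mult tendsto_const \<delta>0 E)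
    then have "\<forall>\<^sub>F k in sequentially. B (Suc n) k < a (Suc n) + inverse (real (Suc n))"
      by (rule order_tendstoD) simp
    then show ?thesis by (auto simp: eventually_sequentially)
  qed
  then obtain k where k: "\<And>n. B (Suc n) (k n) < a (Suc n) + inverse (real (Suc n))" by metis
  have "(\<lambda>n. a (Suc n) + inverse (real (Suc n))) \<longlonglongrightarrow> 0 + 0"
    by (intro tendsto_add LIMSEQ_Suc[OF a0] LIMSEQ_inverse_real_of_nat)
  then have lim: "(\<lambda>n. a (Suc n) + inverse (real (Suc n))) \<longlonglongrightarrow> 0" by simp
  show thesis
  proof (rule that[of "\<lambda>n. G (Suc n) (k n)"])
    show "smooth_approx (\<lambda>n. G (Suc n) (k n)) f"
      unfolding smooth_approx_def
    proof (intro conjI allI fH Gs)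
      show "(\<lambda>n. l2n OM (\<lambda>x. G (Suc n) (k n) x - f x)) \<longlonglongrightarrow> 0"
      proof (rule Lim_null_comparison[OF always_eventually[OF allI] lim])
        show "norm (l2n OM (\<lambda>x. G (Suc n) (k n) x - f x)) \<le> a (Suc n) + inverse (real (Suc n))" for n
          using Gf[of "Suc n" "k n"] k[of n] unfolding real_norm_def abs_of_nonneg[OF l2n_nonneg] by linarith
      qed
      show "(\<lambda>n. l2n OM (\<lambda>x. pd i (G (Suc n) (k n)) x - weak_pd i f x)) \<longlonglongrightarrow> 0" for i
      proof (rule Lim_null_comparison[OF always_eventually[OF allI] lim])
        show "norm (l2n OM (\<lambda>x. pd i (G (Suc n) (k n)) x - weak_pd i f x)) \<le> a (Suc n) + inverse (real (Suc n))" for n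
          using Gd[of "Suc n" i "k n"] k[of n] unfolding real_norm_def abs_of_nonneg[OF l2n_nonneg] by simp
      qed
    qed
    show "G (Suc n) (k n) x = 0" if "x $ 2 = c" for n x
      unfolding G_def layer_edge[OF c that] by simp
  qed
qed

text \<open>The traces on the two edges come with different approximating sequences. One obtains \<open>G\<close> zero
on the upper and \<open>F\<close> zero on the lower edge; their convex combination with weights \<open>x\<^sub>2\<close> and
\<open>1 - x\<^sub>2\<close> is zero on both, and the derivatives of the weights only contribute \<open>G k - F k\<close>, which
tends to zero.\<close>

lemma zero_trace_approx:
  assumes "has_edge_trace f 1 (\<lambda>_. 0)" "has_edge_trace f 0 (\<lambda>_. 0)"
  obtains F where "smooth_approx F f" "\<And>k x. x $ 2 \<in> {0, 1} \<Longrightarrow> F k x = 0"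
proof -
  obtain \<phi> where \<phi>: "smooth_approx \<phi> f" "(\<lambda>k. l2n EM (\<lambda>s. \<phi> k (pt s 1))) \<longlonglongrightarrow> 0"
    using assms(1) unfolding edge_trace_iff by auto
  obtain \<phi>' where \<phi>': "smooth_approx \<phi>' f" "(\<lambda>k. l2n EM (\<lambda>s. \<phi>' k (pt s 0))) \<longlonglongrightarrow> 0"
    using assms(2) unfolding edge_trace_iff by auto
  obtain G where G: "smooth_approx G f" "\<And>k x. x $ 2 = 1 \<Longrightarrow> G k x = 0"
    by (rule approx_vanishing_on_edge[OF \<phi>(1) _ \<phi>(2)]) auto
  obtain F where F: "smooth_approx F f" "\<And>k x. x $ 2 = 0 \<Longrightarrow> F k x = 0"
    by (rule approx_vanishing_on_edge[OF \<phi>'(1) _ \<phi>'(2)]) auto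
  have fH: "f \<in> H1" and fs: "f \<in> sq_int OM" and ds: "weak_pd i f \<in> sq_int OM" for i
    using smooth_approxD(1)[OF \<phi>(1)] by (auto intro: H1_sq_int weak_pd_sq_int)
  note Gs = smooth_approxD(2)[OF G(1)] and Fs = smooth_approxD(2)[OF F(1)]
  define H where "H k x = x $ 2 * G k x + (1 - x $ 2) * F k x" for k x
  have Hs: "smooth (H k)" for k
    unfolding H_def by (intro smooth_add smooth_mult smooth_diff smooth_const smooth_nth Gs Fs)
  have pdH: "pd i (H k) x = (x $ 2 * pd i (G k) x + (1 - x $ 2) * pd i (F k) x) +
      (if i = 2 then 1 else 0) * (G k x - F k x)" for i k x
  proof -
    have d: "(\<lambda>x. x $ 2) differentiable at x" "G k differentiable at x" "F k differentiable at x"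
      "(\<lambda>x. 1 - x $ 2) differentiable at x" "(\<lambda>x. x $ 2 * G k x) differentiable at x"
      "(\<lambda>x. (1 - x $ 2) * F k x) differentiable at x" for x :: plane
      by (intro smooth_differentiable smooth_mult smooth_diff smooth_const smooth_nth Gs Fs)+
    show ?thesis
      unfolding H_def by (auto simp: pd_add pd_mult pd_diff pd_nth d differentiable_const algebra_simps)
  qed
  have r: "\<bar>x $ 2\<bar> \<le> 1" "\<bar>1 - x $ 2\<bar> \<le> 1" if "x \<in> Omega" for x
    using that by (auto simp: Omega_def less_imp_le abs_le_iff)
  have mix: "l2n OM (\<lambda>x. (x $ 2 * p x + (1 - x $ 2) * q x) - h x)
      \<le> l2n OM (\<lambda>x. p x - h x) + l2n OM (\<lambda>x. q x - h x)"
    "(\<lambda>x. (x $ 2 * p x + (1 - x $ 2) * q x) - h x) \<in> sq_int OM"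
    if "p \<in> sq_int OM" "q \<in> sq_int OM" "h \<in> sq_int OM" for p q h
  proof -
    have pq: "(\<lambda>x. p x - h x) \<in> sq_int OM" "(\<lambda>x. q x - h x) \<in> sq_int OM" using that by auto
    note A = l2n_mult_le[OF pq(1) smooth_nth r(1)]
      and B = l2n_mult_le[OF pq(2) smooth_diff[OF smooth_const smooth_nth] r(2)]
    have eq: "(x $ 2 * p x + (1 - x $ 2) * q x) - h x = x $ 2 * (p x - h x) + (1 - x $ 2) * (q x - h x)" for x
      by (simp add: algebra_simps)
    show "(\<lambda>x. (x $ 2 * p x + (1 - x $ 2) * q x) - h x) \<in> sq_int OM"
      unfolding eq by (rule sq_int_add[OF A(1) B(1)])
    show "l2n OM (\<lambda>x. (x $ 2 * p x + (1 - x $ 2) * q x) - h x)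
      \<le> l2n OM (\<lambda>x. p x - h x) + l2n OM (\<lambda>x. q x - h x)"
      unfolding eq using l2n_triangle[OF A(1) B(1)] A(2) B(2) by linarith
  qed
  show thesis
  proof (rule that[of H])
    show "smooth_approx H f"
      unfolding smooth_approx_def
    proof (intro conjI allI fH Hs)
      have lim: "(\<lambda>k. l2n OM (\<lambda>x. G k x - f x) + l2n OM (\<lambda>x. F k x - f x)) \<longlonglongrightarrow> 0"
        using tendsto_add[OF smooth_approxD(3)[OF G(1)] smooth_approxD(3)[OF F(1)]] by simp
      show "(\<lambda>k. l2n OM (\<lambda>x. H k x - f x)) \<longlonglongrightarrow> 0"
        by (rule Lim_null_comparison[OF always_eventually[OF allI] lim])
           (use mix(1)[OF smooth_sq_int[OF Gs] smooth_sq_int[OF Fs] fs] in \<open>simp add: H_def\<close>)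
      fix i :: 2
      have limd: "(\<lambda>k. l2n OM (\<lambda>x. pd i (G k) x - weak_pd i f x) + l2n OM (\<lambda>x. pd i (F k) x - weak_pd i f x)
          + (l2n OM (\<lambda>x. G k x - f x) + l2n OM (\<lambda>x. F k x - f x))) \<longlonglongrightarrow> 0"
        using tendsto_add[OF tendsto_add[OF smooth_approxD(4)[OF G(1), of i] smooth_approxD(4)[OF F(1), of i]] lim] by simp
      show "(\<lambda>k. l2n OM (\<lambda>x. pd i (H k) x - weak_pd i f x)) \<longlonglongrightarrow> 0"
      proof (rule Lim_null_comparison[OF always_eventually[OF allI] limd])
        fix k
        let ?m = "\<lambda>x. (x $ 2 * pd i (G k) x + (1 - x $ 2) * pd i (F k) x) - weak_pd i f x"
        let ?e = "(if i = 2 then 1 else 0) :: real"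
        have gf: "(\<lambda>x. G k x - F k x) \<in> sq_int OM" by (intro sq_int_diff smooth_sq_int Gs Fs)
        have "l2n OM (\<lambda>x. pd i (H k) x - weak_pd i f x) = l2n OM (\<lambda>x. ?m x + ?e * (G k x - F k x))"
          unfolding pdH by (simp add: algebra_simps)
        also have "\<dots> \<le> l2n OM ?m + l2n OM (\<lambda>x. ?e * (G k x - F k x))"
          by (intro l2n_triangle mix sq_int_scale gf smooth_sq_int smooth_pd Gs Fs ds)
        also have "l2n OM (\<lambda>x. ?e * (G k x - F k x)) \<le> l2n OM (\<lambda>x. G k x - F k x)"
          by (simp add: l2n_scale)
        also have "l2n OM (\<lambda>x. G k x - F k x) \<le> l2n OM (\<lambda>x. G k x - f x) + l2n OM (\<lambda>x. F k x - f x)"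
          using l2n_triangle3[OF smooth_sq_int[OF Gs] fs smooth_sq_int[OF Fs], of k k]
          by (simp add: l2n_minus_commute[of OM f])
        also have "l2n OM ?m \<le> l2n OM (\<lambda>x. pd i (G k) x - weak_pd i f x) + l2n OM (\<lambda>x. pd i (F k) x - weak_pd i f x)"
          by (intro mix smooth_sq_int smooth_pd Gs Fs ds)
        finally show "norm (l2n OM (\<lambda>x. pd i (H k) x - weak_pd i f x)) \<le>
            l2n OM (\<lambda>x. pd i (G k) x - weak_pd i f x) + l2n OM (\<lambda>x. pd i (F k) x - weak_pd i f x)
          + (l2n OM (\<lambda>x. G k x - f x) + l2n OM (\<lambda>x. F k x - f x))" by simp
      qed
    qed
    show "H k x = 0" if "x $ 2 \<in> {0, 1}" for k x
      using that F(2)[of x k] G(2)[of x k] by (auto simp: H_def)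
  qed
qed

section \<open>Inequalities of Poincare and Korn\<close>

text \<open>Integration by parts of \<open>f\<^sup>2 = f\<^sup>2 \<partial>\<^sub>i x\<^sub>i\<close> gives \<open>\<integral> f\<^sup>2 = - 2 \<integral> x\<^sub>i f \<partial>\<^sub>i f\<close>, and \<open>x\<^sub>i\<close> is at most 1.\<close>

lemma poincare_smooth:
  assumes f: "smooth f" and zero: "\<And>x. x \<in> cbox 0 1 \<Longrightarrow> x $ i \<in> {0, 1} \<Longrightarrow> f x = 0"
  shows "l2n OM f \<le> 2 * l2n OM (pd i f)"
proof -
  let ?g = "\<lambda>x. x $ i * f x"
  have g: "smooth ?g" using f by (intro smooth_mult smooth_nth)
  have fs: "f \<in> sq_int OM" "pd i f \<in> sq_int OM" using f by (auto intro: smooth_sq_int)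
  note gl = l2n_mult_le[OF fs(1) smooth_nth[of i]]
  have r: "\<bar>x $ i\<bar> \<le> 1" if "x \<in> Omega" for x using that by (auto simp: Omega_def less_imp_le abs_le_iff)
  have pdg: "pd i ?g x = f x + x $ i * pd i f x" for x
    by (subst pd_mult) (use f in \<open>auto intro: smooth_differentiable simp: pd_nth\<close>)
  have "(\<integral>x. f x * pd i ?g x \<partial>OM) = - (\<integral>x. pd i f x * ?g x \<partial>OM)"
    by (rule integral_parts_smooth[OF f g]) (use zero in auto)
  moreover have "(\<integral>x. f x * pd i ?g x \<partial>OM) = (\<integral>x. f x * f x + ?g x * pd i f x \<partial>OM)"
    unfolding pdg by (simp add: algebra_simps)
  moreover have "\<dots> = (l2n OM f)\<^sup>2 + (\<integral>x. ?g x * pd i f x \<partial>OM)"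
    unfolding l2n_sq unfolding power2_eq_square
    by (intro Bochner_Integration.integral_add sq_int_mult_integrable fs smooth_sq_int g)
  moreover have "(\<integral>x. pd i f x * ?g x \<partial>OM) = (\<integral>x. ?g x * pd i f x \<partial>OM)"
    by (intro Bochner_Integration.integral_cong refl mult.commute)
  ultimately have "(l2n OM f)\<^sup>2 = - 2 * (\<integral>x. ?g x * pd i f x \<partial>OM)"
    by linarith
  also have "\<dots> \<le> 2 * (l2n OM ?g * l2n OM (pd i f))"
    using l2n_Cauchy_Schwarz[OF smooth_sq_int[OF g] fs(2)] by linarith
  also have "\<dots> \<le> 2 * (l2n OM f * l2n OM (pd i f))"
    using gl(2)[OF r] by (intro mult_left_mono mult_right_mono) auto
  finally have "l2n OM f * l2n OM f \<le> l2n OM f * (2 * l2n OM (pd i f))"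
    by (simp add: power2_eq_square)
  then show ?thesis
    using l2n_nonneg[of OM f] l2n_nonneg[of OM "pd i f"]
    by (cases "l2n OM f = 0") (auto simp: mult_le_cancel_left)
qed

text \<open>Both statements hold for smooth functions that are zero on the horizontal edges and pass to
the limit.\<close>

lemma poincare_zero_trace:
  assumes "has_edge_trace f 1 (\<lambda>_. 0)" "has_edge_trace f 0 (\<lambda>_. 0)"
  shows "l2n OM f \<le> 2 * l2n OM (weak_pd 2 f)" "(\<integral>x. weak_pd 2 f x \<partial>OM) = 0"
proof -
  obtain F where F: "smooth_approx F f" "\<And>k x. x $ 2 \<in> {0, 1} \<Longrightarrow> F k x = 0"
    using zero_trace_approx[OF assms] by metis
  note D = smooth_approxD[OF F(1)]
  have fs: "f \<in> sq_int OM" and ds: "weak_pd i f \<in> sq_int OM" for i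
    using D(1) by (auto intro: H1_sq_int weak_pd_sq_int)
  have "(\<lambda>k. l2n OM (F k)) \<longlonglongrightarrow> l2n OM f"
    by (rule l2n_tendsto_norm[OF smooth_sq_int[OF D(2)] fs D(3)])
  moreover have "(\<lambda>k. 2 * l2n OM (pd 2 (F k))) \<longlonglongrightarrow> 2 * l2n OM (weak_pd 2 f)"
    by (intro tendsto_mult_left l2n_tendsto_norm[OF smooth_sq_int[OF smooth_pd[OF D(2)]] ds D(4)])
  ultimately show "l2n OM f \<le> 2 * l2n OM (weak_pd 2 f)"
    by (rule LIMSEQ_le) (use poincare_smooth[OF D(2)] F(2) in blast)
  have "(\<lambda>k. \<integral>x. pd 2 (F k) x * 1 \<partial>OM) \<longlonglongrightarrow> (\<integral>x. weak_pd 2 f x * 1 \<partial>OM)"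
    by (rule l2n_tendsto_integral_right[OF smooth_sq_int[OF smooth_pd[OF D(2)]] ds D(4) OM.sq_int_one])
  moreover have "(\<integral>x. pd 2 (F k) x \<partial>OM) = 0" for k
    by (rule integral_pd_zero[OF D(2)]) (use F(2) in blast)
  ultimately show "(\<integral>x. weak_pd 2 f x \<partial>OM) = 0" by (simp add: LIMSEQ_const_iff)
qed

text \<open>A monomial \<open>c x\<^sub>1\<^sup>m x\<^sub>2\<^sup>n\<close> is first reduced by its mean in the second coordinate, which leaves a
derivative \<open>\<partial>\<^sub>2 q\<close>; that mean, a function of \<open>x\<^sub>1\<close>, is reduced by its own mean \<open>M\<close>, which leaves
\<open>\<partial>\<^sub>1 r\<close>.\<close>

lemma monomial_sum_decomposition:
  assumes "monomial_sum p"
  shows "\<exists>q r M. smooth q \<and> smooth r \<and> (\<forall>x. x $ 2 \<in> {0, 1} \<longrightarrow> q x = 0) \<and>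
    (\<forall>x. x $ 1 \<in> {0, 1} \<longrightarrow> r x = 0) \<and> (\<forall>x. pd 2 r x = 0) \<and>
    (\<forall>x. p x = pd 2 q x + pd 1 r x + M)"
  using assms
proof induction
  case (monomial c m n)
  define \<alpha> where "\<alpha> = c / real (Suc n)"
  define \<beta> where "\<beta> = \<alpha> / real (Suc m)"
  define q where "q x = x $ 1 ^ m * (\<alpha> * (x $ 2 ^ Suc n - x $ 2))" for x :: plane
  define r where "r x = \<beta> * (x $ 1 ^ Suc m - x $ 1)" for x :: plane
  have d1: "((\<lambda>t. t ^ m) has_real_derivative real m * t ^ (m - 1)) (at t)" for t :: real
    using DERIV_pow[of m t] by simp
  have d2: "((\<lambda>t. \<alpha> * (t ^ Suc n - t)) has_real_derivative \<alpha> * (real (Suc n) * t ^ n - 1)) (at t)" for t :: real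
    by (rule DERIV_cmult, rule DERIV_diff) (use DERIV_pow[of "Suc n" t] in auto)
  have d3: "((\<lambda>t. \<beta> * (t ^ Suc m - t)) has_real_derivative \<beta> * (real (Suc m) * t ^ m - 1)) (at t)" for t :: real
    by (rule DERIV_cmult, rule DERIV_diff) (use DERIV_pow[of "Suc m" t] in auto)
  have sq: "smooth q" unfolding q_def by (intro smooth_mult smooth_power smooth_diff smooth_const smooth_nth)
  have sr: "smooth r" unfolding r_def by (intro smooth_mult smooth_power smooth_diff smooth_const smooth_nth)
  have "pd 2 q x = x $ 1 ^ m * (\<alpha> * (real (Suc n) * x $ 2 ^ n - 1))" for x
  proof -
    have "pd 2 (\<lambda>x. x $ 1 ^ m) x = 0" by (subst pd_coord[OF d1]) simp
    moreover have "pd 2 (\<lambda>x. \<alpha> * (x $ 2 ^ Suc n - x $ 2)) x = \<alpha> * (real (Suc n) * x $ 2 ^ n - 1)"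
      by (subst pd_coord[OF d2]) (rule if_P, rule refl)
    moreover have "pd 2 q x = pd 2 (\<lambda>x. x $ 1 ^ m) x * (\<alpha> * (x $ 2 ^ Suc n - x $ 2))
        + x $ 1 ^ m * pd 2 (\<lambda>x. \<alpha> * (x $ 2 ^ Suc n - x $ 2)) x"
      unfolding q_def
      by (intro pd_mult smooth_differentiable smooth_mult smooth_power smooth_diff smooth_const smooth_nth)
    ultimately show ?thesis by (simp only: mult_zero_left add_0_left)
  qed
  moreover have "pd i r x = (if i = 1 then \<beta> * (real (Suc m) * x $ 1 ^ m - 1) else 0)" for i x
    unfolding r_def pd_coord[OF d3] by auto
  moreover have "c = \<alpha> * real (Suc n)" "\<alpha> = \<beta> * real (Suc m)"
    by (simp_all add: \<alpha>_def \<beta>_def)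
  ultimately have "c * (x $ 1 ^ m * x $ 2 ^ n) = pd 2 q x + pd 1 r x + \<beta>" "pd 2 r x = 0" for x
    by (simp_all add: algebra_simps)
  moreover have "\<forall>x. x $ 2 \<in> {0, 1} \<longrightarrow> q x = 0" "\<forall>x. x $ 1 \<in> {0, 1} \<longrightarrow> r x = 0"
    by (auto simp: q_def r_def)
  ultimately show ?case using sq sr by blast
next
  case (add p p')
  then obtain q r M q' r' M' where
    *: "smooth q" "smooth r" "\<forall>x. x $ 2 \<in> {0, 1} \<longrightarrow> q x = 0"
    "\<forall>x. x $ 1 \<in> {0, 1} \<longrightarrow> r x = 0" "\<forall>x. pd 2 r x = 0" "\<forall>x. p x = pd 2 q x + pd 1 r x + M"
    "smooth q'" "smooth r'" "\<forall>x. x $ 2 \<in> {0, 1} \<longrightarrow> q' x = 0"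
    "\<forall>x. x $ 1 \<in> {0, 1} \<longrightarrow> r' x = 0" "\<forall>x. pd 2 r' x = 0" "\<forall>x. p' x = pd 2 q' x + pd 1 r' x + M'"
    by metis
  have pq: "pd i (\<lambda>x. q x + q' x) x = pd i q x + pd i q' x" for i x
    by (intro pd_add smooth_differentiable *)
  have pr: "pd i (\<lambda>x. r x + r' x) x = pd i r x + pd i r' x" for i x
    by (intro pd_add smooth_differentiable *)
  show ?case
  proof (intro exI conjI)
    show "smooth (\<lambda>x. q x + q' x)" "smooth (\<lambda>x. r x + r' x)" using * by auto
    show "\<forall>x. x $ 2 \<in> {0, 1} \<longrightarrow> q x + q' x = 0" using * by simp
    show "\<forall>x. x $ 1 \<in> {0, 1} \<longrightarrow> r x + r' x = 0" using * by simp
    show "\<forall>x. pd 2 (\<lambda>x. r x + r' x) x = 0" using * by (simp add: pr)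
    show "\<forall>x. p x + p' x = pd 2 (\<lambda>x. q x + q' x) x + pd 1 (\<lambda>x. r x + r' x) x + (M + M')"
      using * by (simp add: pr pq)
  qed
qed

text \<open>The three summands are mutually orthogonal: integrating by parts in the second direction moves
the derivative from \<open>q\<close> to \<open>pd 1 r x + M\<close>, which depends on \<open>x\<^sub>1\<close> only, and the mean of \<open>pd 1 r\<close> is
zero. Hence neither part has a larger norm than \<open>p\<close>.\<close>

lemma polynomial_decomposition:
  fixes p :: "plane \<Rightarrow> real"
  assumes p: "real_polynomial_function p"
  obtains q r M where "smooth q" "smooth r" "\<And>x. x $ 2 \<in> {0, 1} \<Longrightarrow> q x = 0"
    "\<And>x. x $ 1 \<in> {0, 1} \<Longrightarrow> r x = 0" "\<And>x. p x = pd 2 q x + pd 1 r x + M"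
    "l2n OM (pd 2 q) \<le> l2n OM p" "l2n OM (pd 1 r) \<le> l2n OM p"
proof -
  obtain q r M where q: "smooth q" "smooth r" "\<And>x. x $ 2 \<in> {0, 1} \<Longrightarrow> q x = 0"
    "\<And>x. x $ 1 \<in> {0, 1} \<Longrightarrow> r x = 0" "\<And>x. pd 2 r x = 0" "\<And>x. p x = pd 2 q x + pd 1 r x + M"
    using monomial_sum_decomposition[OF real_polynomial_monomial_sum[OF p]] by blast
  let ?a = "pd 2 q" and ?b = "pd 1 r"
  have s: "?a \<in> sq_int OM" "?b \<in> sq_int OM" "(\<lambda>x. M) \<in> sq_int OM" "(\<lambda>x. ?b x + M) \<in> sq_int OM"
    using q by (auto intro!: smooth_sq_int)
  have "pd 2 r = (\<lambda>x. 0)" using q(5) by (rule ext)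
  then have "pd 2 ?b x = 0" for x by (simp add: pd_commute[OF q(2)])
  then have pb: "pd 2 (\<lambda>x. ?b x + M) x = 0" for x
    using q by (subst pd_add) (auto intro: smooth_differentiable)
  have "(\<integral>x. (?b x + M) * ?a x \<partial>OM) = - (\<integral>x. pd 2 (\<lambda>x. ?b x + M) x * q x \<partial>OM)"
    by (rule integral_parts_smooth) (use q in auto)
  then have o1: "(\<integral>x. (?b x + M) * ?a x \<partial>OM) = 0" by (simp add: pb)
  have "(\<integral>x. ?b x \<partial>OM) = 0" by (rule integral_pd_zero) (use q in auto)
  then have o2: "(\<integral>x. M * ?b x \<partial>OM) = 0" by simp
  have "p = (\<lambda>x. ?a x + (?b x + M))" by (rule ext) (simp add: q(6))
  then have n: "(l2n OM p)\<^sup>2 = (l2n OM ?a)\<^sup>2 + ((l2n OM ?b)\<^sup>2 + (l2n OM (\<lambda>x. M))\<^sup>2)"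
    using l2n_sq_add[OF s(1,4)] l2n_sq_add[OF s(2,3)] o1 o2 by (simp add: mult.commute)
  show thesis
  proof (rule that[of q r M])
    show "l2n OM ?a \<le> l2n OM p" by (rule power2_le_imp_le) (simp_all add: n)
    show "l2n OM ?b \<le> l2n OM p" by (rule power2_le_imp_le) (simp_all add: n)
  qed (use q in auto)
qed

text \<open>By duality: for a polynomial \<open>p\<close> decomposed as above, \<open>\<integral> p f\<close> becomes an integral of the weak
derivatives of \<open>f\<close> against \<open>q\<close> and \<open>r\<close>, whose norms are controlled by the norm of \<open>p\<close>; the constant
contributes nothing because \<open>f\<close> has mean zero. Then \<open>p\<close> tends to \<open>f\<close>.\<close>

lemma poincare_mean_zero:
  assumes f: "f \<in> H1" and mean: "(\<integral>x. f x \<partial>OM) = 0"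
  shows "l2n OM f \<le> 2 * (l2n OM (weak_pd 1 f) + l2n OM (weak_pd 2 f))"
proof -
  let ?D = "l2n OM (weak_pd 1 f) + l2n OM (weak_pd 2 f)"
  have fs: "f \<in> sq_int OM" and ds: "weak_pd i f \<in> sq_int OM" for i
    using f by (auto intro: H1_sq_int weak_pd_sq_int)
  have step: "(\<integral>x. p x * f x \<partial>OM) \<le> 2 * ?D * l2n OM p" if p: "real_polynomial_function p" for p
  proof -
    obtain q r M where q: "smooth q" "smooth r" "\<And>x. x $ 2 \<in> {0, 1} \<Longrightarrow> q x = 0"
      "\<And>x. x $ 1 \<in> {0, 1} \<Longrightarrow> r x = 0" "\<And>x. p x = pd 2 q x + pd 1 r x + M"
      "l2n OM (pd 2 q) \<le> l2n OM p" "l2n OM (pd 1 r) \<le> l2n OM p"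
      using polynomial_decomposition[OF p] by metis
    have w: "(\<integral>x. f x * pd 2 q x \<partial>OM) = - (\<integral>x. weak_pd 2 f x * q x \<partial>OM)"
      "(\<integral>x. f x * pd 1 r x \<partial>OM) = - (\<integral>x. weak_pd 1 f x * r x \<partial>OM)"
      by (rule weak_pd_boundary[OF fs ds weak_pd_is[OF f]]; use q in auto)+
    have int: "integrable OM (\<lambda>x. f x * pd 2 q x)" "integrable OM (\<lambda>x. f x * pd 1 r x)" "integrable OM (\<lambda>x. M * f x)"
      by (intro sq_int_mult_integrable smooth_sq_int smooth_pd q fs smooth_const)+
    have "(\<integral>x. p x * f x \<partial>OM) = (\<integral>x. f x * pd 2 q x + f x * pd 1 r x + M * f x \<partial>OM)"
      by (simp add: q(5) algebra_simps)
    also have "\<dots> = (\<integral>x. f x * pd 2 q x \<partial>OM) + (\<integral>x. f x * pd 1 r x \<partial>OM) + M * (\<integral>x. f x \<partial>OM)"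
      using int by simp
    also have "\<dots> = - (\<integral>x. weak_pd 2 f x * q x \<partial>OM) - (\<integral>x. weak_pd 1 f x * r x \<partial>OM)"
      by (simp add: w mean)
    also have "\<dots> \<le> l2n OM (weak_pd 2 f) * l2n OM q + l2n OM (weak_pd 1 f) * l2n OM r"
      using l2n_Cauchy_Schwarz[OF ds[of 2] smooth_sq_int[OF q(1)]]
        l2n_Cauchy_Schwarz[OF ds[of 1] smooth_sq_int[OF q(2)]] by linarith
    also have "\<dots> \<le> l2n OM (weak_pd 2 f) * (2 * l2n OM p) + l2n OM (weak_pd 1 f) * (2 * l2n OM p)"
    proof (intro add_mono mult_left_mono l2n_nonneg)
      show "l2n OM q \<le> 2 * l2n OM p" using poincare_smooth[OF q(1), of 2] q(3,6) by fastforce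
      show "l2n OM r \<le> 2 * l2n OM p" using poincare_smooth[OF q(2), of 1] q(4,7) by fastforce
    qed
    finally show ?thesis by (simp add: algebra_simps)
  qed
  obtain p where p: "\<And>k. real_polynomial_function (p k)" "(\<lambda>k. l2n OM (\<lambda>x. p k x - f x)) \<longlonglongrightarrow> 0"
    using polynomial_dense_seq[OF fs] by metis
  have ps: "p k \<in> sq_int OM" for k by (intro smooth_sq_int real_polynomial_smooth p)
  have "(\<lambda>k. \<integral>x. p k x * f x \<partial>OM) \<longlonglongrightarrow> (\<integral>x. f x * f x \<partial>OM)"
    by (rule l2n_tendsto_integral_right[OF ps fs p(2) fs])
  moreover have "(\<lambda>k. 2 * ?D * l2n OM (p k)) \<longlonglongrightarrow> 2 * ?D * l2n OM f"
    by (intro tendsto_mult_left l2n_tendsto_norm[OF ps fs p(2)])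
  ultimately have "(\<integral>x. f x * f x \<partial>OM) \<le> 2 * ?D * l2n OM f"
    by (rule LIMSEQ_le) (use step[OF p(1)] in blast)
  then have "l2n OM f * l2n OM f \<le> l2n OM f * (2 * ?D)"
    using l2n_sq[of OM f] by (simp add: power2_eq_square mult.commute)
  then show ?thesis
    using l2n_nonneg[of OM f] l2n_nonneg[of OM "weak_pd 1 f"] l2n_nonneg[of OM "weak_pd 2 f"]
    by (cases "l2n OM f = 0") (auto simp: mult_le_cancel_left)
qed

text \<open>For \<open>b = 0\<close> and \<open>b = 15/16\<close> the square is mapped onto the strip of width \<open>1/16\<close> along the left
and the right edge, and this edge is fixed pointwise.\<close>

definition squeeze :: "real \<Rightarrow> plane \<Rightarrow> plane"
  where "squeeze b = axis_map (vector [1 / 16, 1]) (vector [b, 0])"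

lemma squeeze_nth [simp]: "squeeze b x $ 1 = x $ 1 / 16 + b" "squeeze b x $ 2 = x $ 2"
  by (simp_all add: squeeze_def)

lemma squeeze_Omega: "b \<in> {0, 15/16} \<Longrightarrow> x \<in> Omega \<Longrightarrow> squeeze b x \<in> Omega"
  by (auto simp: Omega_def forall_2)

lemma squeeze_continuous: "continuous_on UNIV (squeeze b)"
  unfolding squeeze_def by (meson continuous_at_imp_continuous_on has_derivative_continuous has_derivative_axis_map)

lemma squeeze_l2:
  assumes h: "continuous_on UNIV (h :: plane \<Rightarrow> real)" and b: "b \<in> {0, 15/16}"
  shows "l2n OM (\<lambda>x. h (squeeze b x)) \<le> 4 * l2n OM h"
proof -
  have hm [measurable]: "h \<in> borel_measurable borel" by (rule borel_measurable_continuous_onI[OF h])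
  have sm [measurable]: "squeeze b \<in> borel_measurable borel" by (rule borel_measurable_continuous_onI[OF squeeze_continuous])
  have hs: "continuous_on UNIV (\<lambda>x. h (squeeze b x))"
    using continuous_on_compose2[OF h squeeze_continuous] by simp
  let ?c = "\<lambda>j. if j = axis 1 1 then 1 / 16 else 1 :: real"
  have T: "(vector [b, 0] :: plane) + (\<Sum>j\<in>Basis. (?c j * (x \<bullet> j)) *\<^sub>R j) = squeeze b x" for x
  proof -
    have "axis 1 1 \<noteq> (axis 2 1 :: plane)" by (simp add: axis_eq_axis)
    then show ?thesis
      unfolding Basis_plane by (simp add: vec_eq_iff forall_2 inner_axis) (simp add: axis_def)
  qed
  \<comment> \<open>the change of variables, whose determinant is \<open>1/16\<close>\<close>
  have dens: "lborel = density (distr lborel borel (squeeze b)) (\<lambda>_. ennreal (1 / 16))"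
    using lborel_affine_euclidean[of ?c "vector [b, 0] :: plane"]
    by (simp add: T prod_Basis_plane axis_eq_axis)
  let ?G = "\<lambda>x. indicator Omega x * ennreal ((h x)\<^sup>2)"
  have "(\<integral>\<^sup>+x. ?G x \<partial>lborel) = (\<integral>\<^sup>+x. ?G x \<partial>density (distr lborel borel (squeeze b)) (\<lambda>_. ennreal (1 / 16)))"
    by (subst dens) simp
  also have "\<dots> = (\<integral>\<^sup>+x. ennreal (1 / 16) * ?G (squeeze b x) \<partial>lborel)"
    by (subst nn_integral_density, measurable, subst nn_integral_distr, measurable)
  also have "\<dots> = ennreal (1 / 16) * (\<integral>\<^sup>+x. ?G (squeeze b x) \<partial>lborel)"
    by (rule nn_integral_cmult) measurable
  finally have A: "(\<integral>\<^sup>+x. ?G x \<partial>lborel) = ennreal (1 / 16) * (\<integral>\<^sup>+x. ?G (squeeze b x) \<partial>lborel)" .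
  have "ennreal ((l2n OM (\<lambda>x. h (squeeze b x)))\<^sup>2) = (\<integral>\<^sup>+x. ennreal ((h (squeeze b x))\<^sup>2) \<partial>OM)"
    by (rule nn_integral_sq[symmetric]) (rule continuous_sq_int[OF hs])
  also have "\<dots> = (\<integral>\<^sup>+x. ennreal ((h (squeeze b x))\<^sup>2) * indicator Omega x \<partial>lborel)"
    by (rule nn_integral_restrict_space) simp
  also have "\<dots> \<le> (\<integral>\<^sup>+x. ?G (squeeze b x) \<partial>lborel)"
    by (intro nn_integral_mono) (auto simp: indicator_def squeeze_Omega[OF b])
  finally have "ennreal (1 / 16) * ennreal ((l2n OM (\<lambda>x. h (squeeze b x)))\<^sup>2) \<le> (\<integral>\<^sup>+x. ?G x \<partial>lborel)"
    unfolding A by (rule mult_left_mono) simp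
  also have "\<dots> = (\<integral>\<^sup>+x. ennreal ((h x)\<^sup>2) * indicator Omega x \<partial>lborel)"
    by (simp add: mult.commute)
  also have "\<dots> = (\<integral>\<^sup>+x. ennreal ((h x)\<^sup>2) \<partial>OM)"
    by (rule nn_integral_restrict_space[symmetric]) simp
  also have "\<dots> = ennreal ((l2n OM h)\<^sup>2)"
    by (rule nn_integral_sq) (rule continuous_sq_int[OF h])
  finally have "(1 / 16) * (l2n OM (\<lambda>x. h (squeeze b x)))\<^sup>2 \<le> (l2n OM h)\<^sup>2"
    by (simp flip: ennreal_mult)
  then have "(l2n OM (\<lambda>x. h (squeeze b x)))\<^sup>2 \<le> (4 * l2n OM h)\<^sup>2"
    by (simp add: power_mult_distrib)
  then show ?thesis by (rule power2_le_imp_le) simp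
qed

text \<open>The interpolation between the two squeezed copies of \<open>h\<close> agrees with \<open>h\<close> on both vertical edges.\<close>

definition lift :: "(plane \<Rightarrow> real) \<Rightarrow> plane \<Rightarrow> real"
  where "lift h x = (1 - x $ 1) * h (squeeze 0 x) + x $ 1 * h (squeeze (15/16) x)"

lemma smooth_squeeze: "smooth h \<Longrightarrow> smooth (\<lambda>x. h (squeeze b x))"
  unfolding squeeze_def by (rule smooth_axis_map)

lemma pd_squeeze:
  assumes "smooth h"
  shows "pd i (\<lambda>x. h (squeeze b x)) x = (if i = 1 then 1 / 16 else 1) * pd i h (squeeze b x)"
proof -
  have "i = 1 \<or> i = 2" by (rule exhaust_2)
  then show ?thesis
    unfolding squeeze_def using assms by (auto simp: pd_axis_map smooth_differentiable)
qed

lemma smooth_lift: "smooth h \<Longrightarrow> smooth (lift h)"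
  unfolding lift_def by (intro smooth_add smooth_mult smooth_diff smooth_const smooth_nth smooth_squeeze)

lemma pd_lift:
  assumes "smooth h"
  shows "pd 1 (lift h) x = 1 / 16 * lift (pd 1 h) x + (h (squeeze (15/16) x) - h (squeeze 0 x))"
    "pd 2 (lift h) x = lift (pd 2 h) x"
proof -
  have d: "(\<lambda>x. 1 - x $ 1) differentiable at x" "(\<lambda>x. x $ 1) differentiable at x"
    "(\<lambda>x. h (squeeze b x)) differentiable at x" "(\<lambda>x. (1 - x $ 1) * h (squeeze 0 x)) differentiable at x"
    "(\<lambda>x. x $ 1 * h (squeeze (15/16) x)) differentiable at x" for x :: plane and b
    by (intro smooth_differentiable smooth_mult smooth_diff smooth_const smooth_nth smooth_squeeze assms)+
  show "pd 1 (lift h) x = 1 / 16 * lift (pd 1 h) x + (h (squeeze (15/16) x) - h (squeeze 0 x))"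
    "pd 2 (lift h) x = lift (pd 2 h) x"
    unfolding lift_def
    by (simp_all add: pd_add pd_mult pd_diff pd_nth d pd_squeeze[OF assms] differentiable_const algebra_simps)
qed

lemma lift_l2:
  assumes h: "smooth h"
  shows "l2n OM (lift h) \<le> 8 * l2n OM h"
proof -
  have hs: "smooth (\<lambda>x. h (squeeze b x))" for b by (rule smooth_squeeze[OF h])
  have r: "\<bar>x $ 1\<bar> \<le> 1" "\<bar>1 - x $ 1\<bar> \<le> 1" if "x \<in> Omega" for x
    using that by (auto simp: Omega_def less_imp_le abs_le_iff)
  note A = l2n_mult_le[OF smooth_sq_int[OF hs[of 0]] smooth_diff[OF smooth_const smooth_nth] r(2)]
    and B = l2n_mult_le[OF smooth_sq_int[OF hs[of "15/16"]] smooth_nth r(1)]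
  have "l2n OM (lift h) \<le> l2n OM (\<lambda>x. h (squeeze 0 x)) + l2n OM (\<lambda>x. h (squeeze (15/16) x))"
    unfolding lift_def using l2n_triangle[OF A(1) B(1)] A(2) B(2) by linarith
  then show ?thesis
    using squeeze_l2[OF smooth_continuous[OF h], of 0] squeeze_l2[OF smooth_continuous[OF h], of "15/16"] by simp
qed

lemma pd_zero_on_line:
  assumes f: "smooth f" and z: "\<And>x. x $ j \<in> {0, 1} \<Longrightarrow> f x = 0" and ij: "i \<noteq> j" and x: "x $ j \<in> {0, 1}"
  shows "pd i f x = 0"
proof -
  have "((\<lambda>t. f (x + t *\<^sub>R axis i 1)) has_real_derivative pd i f (x + 0 *\<^sub>R axis i 1)) (at 0)"
    by (rule pd_line) (rule smooth_differentiable[OF f])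
  moreover have "(\<lambda>t. f (x + t *\<^sub>R axis i 1)) = (\<lambda>t. 0)"
  proof
    fix t
    have "(x + t *\<^sub>R axis i 1) $ j = x $ j" using ij[symmetric] by (simp add: axis_def)
    then show "f (x + t *\<^sub>R axis i 1) = 0" using x by (intro z) (simp only:)
  qed
  ultimately have "((\<lambda>t. 0) has_real_derivative pd i f x) (at 0)" by simp
  then show ?thesis using DERIV_unique DERIV_const by blast
qed

text \<open>The function \<open>Q = f - lift f\<close> vanishes on the whole boundary, so that the mixed derivative
can be moved in either order from \<open>Q\<close> to \<open>u\<close>. The factor \<open>1/2\<close> in front of the norm of \<open>pd 1 f\<close> is
\<open>1/16\<close> from the derivative of the squeezing times 8 from \<open>lift_l2\<close>; all that matters is that it is
less than 1.\<close>

lemma korn_smooth: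
  assumes u: "u \<in> H1" and f: "smooth f" and z: "\<And>x. x $ 2 \<in> {0, 1} \<Longrightarrow> f x = 0"
  shows "\<bar>\<integral>x. pd 1 f x * weak_pd 2 u x \<partial>OM\<bar> \<le>
    l2n OM (weak_pd 2 u) * (1 / 2 * l2n OM (pd 1 f) + 16 * l2n OM (pd 2 f))
    + 9 * (l2n OM (weak_pd 1 u) * l2n OM (pd 2 f))"
proof -
  have us: "u \<in> sq_int OM" and ds: "weak_pd i u \<in> sq_int OM" for i
    using u by (auto intro: H1_sq_int weak_pd_sq_int)
  define Q where "Q x = f x - lift f x" for x
  have sl: "smooth (lift f)" by (rule smooth_lift[OF f])
  have Qs: "smooth Q" unfolding Q_def by (intro smooth_diff f sl)
  have Q2: "Q x = 0" if "x $ 2 \<in> {0, 1}" for x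
    using that by (simp add: Q_def lift_def z)
  have Q1: "Q x = 0" if "x $ 1 \<in> {0, 1}" for x
  proof -
    have "x $ 1 = 0 \<or> x $ 1 = 1" using that by auto
    then show ?thesis
    proof
      assume "x $ 1 = 0"
      moreover from this have "squeeze 0 x = x" by (simp add: vec_eq_iff forall_2)
      ultimately show ?thesis by (simp add: Q_def lift_def)
    next
      assume "x $ 1 = 1"
      moreover from this have "squeeze (15/16) x = x" by (simp add: vec_eq_iff forall_2)
      ultimately show ?thesis by (simp add: Q_def lift_def)
    qed
  qed
  have "(\<integral>x. u x * pd 2 (pd 1 Q) x \<partial>OM) = - (\<integral>x. weak_pd 2 u x * pd 1 Q x \<partial>OM)"
    by (rule weak_pd_boundary[OF us ds weak_pd_is[OF u] smooth_pd[OF Qs]])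
       (rule pd_zero_on_line[OF Qs Q2], auto)
  moreover have "(\<integral>x. u x * pd 1 (pd 2 Q) x \<partial>OM) = - (\<integral>x. weak_pd 1 u x * pd 2 Q x \<partial>OM)"
    by (rule weak_pd_boundary[OF us ds weak_pd_is[OF u] smooth_pd[OF Qs]])
       (rule pd_zero_on_line[OF Qs Q1], auto)
  ultimately have key: "(\<integral>x. weak_pd 2 u x * pd 1 Q x \<partial>OM) = (\<integral>x. weak_pd 1 u x * pd 2 Q x \<partial>OM)"
    by (simp add: pd_commute[OF Qs, of 2 1])
  let ?e = "\<lambda>x. f (squeeze (15/16) x) - f (squeeze 0 x)"
  let ?R = "\<lambda>x. 1 / 16 * lift (pd 1 f) x + ?e x"
  have es: "smooth ?e" using f by (intro smooth_diff smooth_squeeze)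
  have ls: "smooth (lift (pd i f))" for i by (intro smooth_lift smooth_pd f)
  have Rs: "smooth ?R" by (intro smooth_add smooth_mult smooth_const es ls)
  have pQ1: "pd 1 Q x = pd 1 f x - ?R x" for x
    unfolding Q_def pd_diff[OF smooth_differentiable[OF f] smooth_differentiable[OF sl]] pd_lift[OF f] ..
  have pQ2: "pd 2 Q x = pd 2 f x - lift (pd 2 f) x" for x
    unfolding Q_def pd_diff[OF smooth_differentiable[OF f] smooth_differentiable[OF sl]] pd_lift[OF f] ..
  have fp: "l2n OM f \<le> 2 * l2n OM (pd 2 f)" by (rule poincare_smooth[OF f]) (rule z)
  have "l2n OM ?e \<le> l2n OM (\<lambda>x. f (squeeze (15/16) x)) + l2n OM (\<lambda>x. f (squeeze 0 x))"
    by (intro l2n_triangle_diff smooth_sq_int smooth_squeeze f)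
  also have "\<dots> \<le> 8 * l2n OM f"
    using squeeze_l2[OF smooth_continuous[OF f], of 0] squeeze_l2[OF smooth_continuous[OF f], of "15/16"] by simp
  finally have el: "l2n OM ?e \<le> 16 * l2n OM (pd 2 f)" using fp by linarith
  have "l2n OM ?R \<le> l2n OM (\<lambda>x. 1 / 16 * lift (pd 1 f) x) + l2n OM ?e"
    by (intro l2n_triangle smooth_sq_int smooth_mult smooth_const es ls)
  then have Rl: "l2n OM ?R \<le> 1 / 2 * l2n OM (pd 1 f) + 16 * l2n OM (pd 2 f)"
    using lift_l2[OF smooth_pd[OF f], of 1] el l2n_scale[of OM "1 / 16" "lift (pd 1 f)"] by linarith
  have "l2n OM (pd 2 Q) \<le> l2n OM (pd 2 f) + l2n OM (lift (pd 2 f))"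
    unfolding pQ2[abs_def] by (intro l2n_triangle_diff smooth_sq_int ls smooth_pd f)
  then have Q2l: "l2n OM (pd 2 Q) \<le> 9 * l2n OM (pd 2 f)"
    using lift_l2[OF smooth_pd[OF f], of 2] by simp
  have "(\<integral>x. weak_pd 2 u x * pd 1 Q x \<partial>OM) = (\<integral>x. weak_pd 2 u x * pd 1 f x - weak_pd 2 u x * ?R x \<partial>OM)"
    unfolding pQ1 by (simp only: right_diff_distrib)
  also have "\<dots> = (\<integral>x. weak_pd 2 u x * pd 1 f x \<partial>OM) - (\<integral>x. weak_pd 2 u x * ?R x \<partial>OM)"
    by (intro Bochner_Integration.integral_diff sq_int_mult_integrable ds smooth_sq_int smooth_pd f Rs)
  finally have "(\<integral>x. pd 1 f x * weak_pd 2 u x \<partial>OM) =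
      (\<integral>x. weak_pd 2 u x * ?R x \<partial>OM) + (\<integral>x. weak_pd 1 u x * pd 2 Q x \<partial>OM)"
    using key by (simp add: mult.commute[of "pd 1 f _"])
  moreover have "\<bar>\<integral>x. weak_pd 2 u x * ?R x \<partial>OM\<bar> \<le> l2n OM (weak_pd 2 u) * (1 / 2 * l2n OM (pd 1 f) + 16 * l2n OM (pd 2 f))"
    by (rule order_trans[OF l2n_Cauchy_Schwarz[OF ds smooth_sq_int[OF Rs]] mult_left_mono[OF Rl]]) simp
  moreover have "\<bar>\<integral>x. weak_pd 1 u x * pd 2 Q x \<partial>OM\<bar> \<le> l2n OM (weak_pd 1 u) * (9 * l2n OM (pd 2 f))"
    by (rule order_trans[OF l2n_Cauchy_Schwarz[OF ds smooth_sq_int[OF smooth_pd[OF Qs]]] mult_left_mono[OF Q2l]]) simp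
  ultimately show ?thesis by simp
qed

text \<open>In the limit of \<open>korn_smooth\<close> for smooth functions tending to \<open>v\<close>, \<open>weak_pd 1 v\<close> is replaced by the
shear strain minus \<open>weak_pd 2 u\<close>, and half of the square of the norm of \<open>weak_pd 2 u\<close> is absorbed.\<close>

lemma korn:
  assumes u: "u \<in> H1" and v: "has_edge_trace v 1 (\<lambda>_. 0)" "has_edge_trace v 0 (\<lambda>_. 0)"
  shows "l2n OM (weak_pd 2 u) \<le>
    33 * (l2n OM (weak_pd 1 u) + l2n OM (weak_pd 2 v) + l2n OM (\<lambda>x. weak_pd 2 u x + weak_pd 1 v x))"
proof -
  obtain F where F: "smooth_approx F v" "\<And>k x. x $ 2 \<in> {0, 1} \<Longrightarrow> F k x = 0"
    using zero_trace_approx[OF v] by metis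
  note D = smooth_approxD[OF F(1)]
  have us: "weak_pd i u \<in> sq_int OM" and vs: "weak_pd i v \<in> sq_int OM" for i
    using u D(1) by (auto intro: weak_pd_sq_int)
  have ps: "pd i (F k) \<in> sq_int OM" for i k by (intro smooth_sq_int smooth_pd D)
  define w g p q s where "w = l2n OM (weak_pd 2 u)" and "g = l2n OM (weak_pd 1 u)"
    and "p = l2n OM (weak_pd 1 v)" and "q = l2n OM (weak_pd 2 v)"
    and "s = l2n OM (\<lambda>x. weak_pd 2 u x + weak_pd 1 v x)"
  have pos: "0 \<le> w" "0 \<le> g" "0 \<le> p" "0 \<le> q" "0 \<le> s" by (simp_all add: w_def g_def p_def q_def s_def)
  have "(\<lambda>k. \<bar>\<integral>x. pd 1 (F k) x * weak_pd 2 u x \<partial>OM\<bar>) \<longlonglongrightarrow> \<bar>\<integral>x. weak_pd 1 v x * weak_pd 2 u x \<partial>OM\<bar>"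
    by (intro tendsto_rabs l2n_tendsto_integral_right[OF ps vs D(4) us])
  moreover have "(\<lambda>k. w * (1 / 2 * l2n OM (pd 1 (F k)) + 16 * l2n OM (pd 2 (F k))) + 9 * (g * l2n OM (pd 2 (F k))))
      \<longlonglongrightarrow> w * (1 / 2 * p + 16 * q) + 9 * (g * q)"
    unfolding p_def q_def
    by (intro tendsto_add tendsto_mult tendsto_const l2n_tendsto_norm[OF ps vs D(4)])
  ultimately have a: "\<bar>\<integral>x. weak_pd 1 v x * weak_pd 2 u x \<partial>OM\<bar> \<le> w * (1 / 2 * p + 16 * q) + 9 * (g * q)"
    by (rule LIMSEQ_le) (use korn_smooth[OF u D(2) F(2)] in \<open>auto simp: w_def g_def\<close>)
  have ss: "(\<lambda>x. weak_pd 2 u x + weak_pd 1 v x) \<in> sq_int OM" using us vs by auto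
  have "(\<integral>x. (weak_pd 2 u x + weak_pd 1 v x) * weak_pd 2 u x \<partial>OM) = w\<^sup>2 + (\<integral>x. weak_pd 1 v x * weak_pd 2 u x \<partial>OM)"
    unfolding w_def l2n_sq distrib_right unfolding power2_eq_square
    by (intro Bochner_Integration.integral_add sq_int_mult_integrable us vs)
  moreover have "\<bar>\<integral>x. (weak_pd 2 u x + weak_pd 1 v x) * weak_pd 2 u x \<partial>OM\<bar> \<le> s * w"
    unfolding s_def w_def by (rule l2n_Cauchy_Schwarz[OF ss us])
  ultimately have b: "w\<^sup>2 \<le> s * w + (w * (1 / 2 * p + 16 * q) + 9 * (g * q))" using a by linarith
  have "p \<le> s + w"
    using l2n_triangle_diff[OF ss us[of 2]] by (simp add: s_def w_def p_def)
  then have "w * (1 / 2 * p + 16 * q) \<le> w * (1 / 2 * (s + w) + 16 * q)"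
    using pos by (intro mult_left_mono) auto
  with b have "w\<^sup>2 \<le> 3 * (w * s) + 32 * (w * q) + 18 * (g * q)"
    by (simp add: algebra_simps power2_eq_square)
  moreover define T where "T = g + q + s"
  moreover have "w * s \<ge> 0" "w * g \<ge> 0" "g * q \<le> T * T"
    using pos by (auto simp: T_def intro!: mult_mono)
  ultimately have c: "w\<^sup>2 \<le> 32 * (w * T) + 18 * (T * T)" by (simp add: algebra_simps)
  have T: "T \<ge> 0" using pos by (simp add: T_def)
  \<comment> \<open>any solution of \<open>t\<^sup>2 \<le> 32 t + 18\<close> is below 33\<close>
  have "w \<le> 33 * T"
  proof (rule ccontr)
    assume "\<not> w \<le> 33 * T"
    then have n: "33 * T < w" by simp
    then have "33 * T * T \<le> w * T" using T by (intro mult_right_mono) auto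
    moreover have "33 * T * w < w * w" using n T by (intro mult_strict_right_mono) auto
    ultimately have "33 * (T * T) \<le> w * T" "33 * (w * T) < w * w" "0 \<le> T * T"
      by (simp_all add: mult_ac)
    with c show False unfolding power2_eq_square by linarith
  qed
  then show ?thesis by (simp add: T_def w_def g_def q_def s_def)
qed

section \<open>Linear structure of traces\<close>

lemma edge_trace_H1: "has_edge_trace f c g \<Longrightarrow> f \<in> H1"
  by (simp add: has_edge_trace_def)

lemma l2n_lincomb_null:
  assumes F: "\<And>k. F k \<in> sq_int M" "(\<lambda>k. l2n M (F k)) \<longlonglongrightarrow> 0"
    and G: "\<And>k. G k \<in> sq_int M" "(\<lambda>k. l2n M (G k)) \<longlonglongrightarrow> 0"
  shows "(\<lambda>k. l2n M (\<lambda>x. a * F k x + b * G k x)) \<longlonglongrightarrow> 0"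
proof (rule Lim_null_comparison[OF always_eventually[OF allI]])
  have "(\<lambda>k. \<bar>a\<bar> * l2n M (F k) + \<bar>b\<bar> * l2n M (G k)) \<longlonglongrightarrow> \<bar>a\<bar> * 0 + \<bar>b\<bar> * 0"
    by (intro tendsto_add tendsto_mult_left F G)
  then show "(\<lambda>k. \<bar>a\<bar> * l2n M (F k) + \<bar>b\<bar> * l2n M (G k)) \<longlonglongrightarrow> 0" by simp
  show "norm (l2n M (\<lambda>x. a * F k x + b * G k x)) \<le> \<bar>a\<bar> * l2n M (F k) + \<bar>b\<bar> * l2n M (G k)" for k
    using l2n_triangle[OF sq_int_scale[OF F(1)] sq_int_scale[OF G(1)], of a k b k]
    by (simp add: l2n_scale)
qed

lemma edge_trace_lincomb:
  assumes f: "has_edge_trace f c (\<lambda>_. p)" and g: "has_edge_trace g c (\<lambda>_. q)"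
  shows "has_edge_trace (\<lambda>x. a * f x + b * g x) c (\<lambda>_. a * p + b * q)"
proof -
  obtain \<phi> where \<phi>: "smooth_approx \<phi> f" "(\<lambda>k. l2n EM (\<lambda>s. \<phi> k (pt s c) - p)) \<longlonglongrightarrow> 0"
    using f unfolding edge_trace_iff by blast
  obtain \<psi> where \<psi>: "smooth_approx \<psi> g" "(\<lambda>k. l2n EM (\<lambda>s. \<psi> k (pt s c) - q)) \<longlonglongrightarrow> 0"
    using g unfolding edge_trace_iff by blast
  note F = smooth_approxD[OF \<phi>(1)] and G = smooth_approxD[OF \<psi>(1)]
  define h where "h k x = a * \<phi> k x + b * \<psi> k x" for k x
  have hs: "smooth (h k)" for k unfolding h_def by (intro smooth_add smooth_mult smooth_const F G)
  have fg: "(\<lambda>x. a * f x + b * g x) \<in> H1" by (rule H1_lincomb[OF F(1) G(1)])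
  have s: "\<phi> k \<in> sq_int OM" "\<psi> k \<in> sq_int OM" "pd i (\<phi> k) \<in> sq_int OM" "pd i (\<psi> k) \<in> sq_int OM"
    "f \<in> sq_int OM" "g \<in> sq_int OM" "weak_pd i f \<in> sq_int OM" "weak_pd i g \<in> sq_int OM" for k i
    by (intro smooth_sq_int smooth_pd F G H1_sq_int weak_pd_sq_int)+
  have pdh: "pd i (h k) x = a * pd i (\<phi> k) x + b * pd i (\<psi> k) x" for i k x
  proof -
    have "pd i (h k) x = pd i (\<lambda>x. a * \<phi> k x) x + pd i (\<lambda>x. b * \<psi> k x) x"
      unfolding h_def by (intro pd_add smooth_differentiable smooth_mult smooth_const F G)
    moreover have "pd i (\<lambda>x. a * \<phi> k x) x = pd i (\<lambda>x. a) x * \<phi> k x + a * pd i (\<phi> k) x"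
      by (intro pd_mult smooth_differentiable smooth_const F)
    moreover have "pd i (\<lambda>x. b * \<psi> k x) x = pd i (\<lambda>x. b) x * \<psi> k x + b * pd i (\<psi> k) x"
      by (intro pd_mult smooth_differentiable smooth_const G)
    ultimately show ?thesis by simp
  qed
  have "smooth_approx h (\<lambda>x. a * f x + b * g x)"
    unfolding smooth_approx_def
  proof (intro conjI allI fg hs)
    have "(\<lambda>k. l2n OM (\<lambda>x. a * (\<phi> k x - f x) + b * (\<psi> k x - g x))) \<longlonglongrightarrow> 0"
      by (intro l2n_lincomb_null sq_int_diff s F G)
    then show "(\<lambda>k. l2n OM (\<lambda>x. h k x - (a * f x + b * g x))) \<longlonglongrightarrow> 0"
      by (simp add: h_def algebra_simps)
    fix i
    have lim: "(\<lambda>k. l2n OM (\<lambda>x. a * (pd i (\<phi> k) x - weak_pd i f x) + b * (pd i (\<psi> k) x - weak_pd i g x))) \<longlonglongrightarrow> 0"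
      by (intro l2n_lincomb_null sq_int_diff s F G)
    have "l2n OM (\<lambda>x. pd i (h k) x - weak_pd i (\<lambda>x. a * f x + b * g x) x) =
        l2n OM (\<lambda>x. a * (pd i (\<phi> k) x - weak_pd i f x) + b * (pd i (\<psi> k) x - weak_pd i g x))" for k
    proof (rule l2n_cong_AE)
      show "AE x in OM. pd i (h k) x - weak_pd i (\<lambda>x. a * f x + b * g x) x =
          a * (pd i (\<phi> k) x - weak_pd i f x) + b * (pd i (\<psi> k) x - weak_pd i g x)"
        using weak_pd_lincomb[OF F(1) G(1), of i a b]
        by eventually_elim (simp add: pdh algebra_simps)
    qed (intro sq_int_measurable sq_int_diff sq_int_add sq_int_scale s smooth_sq_int smooth_pd hs weak_pd_sq_int fg)+
    with lim show "(\<lambda>k. l2n OM (\<lambda>x. pd i (h k) x - weak_pd i (\<lambda>x. a * f x + b * g x) x)) \<longlonglongrightarrow> 0"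
      by simp
  qed
  moreover have "(\<lambda>k. l2n EM (\<lambda>s. a * (\<phi> k (pt s c) - p) + b * (\<psi> k (pt s c) - q))) \<longlonglongrightarrow> 0"
    by (intro l2n_lincomb_null sq_int_diff edge_sq_int edge_const_sq_int F G \<phi> \<psi>)
  then have "(\<lambda>k. l2n EM (\<lambda>s. h k (pt s c) - (a * p + b * q))) \<longlonglongrightarrow> 0"
    by (simp add: h_def algebra_simps)
  ultimately show ?thesis unfolding edge_trace_iff by blast
qed

lemma smooth_edge_trace:
  assumes f: "smooth f" and p: "\<And>s. f (pt s c) = p"
  shows "has_edge_trace f c (\<lambda>_. p)"
proof -
  have "l2n OM (\<lambda>x. pd i f x - weak_pd i f x) = l2n OM (\<lambda>x. 0)" for i
  proof (rule l2n_cong_AE)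
    show "AE x in OM. pd i f x - weak_pd i f x = 0"
      using weak_pd_smooth[OF f, of i] by eventually_elim simp
  qed (intro sq_int_measurable sq_int_diff sq_int_zero smooth_sq_int smooth_pd f weak_pd_sq_int smooth_H1)+
  then have "smooth_approx (\<lambda>k. f) f"
    by (simp add: smooth_approx_def smooth_H1 f l2n_def)
  then show ?thesis unfolding edge_trace_iff by (rule exI[of _ "\<lambda>k. f", OF conjI]) (simp add: p l2n_def)
qed

text \<open>A trace is itself defined by approximation, so a diagonal choice of smooth functions suffices.\<close>

lemma edge_trace_closed:
  assumes F: "\<And>k. has_edge_trace (F k) c (\<lambda>_. p)" and f: "f \<in> H1"
    and lim: "(\<lambda>k. l2n OM (\<lambda>x. F k x - f x)) \<longlonglongrightarrow> 0"
    and limd: "\<And>i. (\<lambda>k. l2n OM (\<lambda>x. weak_pd i (F k) x - weak_pd i f x)) \<longlonglongrightarrow> 0"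
  shows "has_edge_trace f c (\<lambda>_. p)"
proof -
  let ?r = "\<lambda>k. inverse (real (Suc k))"
  have "\<forall>k. \<exists>\<psi>. smooth \<psi> \<and> l2n OM (\<lambda>x. \<psi> x - F k x) < ?r k \<and>
      (\<forall>i. l2n OM (\<lambda>x. pd i \<psi> x - weak_pd i (F k) x) < ?r k) \<and> l2n EM (\<lambda>s. \<psi> (pt s c) - p) < ?r k"
  proof
    fix k
    obtain \<phi> where \<phi>: "smooth_approx \<phi> (F k)" "(\<lambda>k. l2n EM (\<lambda>s. \<phi> k (pt s c) - p)) \<longlonglongrightarrow> 0"
      using F[of k] unfolding edge_trace_iff by blast
    note D = smooth_approxD[OF \<phi>(1)]
    have r: "0 < ?r k" by simp
    have "\<forall>\<^sub>F n in sequentially. l2n OM (\<lambda>x. \<phi> n x - F k x) < ?r k"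
      "\<forall>\<^sub>F n in sequentially. l2n OM (\<lambda>x. pd 1 (\<phi> n) x - weak_pd 1 (F k) x) < ?r k"
      "\<forall>\<^sub>F n in sequentially. l2n OM (\<lambda>x. pd 2 (\<phi> n) x - weak_pd 2 (F k) x) < ?r k"
      "\<forall>\<^sub>F n in sequentially. l2n EM (\<lambda>s. \<phi> n (pt s c) - p) < ?r k"
      by (rule order_tendstoD(2)[OF D(3) r] order_tendstoD(2)[OF D(4) r] order_tendstoD(2)[OF \<phi>(2) r])+
    then have "\<forall>\<^sub>F n in sequentially. l2n OM (\<lambda>x. \<phi> n x - F k x) < ?r k \<and>
      (\<forall>i. l2n OM (\<lambda>x. pd i (\<phi> n) x - weak_pd i (F k) x) < ?r k) \<and> l2n EM (\<lambda>s. \<phi> n (pt s c) - p) < ?r k"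
      unfolding forall_2 by eventually_elim blast
    then show "\<exists>\<psi>. smooth \<psi> \<and> l2n OM (\<lambda>x. \<psi> x - F k x) < ?r k \<and>
      (\<forall>i. l2n OM (\<lambda>x. pd i \<psi> x - weak_pd i (F k) x) < ?r k) \<and> l2n EM (\<lambda>s. \<psi> (pt s c) - p) < ?r k"
      using D(2) by (auto simp: eventually_sequentially)
  qed
  from choice[OF this] obtain \<psi> where \<psi>: "\<And>k. smooth (\<psi> k)" "\<And>k. l2n OM (\<lambda>x. \<psi> k x - F k x) < ?r k"
    "\<And>k i. l2n OM (\<lambda>x. pd i (\<psi> k) x - weak_pd i (F k) x) < ?r k"
    "\<And>k. l2n EM (\<lambda>s. \<psi> k (pt s c) - p) < ?r k" by blast
  have FH: "F k \<in> H1" for k by (rule edge_trace_H1[OF F])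
  have "smooth_approx \<psi> f"
    unfolding smooth_approx_def
  proof (intro conjI allI f \<psi>)
    have l: "(\<lambda>k. ?r k + l2n OM (\<lambda>x. F k x - f x)) \<longlonglongrightarrow> 0"
      using tendsto_add[OF LIMSEQ_inverse_real_of_nat lim] by simp
    show "(\<lambda>k. l2n OM (\<lambda>x. \<psi> k x - f x)) \<longlonglongrightarrow> 0"
    proof (rule Lim_null_comparison[OF always_eventually[OF allI] l])
      show "norm (l2n OM (\<lambda>x. \<psi> k x - f x)) \<le> ?r k + l2n OM (\<lambda>x. F k x - f x)" for k
        using l2n_triangle3[OF smooth_sq_int[OF \<psi>(1)[of k]] H1_sq_int[OF FH[of k]] H1_sq_int[OF f]] \<psi>(2)[of k]
        unfolding real_norm_def abs_of_nonneg[OF l2n_nonneg] by linarith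
    qed
    fix i
    have l: "(\<lambda>k. ?r k + l2n OM (\<lambda>x. weak_pd i (F k) x - weak_pd i f x)) \<longlonglongrightarrow> 0"
      using tendsto_add[OF LIMSEQ_inverse_real_of_nat limd] by simp
    show "(\<lambda>k. l2n OM (\<lambda>x. pd i (\<psi> k) x - weak_pd i f x)) \<longlonglongrightarrow> 0"
    proof (rule Lim_null_comparison[OF always_eventually[OF allI] l])
      show "norm (l2n OM (\<lambda>x. pd i (\<psi> k) x - weak_pd i f x)) \<le> ?r k + l2n OM (\<lambda>x. weak_pd i (F k) x - weak_pd i f x)" for k
        using l2n_triangle3[OF smooth_sq_int[OF smooth_pd[OF \<psi>(1)[of k]]] weak_pd_sq_int[OF FH[of k]] weak_pd_sq_int[OF f], of i i i] \<psi>(3)[of i k]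
        unfolding real_norm_def abs_of_nonneg[OF l2n_nonneg] by linarith
    qed
  qed
  moreover have "(\<lambda>k. l2n EM (\<lambda>s. \<psi> k (pt s c) - p)) \<longlonglongrightarrow> 0"
    by (rule Lim_null_comparison[OF always_eventually[OF allI] LIMSEQ_inverse_real_of_nat])
       (use \<psi>(4) in \<open>simp add: less_imp_le\<close>)
  ultimately show ?thesis unfolding edge_trace_iff by blast
qed

section \<open>The elastic energy\<close>

text \<open>The entries of the weak gradient of a vector field.\<close>

definition jac :: "2 \<Rightarrow> 2 \<Rightarrow> (plane \<Rightarrow> plane) \<Rightarrow> plane \<Rightarrow> real"
  where "jac i j u = weak_pd j (\<lambda>y. u y $ i)"

definition H1vec :: "(plane \<Rightarrow> plane) set"
  where "H1vec = {u. \<forall>i. (\<lambda>x. u x $ i) \<in> H1}"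

text \<open>The integrand of the tensile test, written out in the entries of the gradient so that each
summand is a product of two square integrable functions.\<close>

definition dens :: "(plane \<Rightarrow> real) \<Rightarrow> real \<Rightarrow> (plane \<Rightarrow> plane) \<Rightarrow> (plane \<Rightarrow> plane) \<Rightarrow> plane \<Rightarrow> real"
  where "dens lam mu u v x =
    (lam x * (jac 1 1 u x + jac 2 2 u x)) * (jac 1 1 v x + jac 2 2 v x)
    + 2 * mu * (jac 1 1 u x * jac 1 1 v x) + 2 * mu * (jac 2 2 u x * jac 2 2 v x)
    + mu * ((jac 1 2 u x + jac 2 1 u x) * (jac 1 2 v x + jac 2 1 v x))"

definition form :: "(plane \<Rightarrow> real) \<Rightarrow> real \<Rightarrow> (plane \<Rightarrow> plane) \<Rightarrow> (plane \<Rightarrow> plane) \<Rightarrow> real"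
  where "form lam mu u v = (\<integral>x. dens lam mu u v x \<partial>OM)"

lemma trace_sym_grad: "trace (sym_grad u x) = jac 1 1 u x + jac 2 2 u x"
  by (simp add: trace_def sum_2 sym_grad_def weak_grad_def transpose_def jac_def)

lemma frobenius_sym_grad:
  "frobenius (sym_grad u x) (sym_grad v x) = jac 1 1 u x * jac 1 1 v x + jac 2 2 u x * jac 2 2 v x
    + 1 / 2 * ((jac 1 2 u x + jac 2 1 u x) * (jac 1 2 v x + jac 2 1 v x))"
  by (simp add: frobenius_def matrix_matrix_mult_def trace_def sum_2 sym_grad_def weak_grad_def
      transpose_def jac_def algebra_simps)

lemma tensile_solution_iff:
  "tensile_solution lam (\<lambda>_. mu) l u \<longleftrightarrow> u \<in> W l \<and> (\<forall>v\<in>W 0. form lam mu u v = 0)"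
proof -
  have "(LINT x:Omega|lborel. lam x * trace (sym_grad u x) * trace (sym_grad v x)
        + 2 * mu * frobenius (sym_grad u x) (sym_grad v x)) = form lam mu u v" for v
    unfolding LINT_Omega form_def dens_def trace_sym_grad frobenius_sym_grad
    by (intro Bochner_Integration.integral_cong) (auto simp: algebra_simps)
  then show ?thesis by (simp add: tensile_solution_def)
qed

lemma W_iff:
  "u \<in> W l \<longleftrightarrow> u \<in> H1vec \<and> (\<integral>x. u x $ 1 \<partial>OM) = 0 \<and>
    has_edge_trace (\<lambda>x. u x $ 2) 1 (\<lambda>_. l) \<and> has_edge_trace (\<lambda>x. u x $ 2) 0 (\<lambda>_. 0)"
  by (simp add: W_def H1vec_def LINT_Omega)

lemma W_H1vec: "u \<in> W l \<Longrightarrow> u \<in> H1vec"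
  by (simp add: W_iff)

lemma H1vec_comp: "u \<in> H1vec \<Longrightarrow> (\<lambda>x. u x $ i) \<in> H1"
  by (simp add: H1vec_def)

lemma jac_sq_int: "u \<in> H1vec \<Longrightarrow> jac i j u \<in> sq_int OM"
  unfolding jac_def by (intro weak_pd_sq_int H1vec_comp)

lemma H1vec_lincomb:
  assumes "u \<in> H1vec" "v \<in> H1vec"
  shows "(\<lambda>x. a *\<^sub>R u x + b *\<^sub>R v x) \<in> H1vec"
  using H1_lincomb[OF H1vec_comp[OF assms(1)] H1vec_comp[OF assms(2)]] by (simp add: H1vec_def)

lemma jac_lincomb:
  assumes "u \<in> H1vec" "v \<in> H1vec"
  shows "AE x in OM. jac i j (\<lambda>x. a *\<^sub>R u x + b *\<^sub>R v x) x = a * jac i j u x + b * jac i j v x"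
  using weak_pd_lincomb[OF H1vec_comp[OF assms(1)] H1vec_comp[OF assms(2)], of j a i b i]
  by (simp add: jac_def)

lemma W_lincomb:
  assumes u: "u \<in> W l" and v: "v \<in> W m"
  shows "(\<lambda>x. a *\<^sub>R u x + b *\<^sub>R v x) \<in> W (a * l + b * m)"
proof -
  have U: "u \<in> H1vec" "v \<in> H1vec" using u v by (simp_all add: W_iff)
  have i: "integrable OM (\<lambda>x. u x $ 1)" "integrable OM (\<lambda>x. v x $ 1)"
    by (intro OM.sq_int_integrable1 H1_sq_int H1vec_comp U)+
  have "(\<integral>x. a * u x $ 1 + b * v x $ 1 \<partial>OM) = 0"
    using u v i by (simp add: W_iff)
  then show ?thesis
    using H1vec_lincomb[OF U] u v edge_trace_lincomb[of "\<lambda>x. u x $ 2" 1 l "\<lambda>x. v x $ 2" m a b]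
      edge_trace_lincomb[of "\<lambda>x. u x $ 2" 0 0 "\<lambda>x. v x $ 2" 0 a b]
    by (simp add: W_iff)
qed

lemma W_diff: "u \<in> W l \<Longrightarrow> v \<in> W l \<Longrightarrow> (\<lambda>x. 1 *\<^sub>R u x + (-1) *\<^sub>R v x) \<in> W 0"
  using W_lincomb[of u l v l 1 "-1"] by simp

locale material =
  fixes lam :: "plane \<Rightarrow> real" and mu B :: real
  assumes lam_measurable [measurable]: "lam \<in> borel_measurable OM"
    and lam_nonneg: "\<And>x. x \<in> Omega \<Longrightarrow> 0 \<le> lam x"
    and lam_bounded: "\<And>x. x \<in> Omega \<Longrightarrow> lam x \<le> B"
    and mu_pos: "mu > 0"
begin

lemma lam_times:
  assumes f: "f \<in> sq_int OM"
  shows "(\<lambda>x. lam x * f x) \<in> sq_int OM" "l2n OM (\<lambda>x. lam x * f x) \<le> \<bar>B\<bar> * l2n OM f"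
proof -
  have m: "(\<lambda>x. lam x * f x) \<in> borel_measurable OM"
    using sq_int_measurable[OF f] by (intro borel_measurable_times lam_measurable)
  have "\<bar>lam x * f x\<bar> \<le> \<bar>B * f x\<bar>" if "x \<in> space OM" for x
    using lam_nonneg[of x] lam_bounded[of x] that by (auto simp: abs_mult intro!: mult_right_mono)
  from l2n_mono[OF sq_int_scale[OF f] m this]
  show "(\<lambda>x. lam x * f x) \<in> sq_int OM" "l2n OM (\<lambda>x. lam x * f x) \<le> \<bar>B\<bar> * l2n OM f"
    by (auto simp: l2n_scale)
qed

lemma form_integrable:
  assumes "u \<in> H1vec" "v \<in> H1vec"
  shows "integrable OM (\<lambda>x. (lam x * (jac 1 1 u x + jac 2 2 u x)) * (jac 1 1 v x + jac 2 2 v x))"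
    "integrable OM (\<lambda>x. jac i j u x * jac i j v x)"
    "integrable OM (\<lambda>x. (jac 1 2 u x + jac 2 1 u x) * (jac 1 2 v x + jac 2 1 v x))"
  by (intro sq_int_mult_integrable lam_times sq_int_add jac_sq_int assms)+

lemma form_eq:
  assumes "u \<in> H1vec" "v \<in> H1vec"
  shows "form lam mu u v =
    (\<integral>x. (lam x * (jac 1 1 u x + jac 2 2 u x)) * (jac 1 1 v x + jac 2 2 v x) \<partial>OM)
    + 2 * mu * (\<integral>x. jac 1 1 u x * jac 1 1 v x \<partial>OM) + 2 * mu * (\<integral>x. jac 2 2 u x * jac 2 2 v x \<partial>OM)
    + mu * (\<integral>x. (jac 1 2 u x + jac 2 1 u x) * (jac 1 2 v x + jac 2 1 v x) \<partial>OM)"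
  unfolding form_def dens_def using form_integrable[OF assms] by simp

lemma dens_integrable:
  assumes "u \<in> H1vec" "v \<in> H1vec"
  shows "integrable OM (dens lam mu u v)"
  unfolding dens_def using form_integrable[OF assms] by auto

lemma form_commute: "form lam mu u v = form lam mu v u"
  unfolding form_def dens_def by (simp add: mult_ac)

lemma form_lincomb_left:
  assumes u: "u \<in> H1vec" "u' \<in> H1vec" "v \<in> H1vec"
  shows "form lam mu (\<lambda>x. a *\<^sub>R u x + b *\<^sub>R u' x) v = a * form lam mu u v + b * form lam mu u' v"
proof -
  let ?w = "\<lambda>x. a *\<^sub>R u x + b *\<^sub>R u' x"
  have w: "?w \<in> H1vec" by (rule H1vec_lincomb[OF u(1,2)])
  have "form lam mu ?w v = (\<integral>x. a * dens lam mu u v x + b * dens lam mu u' v x \<partial>OM)"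
    unfolding form_def
  proof (rule integral_cong_AE)
    show "AE x in OM. dens lam mu ?w v x = a * dens lam mu u v x + b * dens lam mu u' v x"
      using jac_lincomb[OF u(1,2), of 1 1 a b] jac_lincomb[OF u(1,2), of 1 2 a b]
        jac_lincomb[OF u(1,2), of 2 1 a b] jac_lincomb[OF u(1,2), of 2 2 a b]
      by eventually_elim (simp add: dens_def algebra_simps)
  qed (use dens_integrable[OF w u(3)] dens_integrable[OF u(1,3)] dens_integrable[OF u(2,3)] in auto)
  also have "\<dots> = a * form lam mu u v + b * form lam mu u' v"
    unfolding form_def using dens_integrable[OF u(1,3)] dens_integrable[OF u(2,3)] by simp
  finally show ?thesis .
qed

lemma form_lincomb:
  assumes u: "u \<in> H1vec" "v \<in> H1vec"
  shows "form lam mu (\<lambda>x. a *\<^sub>R u x + b *\<^sub>R v x) (\<lambda>x. a *\<^sub>R u x + b *\<^sub>R v x) =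
    a\<^sup>2 * form lam mu u u + 2 * a * b * form lam mu u v + b\<^sup>2 * form lam mu v v"
proof -
  let ?w = "\<lambda>x. a *\<^sub>R u x + b *\<^sub>R v x"
  have w: "?w \<in> H1vec" by (rule H1vec_lincomb[OF u])
  have "form lam mu ?w ?w = a * form lam mu ?w u + b * form lam mu ?w v"
    by (simp only: form_lincomb_left[OF u w] form_commute[of _ ?w])
  also have "\<dots> = a * (a * form lam mu u u + b * form lam mu v u) + b * (a * form lam mu u v + b * form lam mu v v)"
    by (simp only: form_lincomb_left[OF u u(1)] form_lincomb_left[OF u u(2)])
  finally show ?thesis
    by (simp add: form_commute[of v u] power2_eq_square algebra_simps)
qed

lemma form_lower:
  assumes u: "u \<in> H1vec"
  shows "2 * mu * (l2n OM (jac 1 1 u))\<^sup>2 + 2 * mu * (l2n OM (jac 2 2 u))\<^sup>2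
    + mu * (l2n OM (\<lambda>x. jac 1 2 u x + jac 2 1 u x))\<^sup>2 \<le> form lam mu u u"
proof -
  have "0 \<le> (\<integral>x. (lam x * (jac 1 1 u x + jac 2 2 u x)) * (jac 1 1 u x + jac 2 2 u x) \<partial>OM)"
    by (rule integral_nonneg_AE, rule AE_I2) (simp add: lam_nonneg mult.assoc)
  then show ?thesis
    unfolding form_eq[OF u u] l2n_sq unfolding power2_eq_square by simp
qed

lemma form_nonneg:
  assumes u: "u \<in> H1vec"
  shows "0 \<le> form lam mu u u"
proof -
  have "0 \<le> 2 * mu * (l2n OM (jac 1 1 u))\<^sup>2 + 2 * mu * (l2n OM (jac 2 2 u))\<^sup>2
    + mu * (l2n OM (\<lambda>x. jac 1 2 u x + jac 2 1 u x))\<^sup>2"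
    using mu_pos by simp
  with form_lower[OF u] show ?thesis by linarith
qed

text \<open>Korn's inequality bounds the gradient by the strains, which the energy controls, and the
inequalities of Poincare bound the components by the gradient.\<close>

lemma coercive:
  assumes v: "v \<in> W 0"
  shows "l2n OM (\<lambda>x. v x $ i) \<le> 200 * sqrt (form lam mu v v / mu)"
    "l2n OM (jac i j v) \<le> 200 * sqrt (form lam mu v v / mu)"
proof -
  have V: "v \<in> H1vec" and mean: "(\<integral>x. v x $ 1 \<partial>OM) = 0"
    and tr: "has_edge_trace (\<lambda>x. v x $ 2) 1 (\<lambda>_. 0)" "has_edge_trace (\<lambda>x. v x $ 2) 0 (\<lambda>_. 0)"
    using v by (auto simp: W_iff)
  define R where "R = sqrt (form lam mu v v / mu)"
  define a b s where "a = l2n OM (jac 1 1 v)" and "b = l2n OM (jac 2 2 v)"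
    and "s = l2n OM (\<lambda>x. jac 1 2 v x + jac 2 1 v x)"
  have "mu * (2 * a\<^sup>2 + 2 * b\<^sup>2 + s\<^sup>2) \<le> form lam mu v v"
    using form_lower[OF V] by (simp add: a_def b_def s_def algebra_simps)
  then have le: "2 * a\<^sup>2 + 2 * b\<^sup>2 + s\<^sup>2 \<le> form lam mu v v / mu"
    using mu_pos by (simp add: field_simps)
  have R: "t \<le> R" if "t\<^sup>2 \<le> 2 * a\<^sup>2 + 2 * b\<^sup>2 + s\<^sup>2" for t
    unfolding R_def by (rule real_le_rsqrt) (use le that in linarith)
  have aR: "a \<le> R" "b \<le> R" "s \<le> R" by (rule R; simp)+
  \<comment> \<open>the three strains are at most \<open>R\<close> each, which gives \<open>99 R\<close> and \<open>100 R\<close> for the remaining entries and \<open>200 R\<close> for the first component\<close>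
  have k: "l2n OM (jac 1 2 v) \<le> 33 * (a + b + s)"
    using korn[OF H1vec_comp[OF V, of 1] tr] by (simp add: a_def b_def s_def jac_def)
  have "l2n OM (jac 2 1 v) \<le> s + l2n OM (jac 1 2 v)"
    using l2n_triangle_diff[of "\<lambda>x. jac 1 2 v x + jac 2 1 v x" OM "jac 1 2 v"] jac_sq_int[OF V]
    by (auto simp: s_def)
  moreover have "a + b + s \<le> R + R + R" by (intro add_mono aR)
  then have "33 * (a + b + s) \<le> 99 * R" by simp
  with k have "l2n OM (jac 1 2 v) \<le> 99 * R" by (rule order_trans)
  ultimately have J: "l2n OM (jac 1 2 v) \<le> 99 * R" "l2n OM (jac 2 1 v) \<le> 100 * R"
    using aR(3) by simp_all
  have R0: "0 \<le> R" using aR(1) l2n_nonneg[of OM "jac 1 1 v"] unfolding a_def by linarith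
  have "l2n OM (\<lambda>x. v x $ 1) \<le> 2 * (a + l2n OM (jac 1 2 v))"
    using poincare_mean_zero[OF H1vec_comp[OF V, of 1] mean] by (simp add: a_def jac_def)
  also have "\<dots> \<le> 2 * (R + 99 * R)" by (intro mult_left_mono add_mono aR J) simp
  finally have 1: "l2n OM (\<lambda>x. v x $ 1) \<le> 200 * R" by simp
  have "l2n OM (\<lambda>x. v x $ 2) \<le> 2 * b"
    using poincare_zero_trace(1)[OF tr] by (simp add: b_def jac_def)
  then have 2: "l2n OM (\<lambda>x. v x $ 2) \<le> 200 * R" using aR(2) R0 by simp
  have "i = 1 \<or> i = 2" "j = 1 \<or> j = 2" by (rule exhaust_2)+
  then show "l2n OM (\<lambda>x. v x $ i) \<le> 200 * R" "l2n OM (jac i j v) \<le> 200 * R"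
    unfolding R_def[symmetric] using 1 2 J aR R0 unfolding a_def b_def by (elim disjE; simp)+
qed

lemma form_tendsto:
  assumes U: "\<And>k. U k \<in> H1vec" and u: "u \<in> H1vec"
    and lim: "\<And>i j. (\<lambda>k. l2n OM (\<lambda>x. jac i j (U k) x - jac i j u x)) \<longlonglongrightarrow> 0"
  shows "(\<lambda>k. form lam mu (U k) (U k)) \<longlonglongrightarrow> form lam mu u u"
proof -
  have sumlim: "(\<lambda>k. l2n OM (\<lambda>x. (jac i j (U k) x + jac m n (U k) x) - (jac i j u x + jac m n u x))) \<longlonglongrightarrow> 0" for i j m n
  proof -
    have "(\<lambda>k. l2n OM (\<lambda>x. 1 * (jac i j (U k) x - jac i j u x) + 1 * (jac m n (U k) x - jac m n u x))) \<longlonglongrightarrow> 0"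
      by (intro l2n_lincomb_null sq_int_diff jac_sq_int U u lim)
    then show ?thesis by (simp add: algebra_simps)
  qed
  have lamlim: "(\<lambda>k. l2n OM (\<lambda>x. lam x * (jac 1 1 (U k) x + jac 2 2 (U k) x) - lam x * (jac 1 1 u x + jac 2 2 u x))) \<longlonglongrightarrow> 0"
  proof (rule Lim_null_comparison[OF always_eventually[OF allI]])
    show "(\<lambda>k. \<bar>B\<bar> * l2n OM (\<lambda>x. (jac 1 1 (U k) x + jac 2 2 (U k) x) - (jac 1 1 u x + jac 2 2 u x))) \<longlonglongrightarrow> 0"
      using tendsto_mult_left[OF sumlim, of "\<bar>B\<bar>"] by simp
    show "norm (l2n OM (\<lambda>x. lam x * (jac 1 1 (U k) x + jac 2 2 (U k) x) - lam x * (jac 1 1 u x + jac 2 2 u x)))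
        \<le> \<bar>B\<bar> * l2n OM (\<lambda>x. (jac 1 1 (U k) x + jac 2 2 (U k) x) - (jac 1 1 u x + jac 2 2 u x))" for k
      using lam_times(2)[of "\<lambda>x. (jac 1 1 (U k) x + jac 2 2 (U k) x) - (jac 1 1 u x + jac 2 2 u x)"]
        sq_int_diff[OF sq_int_add[OF jac_sq_int[OF U] jac_sq_int[OF U]] sq_int_add[OF jac_sq_int[OF u] jac_sq_int[OF u]]]
      by (simp add: right_diff_distrib)
  qed
  show ?thesis
    unfolding form_eq[OF U U] form_eq[OF u u]
    by (intro tendsto_add tendsto_mult_left l2n_tendsto_integral lamlim sumlim lim
        lam_times sq_int_add jac_sq_int U u)
qed

end

section \<open>Existence of the solution\<close>

text \<open>The fields in \<^const>\<open>W\<close> with constant diagonal gradient. They are admissible competitors, they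
represent the force as a value of the bilinear form, and they solve the test for a constant
coefficient. The shift by \<open>1/2\<close> makes the mean of the first component zero.\<close>

definition affine_field :: "real \<Rightarrow> real \<Rightarrow> plane \<Rightarrow> plane"
  where "affine_field a l x = pt (a * (x $ 1 - 1 / 2)) (l * x $ 2)"

lemma affine_field_nth [simp]:
  "affine_field a l x $ 1 = a * (x $ 1 - 1 / 2)" "affine_field a l x $ 2 = l * x $ 2"
  by (simp_all add: affine_field_def)

lemma smooth_affine_field: "smooth (\<lambda>x. affine_field a l x $ i)"
proof -
  have "i = 1 \<or> i = 2" by (rule exhaust_2)
  then show ?thesis
    by (elim disjE) (simp_all, (intro smooth_mult smooth_diff smooth_const smooth_nth)+)
qed

lemma jac_affine_field:
  "AE x in OM. jac i j (affine_field a l) x = (if i = j then if i = 1 then a else l else 0)"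
proof -
  have d1: "((\<lambda>t. a * (t - 1 / 2)) has_real_derivative a) (at t)" for t
    by (auto intro!: derivative_eq_intros)
  have d2: "((\<lambda>t. l * t) has_real_derivative l) (at t)" for t
    by (auto intro!: derivative_eq_intros)
  have "i = 1 \<or> i = 2" by (rule exhaust_2)
  then have "pd j (\<lambda>x. affine_field a l x $ i) x = (if i = j then if i = 1 then a else l else 0)" for x
    by (elim disjE) (simp_all add: pd_coord[OF d1] pd_coord[OF d2])
  then show ?thesis
    unfolding jac_def using weak_pd_smooth[OF smooth_affine_field[of a l i], of j] by simp
qed

lemma mean_affine: "(\<integral>x. a * (x $ 1 - 1 / 2) \<partial>OM) = 0"
proof -
  \<comment> \<open>a primitive in the first direction that vanishes on the vertical edges\<close>
  let ?h = "\<lambda>x :: plane. a / 2 * (x $ 1 * (x $ 1 - 1))"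
  have d: "((\<lambda>t. a / 2 * (t * (t - 1))) has_real_derivative a * (t - 1 / 2)) (at t)" for t
    by (auto intro!: derivative_eq_intros simp: field_simps)
  have s: "smooth ?h" by (intro smooth_mult smooth_diff smooth_const smooth_nth)
  have "(\<integral>x. pd 1 ?h x \<partial>OM) = 0" by (rule integral_pd_zero[OF s]) auto
  moreover have "pd 1 ?h x = a * (x $ 1 - 1 / 2)" for x by (subst pd_coord[OF d]) simp
  ultimately show ?thesis by (simp only:)
qed

lemma affine_field_W: "affine_field a l \<in> W l"
  unfolding W_iff H1vec_def
proof (intro conjI CollectI allI)
  show "(\<lambda>x. affine_field a l x $ i) \<in> H1" for i by (rule smooth_H1[OF smooth_affine_field])
  show "(\<integral>x. affine_field a l x $ 1 \<partial>OM) = 0"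
    unfolding affine_field_nth by (rule mean_affine)
  show "has_edge_trace (\<lambda>x. affine_field a l x $ 2) 1 (\<lambda>_. l)"
    "has_edge_trace (\<lambda>x. affine_field a l x $ 2) 0 (\<lambda>_. 0)"
    by (rule smooth_edge_trace[OF smooth_affine_field]; simp)+
qed

context material
begin

lemma minimiser_solves:
  assumes u: "u \<in> W l" and min: "\<And>w. w \<in> W l \<Longrightarrow> form lam mu u u \<le> form lam mu w w"
  shows "tensile_solution lam (\<lambda>_. mu) l u"
  unfolding tensile_solution_iff
proof (intro conjI ballI u)
  fix v assume v: "v \<in> W 0"
  let ?F = "form lam mu u v" and ?V = "form lam mu v v"
  have uv: "u \<in> H1vec" "v \<in> H1vec" using u v by (auto intro: W_H1vec)
  have V: "0 \<le> ?V" by (rule form_nonneg[OF uv(2)])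
  have q: "0 \<le> 2 * t * ?F + t\<^sup>2 * ?V" for t
  proof -
    have "(\<lambda>x. 1 *\<^sub>R u x + t *\<^sub>R v x) \<in> W l" using W_lincomb[OF u v, of 1 t] by simp
    from min[OF this] show ?thesis unfolding form_lincomb[OF uv] by simp
  qed
  define t where "t = - ?F / (?V + 1)"
  have F: "?F = - t * (?V + 1)" using V by (simp add: t_def)
  have "2 * t * ?F + t\<^sup>2 * ?V = - (t\<^sup>2 * (?V + 2))"
    unfolding F by (simp add: power2_eq_square algebra_simps)
  with q[of t] have "t\<^sup>2 * (?V + 2) \<le> 0" by simp
  then have "t\<^sup>2 = 0" using V by (simp add: mult_le_0_iff)
  then show "?F = 0" using F by simp
qed

lemma minimiser_exists:
  obtains u where "u \<in> W l" "\<And>w. w \<in> W l \<Longrightarrow> form lam mu u u \<le> form lam mu w w"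
proof -
  define E where "E = (\<lambda>u. form lam mu u u)"
  define m where "m = Inf (E ` W l)"
  have bdd: "bdd_below (E ` W l)"
    by (rule bdd_belowI[of _ 0]) (auto simp: E_def intro!: form_nonneg W_H1vec)
  have ne: "E ` W l \<noteq> {}" using affine_field_W by blast
  have m: "m \<le> E w" if "w \<in> W l" for w
    unfolding m_def using that bdd by (auto intro: cInf_lower)
  let ?r = "\<lambda>k. inverse (real (Suc k))"
  have "\<exists>u. u \<in> W l \<and> E u < m + ?r k" for k
  proof -
    have "Inf (E ` W l) < m + ?r k" by (simp add: m_def)
    then show ?thesis using cInf_less_iff[OF ne bdd] by blast
  qed
  then have "\<forall>k. \<exists>u. u \<in> W l \<and> E u < m + ?r k" by blast
  from choice[OF this] obtain U where U: "\<And>k. U k \<in> W l" "\<And>k. E (U k) < m + ?r k" by blast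
  have UH: "U k \<in> H1vec" for k by (rule W_H1vec[OF U(1)])
  define d where "d j k x = 1 *\<^sub>R U j x + (-1) *\<^sub>R U k x" for j k x
  have dW: "d j k \<in> W 0" for j k unfolding d_def by (rule W_diff[OF U(1) U(1)])
  \<comment> \<open>the parallelogram identity; the midpoint of two competitors is a competitor\<close>
  have Ed: "form lam mu (d j k) (d j k) \<le> 2 * ?r j + 2 * ?r k" for j k
  proof -
    have half: "(\<lambda>x. (1/2) *\<^sub>R U j x + (1/2) *\<^sub>R U k x) \<in> W l"
      using W_lincomb[OF U(1) U(1), of "1/2" j "1/2" k] by simp
    have "m \<le> 1/4 * E (U j) + 1/2 * form lam mu (U j) (U k) + 1/4 * E (U k)"
      using m[OF half] unfolding E_def form_lincomb[OF UH UH] by (simp add: power2_eq_square)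
    moreover have "form lam mu (d j k) (d j k) = E (U j) - 2 * form lam mu (U j) (U k) + E (U k)"
      unfolding d_def form_lincomb[OF UH UH] E_def by simp
    moreover have "D \<le> 2 * r + 2 * s"
      if "m \<le> 1/4 * a + 1/2 * b + 1/4 * c" "D = a - 2 * b + c" "a < m + r" "c < m + s"
      for a b c D r s :: real using that by linarith
    ultimately show ?thesis using U(2)[of j] U(2)[of k] by blast
  qed
  have small: "\<exists>N. \<forall>j\<ge>N. \<forall>k\<ge>N. 200 * sqrt (form lam mu (d j k) (d j k) / mu) < e" if e: "e > 0" for e
  proof -
    have "0 < (e / 200)\<^sup>2 * mu / 4" using e mu_pos by simp
    then obtain N where N: "?r N < (e / 200)\<^sup>2 * mu / 4" using reals_Archimedean by blast
    show ?thesis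
    proof (intro exI allI impI)
      fix j k assume jk: "j \<ge> N" "k \<ge> N"
      have "?r j \<le> ?r N" "?r k \<le> ?r N" using jk by (auto intro!: le_imp_inverse_le)
      then have "form lam mu (d j k) (d j k) < (e / 200)\<^sup>2 * mu" using Ed[of j k] N by linarith
      then have "form lam mu (d j k) (d j k) / mu < (e / 200)\<^sup>2" using mu_pos by (simp add: field_simps)
      then have "sqrt (form lam mu (d j k) (d j k) / mu) < sqrt ((e / 200)\<^sup>2)" by (rule real_sqrt_less_mono)
      then show "200 * sqrt (form lam mu (d j k) (d j k) / mu) < e" using e by simp
    qed
  qed
  have ci: "\<exists>N. \<forall>j\<ge>N. \<forall>k\<ge>N. l2n OM (\<lambda>x. U j x $ i - U k x $ i) < e" if e: "e > 0" for e i
  proof -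
    have "l2n OM (\<lambda>x. U j x $ i - U k x $ i) \<le> 200 * sqrt (form lam mu (d j k) (d j k) / mu)" for j k
      using coercive(1)[OF dW, of j k i] by (simp add: d_def)
    then show ?thesis using small[OF e] by (meson le_less_trans)
  qed
  have cj: "\<exists>N. \<forall>m\<ge>N. \<forall>n\<ge>N. l2n OM (\<lambda>x. jac i j (U m) x - jac i j (U n) x) < e" if e: "e > 0" for e i j
  proof -
    have "l2n OM (\<lambda>x. jac i j (U m) x - jac i j (U n) x) = l2n OM (jac i j (d m n))" for m n
    proof (rule l2n_cong_AE)
      show "AE x in OM. jac i j (U m) x - jac i j (U n) x = jac i j (d m n) x"
        using jac_lincomb[OF UH UH, of i j 1 m "-1" n]
        unfolding d_def by eventually_elim simp
    qed (intro sq_int_measurable sq_int_diff jac_sq_int UH W_H1vec[OF dW])+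
    then have "l2n OM (\<lambda>x. jac i j (U m) x - jac i j (U n) x) \<le> 200 * sqrt (form lam mu (d m n) (d m n) / mu)" for m n
      using coercive(2)[OF dW, of i j m n] by simp
    then show ?thesis using small[OF e] by (meson le_less_trans)
  qed
  have "\<forall>i. \<exists>f. f \<in> sq_int OM \<and> (\<lambda>k. l2n OM (\<lambda>x. U k x $ i - f x)) \<longlonglongrightarrow> 0"
  proof
    fix i
    show "\<exists>f. f \<in> sq_int OM \<and> (\<lambda>k. l2n OM (\<lambda>x. U k x $ i - f x)) \<longlonglongrightarrow> 0"
      by (rule OM.sq_int_complete[OF H1_sq_int[OF H1vec_comp[OF UH]] ci]) blast+
  qed
  from choice[OF this] obtain f where f: "\<And>i. f i \<in> sq_int OM"
    "\<And>i. (\<lambda>k. l2n OM (\<lambda>x. U k x $ i - f i x)) \<longlonglongrightarrow> 0" by blast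
  have "\<forall>ij. \<exists>g. g \<in> sq_int OM \<and> (\<lambda>k. l2n OM (\<lambda>x. jac (fst ij) (snd ij) (U k) x - g x)) \<longlonglongrightarrow> 0"
  proof
    fix ij :: "2 \<times> 2"
    show "\<exists>g. g \<in> sq_int OM \<and> (\<lambda>k. l2n OM (\<lambda>x. jac (fst ij) (snd ij) (U k) x - g x)) \<longlonglongrightarrow> 0"
      by (rule OM.sq_int_complete[OF jac_sq_int[OF UH] cj]) blast+
  qed
  from choice[OF this] obtain g where
    "\<forall>ij. g ij \<in> sq_int OM \<and> (\<lambda>k. l2n OM (\<lambda>x. jac (fst ij) (snd ij) (U k) x - g ij x)) \<longlonglongrightarrow> 0"
    by blast
  note g' = spec[OF this]
  have g: "g (i, j) \<in> sq_int OM" "(\<lambda>k. l2n OM (\<lambda>x. jac i j (U k) x - g (i, j) x)) \<longlonglongrightarrow> 0" for i j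
    using g'[of "(i, j)"] by simp_all
  define u where "u x = pt (f 1 x) (f 2 x)" for x
  have ui: "(\<lambda>x. u x $ i) = f i" for i
  proof -
    have "i = 1 \<or> i = 2" by (rule exhaust_2)
    then show ?thesis by (auto simp: u_def)
  qed
  note cl = H1_closed[OF H1vec_comp[OF UH] f(1) g(1) f(2) g(2)[unfolded jac_def]]
    weak_pd_closed[OF H1vec_comp[OF UH] f(1) g(1) f(2) g(2)[unfolded jac_def]]
  have uH: "u \<in> H1vec" unfolding H1vec_def by (simp add: ui cl(1))
  have jl: "(\<lambda>k. l2n OM (\<lambda>x. jac i j (U k) x - jac i j u x)) \<longlonglongrightarrow> 0" for i j
  proof -
    have "l2n OM (\<lambda>x. jac i j (U k) x - jac i j u x) = l2n OM (\<lambda>x. jac i j (U k) x - g (i, j) x)" for k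
    proof (rule l2n_cong_AE)
      show "AE x in OM. jac i j (U k) x - jac i j u x = jac i j (U k) x - g (i, j) x"
        using cl(2)[of j i] unfolding jac_def ui by eventually_elim simp
    qed (intro sq_int_measurable sq_int_diff jac_sq_int UH uH g)+
    then show ?thesis using g(2) by simp
  qed
  have ul: "(\<lambda>k. l2n OM (\<lambda>x. U k x $ i - u x $ i)) \<longlonglongrightarrow> 0" for i
    using f(2)[of i] by (simp flip: ui)
  have "(\<lambda>k. \<integral>x. U k x $ 1 * 1 \<partial>OM) \<longlonglongrightarrow> (\<integral>x. u x $ 1 * 1 \<partial>OM)"
    by (rule l2n_tendsto_integral_right[OF _ _ ul OM.sq_int_one]) (intro H1_sq_int H1vec_comp UH uH)+
  moreover have "(\<integral>x. U k x $ 1 \<partial>OM) = 0" for k using U(1)[of k] by (simp add: W_iff)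
  ultimately have mean: "(\<integral>x. u x $ 1 \<partial>OM) = 0" by (simp add: LIMSEQ_const_iff)
  have tr: "has_edge_trace (\<lambda>x. u x $ 2) c (\<lambda>_. p)" if "\<And>k. has_edge_trace (\<lambda>x. U k x $ 2) c (\<lambda>_. p)" for c p
    by (rule edge_trace_closed[OF that H1vec_comp[OF uH] ul]) (rule jl[of 2, unfolded jac_def])
  have uW: "u \<in> W l"
    unfolding W_iff using uH mean U(1) by (auto simp: W_iff intro!: tr)
  have "(\<lambda>k. E (U k)) \<longlonglongrightarrow> E u" unfolding E_def by (rule form_tendsto[OF UH uH jl])
  moreover have "(\<lambda>k. m + ?r k) \<longlonglongrightarrow> m + 0"
    by (intro tendsto_add tendsto_const LIMSEQ_inverse_real_of_nat)
  ultimately have "E u \<le> m + 0"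
    by (rule LIMSEQ_le) (use U(2) in \<open>auto intro: less_imp_le\<close>)
  then have "E u \<le> E w" if "w \<in> W l" for w using m[OF that] by simp
  with uW show ?thesis by (intro that[of u]) (auto simp: E_def)
qed

section \<open>The tensile force as a minimal energy\<close>

text \<open>The gradient of \<open>affine_field 0 1\<close> is the matrix unit in position \<open>(2, 2)\<close>, so the bilinear form
against it picks out the normal stress in the second direction.\<close>

lemma force_integral:
  assumes u: "u \<in> H1vec"
  shows "(LINT x:Omega|lborel. lam x * trace (sym_grad u x) + 2 * mu * weak_pd 2 (\<lambda>y. u y $ 2) x)
    = form lam mu u (affine_field 0 1)"
  unfolding LINT_Omega form_def
proof (rule integral_cong_AE)
  show "AE x in OM. lam x * trace (sym_grad u x) + 2 * mu * weak_pd 2 (\<lambda>y. u y $ 2) x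
      = dens lam mu u (affine_field 0 1) x"
    using jac_affine_field[of 1 1 0 1] jac_affine_field[of 1 2 0 1]
      jac_affine_field[of 2 1 0 1] jac_affine_field[of 2 2 0 1]
    by eventually_elim (simp add: trace_sym_grad dens_def, simp add: jac_def)
  show "(\<lambda>x. lam x * trace (sym_grad u x) + 2 * mu * weak_pd 2 (\<lambda>y. u y $ 2) x) \<in> borel_measurable OM"
    unfolding trace_sym_grad jac_def[of 2 2 u, symmetric]
    by (intro sq_int_measurable sq_int_add lam_times sq_int_scale jac_sq_int u)
  show "dens lam mu u (affine_field 0 1) \<in> borel_measurable OM"
    using dens_integrable[OF u W_H1vec[OF affine_field_W]] by auto
qed

lemma solution_force:
  assumes s: "tensile_solution lam (\<lambda>_. mu) l u"
  shows "l * form lam mu u (affine_field 0 1) = form lam mu u u"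
proof -
  have u: "u \<in> W l" and v0: "\<And>v. v \<in> W 0 \<Longrightarrow> form lam mu u v = 0"
    using s by (auto simp: tensile_solution_iff)
  have H: "u \<in> H1vec" "affine_field 0 1 \<in> H1vec" by (rule W_H1vec[OF u], rule W_H1vec[OF affine_field_W])
  have "(\<lambda>x. 1 *\<^sub>R u x + (- l) *\<^sub>R affine_field 0 1 x) \<in> W 0"
    using W_lincomb[OF u affine_field_W, of 1 "- l" 0 1] by simp
  from v0[OF this] have "form lam mu (\<lambda>x. 1 *\<^sub>R u x + (- l) *\<^sub>R affine_field 0 1 x) u = 0"
    by (simp only: form_commute[of _ u])
  then have "form lam mu u u = l * form lam mu (affine_field 0 1) u"
    unfolding form_lincomb_left[OF H H(1)] by simp
  then show ?thesis by (simp only: form_commute[of u "affine_field 0 1"])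
qed

lemma solution_orthogonal:
  assumes s: "tensile_solution lam (\<lambda>_. mu) l u" and w: "w \<in> W l"
  shows "form lam mu u w = form lam mu u u"
proof -
  have u: "u \<in> W l" and v0: "\<And>v. v \<in> W 0 \<Longrightarrow> form lam mu u v = 0"
    using s by (auto simp: tensile_solution_iff)
  have "form lam mu (\<lambda>x. 1 *\<^sub>R w x + (-1) *\<^sub>R u x) u = 0"
    using v0[OF W_diff[OF w u]] by (simp only: form_commute[of _ u])
  then show ?thesis
    unfolding form_lincomb_left[OF W_H1vec[OF w] W_H1vec[OF u] W_H1vec[OF u]]
    by (simp add: form_commute[of u w])
qed

lemma solution_minimal:
  assumes s: "tensile_solution lam (\<lambda>_. mu) l u" and w: "w \<in> W l"
  shows "form lam mu u u \<le> form lam mu w w"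
proof -
  have u: "u \<in> W l" using s by (simp add: tensile_solution_iff)
  have "0 \<le> form lam mu (\<lambda>x. 1 *\<^sub>R u x + (-1) *\<^sub>R w x) (\<lambda>x. 1 *\<^sub>R u x + (-1) *\<^sub>R w x)"
    by (rule form_nonneg[OF W_H1vec[OF W_diff[OF u w]]])
  then show ?thesis
    unfolding form_lincomb[OF W_H1vec[OF u] W_H1vec[OF w]] by (simp add: solution_orthogonal[OF s w])
qed

text \<open>All solutions have the same energy, as each of them minimises; hence the definite description
is well defined.\<close>

lemma tensile_force_eq:
  assumes l: "l > 0" and s: "tensile_solution lam (\<lambda>_. mu) l u"
  shows "tensile_force lam (\<lambda>_. mu) l = form lam mu u u / l"
proof -
  have F: "(LINT x:Omega|lborel. lam x * trace (sym_grad v x) + 2 * mu * weak_pd 2 (\<lambda>y. v y $ 2) x)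
      = form lam mu v v / l" if v: "tensile_solution lam (\<lambda>_. mu) l v" for v
  proof -
    have "v \<in> H1vec" using v by (auto simp: tensile_solution_iff intro: W_H1vec)
    then show ?thesis using force_integral solution_force[OF v] l by (simp add: field_simps)
  qed
  have E: "form lam mu v v = form lam mu u u" if v: "tensile_solution lam (\<lambda>_. mu) l v" for v
    using solution_minimal[OF v, of u] solution_minimal[OF s, of v] s v by (simp add: tensile_solution_iff)
  show ?thesis
    unfolding tensile_force_def
  proof (rule the_equality)
    show "\<exists>v. tensile_solution lam (\<lambda>_. mu) l v \<and> form lam mu u u / l =
        (LINT x:Omega|lborel. lam x * trace (sym_grad v x) + 2 * mu * weak_pd 2 (\<lambda>y. v y $ 2) x)"
      by (intro exI[of _ u] conjI s F[OF s, symmetric])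
  next
    fix G
    assume "\<exists>v. tensile_solution lam (\<lambda>_. mu) l v \<and> G =
        (LINT x:Omega|lborel. lam x * trace (sym_grad v x) + 2 * mu * weak_pd 2 (\<lambda>y. v y $ 2) x)"
    then obtain v where v: "tensile_solution lam (\<lambda>_. mu) l v" and G: "G =
        (LINT x:Omega|lborel. lam x * trace (sym_grad v x) + 2 * mu * weak_pd 2 (\<lambda>y. v y $ 2) x)"
      by (elim exE conjE)
    show "G = form lam mu u u / l" unfolding G F[OF v] E[OF v] ..
  qed
qed

lemma tensile_force_exists:
  assumes l: "l > 0"
  obtains u where "tensile_solution lam (\<lambda>_. mu) l u"
    "tensile_force lam (\<lambda>_. mu) l = form lam mu u u / l"
proof -
  obtain u where "u \<in> W l" "\<And>w. w \<in> W l \<Longrightarrow> form lam mu u u \<le> form lam mu w w"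
    using minimiser_exists by metis
  then have s: "tensile_solution lam (\<lambda>_. mu) l u" by (rule minimiser_solves)
  show ?thesis by (rule that[OF s tensile_force_eq[OF l s]])
qed

end

text \<open>The solution for the larger coefficient is a competitor for the smaller one, and its energy does
not increase when the coefficient is lowered.\<close>

lemma tensile_force_mono:
  assumes m: "material lam mu B" "material lam' mu B'" and l: "l > 0"
    and le: "\<And>x. x \<in> Omega \<Longrightarrow> lam x \<le> lam' x"
  shows "tensile_force lam (\<lambda>_. mu) l \<le> tensile_force lam' (\<lambda>_. mu) l"
proof -
  obtain u where u: "tensile_solution lam (\<lambda>_. mu) l u" "tensile_force lam (\<lambda>_. mu) l = form lam mu u u / l"
    using material.tensile_force_exists[OF m(1) l] by metis
  obtain u' where u': "tensile_solution lam' (\<lambda>_. mu) l u'" "tensile_force lam' (\<lambda>_. mu) l = form lam' mu u' u' / l"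
    using material.tensile_force_exists[OF m(2) l] by metis
  have W': "u' \<in> W l" using u'(1) by (simp add: tensile_solution_iff)
  have "form lam mu u u \<le> form lam mu u' u'"
    by (rule material.solution_minimal[OF m(1) u(1) W'])
  also have "\<dots> \<le> form lam' mu u' u'"
    unfolding form_def
  proof (rule integral_mono)
    show "integrable OM (dens lam mu u' u')" "integrable OM (dens lam' mu u' u')"
      using material.dens_integrable[OF m(1)] material.dens_integrable[OF m(2)] W_H1vec[OF W'] by auto
    fix x assume "x \<in> space OM"
    then have "lam x * (jac 1 1 u' x + jac 2 2 u' x)\<^sup>2 \<le> lam' x * (jac 1 1 u' x + jac 2 2 u' x)\<^sup>2"
      using le by (intro mult_right_mono) auto
    then show "dens lam mu u' u' x \<le> dens lam' mu u' u' x"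
      by (simp add: dens_def power2_eq_square mult.assoc)
  qed
  finally show ?thesis unfolding u(2) u'(2) using l by (simp add: divide_right_mono)
qed

text \<open>The lateral contraction \<open>a\<close> is chosen such that the stress in the first direction is zero. The only
remaining stress is constant and acts in the second direction, and \<open>\<integral> \<partial>\<^sub>2 v\<^sub>2 = 0\<close> for \<open>v\<close> in \<open>W 0\<close>.\<close>

lemma tensile_force_const:
  assumes c: "c \<ge> 0" and mu: "mu > 0" and l: "l > 0"
  shows "tensile_force (\<lambda>_. c) (\<lambda>_. mu) l = 2 * mu * l + 2 * mu * l * c / (c + 2 * mu)"
proof -
  interpret material "\<lambda>_. c" mu c by standard (use c mu in auto)
  define a where "a = - c * l / (c + 2 * mu)"
  have p: "c + 2 * mu > 0" using c mu by simp
  let ?u = "affine_field a l"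
  have a: "c * (a + l) + 2 * mu * a = 0" using p by (simp add: a_def field_simps)
  have u: "?u \<in> W l" by (rule affine_field_W)
  have f: "form (\<lambda>_. c) mu ?u v = (c * (a + l) + 2 * mu * l) * (\<integral>x. jac 2 2 v x \<partial>OM)" if v: "v \<in> H1vec" for v
  proof -
    have "form (\<lambda>_. c) mu ?u v = (\<integral>x. (c * (a + l) + 2 * mu * l) * jac 2 2 v x \<partial>OM)"
      unfolding form_def
    proof (rule integral_cong_AE)
      show "AE x in OM. dens (\<lambda>_. c) mu ?u v x = (c * (a + l) + 2 * mu * l) * jac 2 2 v x"
        using jac_affine_field[of 1 1 a l] jac_affine_field[of 1 2 a l]
          jac_affine_field[of 2 1 a l] jac_affine_field[of 2 2 a l]
      proof eventually_elim
        case (elim x)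
        then have "dens (\<lambda>_. c) mu ?u v x =
            (c * (a + l) + 2 * mu * a) * jac 1 1 v x + (c * (a + l) + 2 * mu * l) * jac 2 2 v x"
          by (simp add: dens_def algebra_simps)
        then show ?case unfolding a by simp
      qed
      show "dens (\<lambda>_. c) mu ?u v \<in> borel_measurable OM"
        using dens_integrable[OF W_H1vec[OF u] v] by auto
      show "(\<lambda>x. (c * (a + l) + 2 * mu * l) * jac 2 2 v x) \<in> borel_measurable OM"
        by (intro sq_int_measurable sq_int_scale jac_sq_int v)
    qed
    then show ?thesis by simp
  qed
  have s: "tensile_solution (\<lambda>_. c) (\<lambda>_. mu) l ?u"
    unfolding tensile_solution_iff
  proof (intro conjI u ballI)
    fix v assume v: "v \<in> W 0"
    then have "(\<integral>x. jac 2 2 v x \<partial>OM) = 0"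
      unfolding jac_def by (intro poincare_zero_trace(2)) (simp_all add: W_iff)
    then show "form (\<lambda>_. c) mu ?u v = 0" using f[OF W_H1vec[OF v]] by simp
  qed
  have "(\<integral>x. jac 2 2 ?u x \<partial>OM) = (\<integral>x. l \<partial>OM)"
  proof (rule integral_cong_AE)
    show "AE x in OM. jac 2 2 ?u x = l" using jac_affine_field[of 2 2 a l] by simp
    show "jac 2 2 ?u \<in> borel_measurable OM"
      by (intro sq_int_measurable jac_sq_int W_H1vec[OF u])
  qed simp
  also have "\<dots> = l" by (simp add: measure_OM)
  finally have "tensile_force (\<lambda>_. c) (\<lambda>_. mu) l = c * (a + l) + 2 * mu * l"
    using tensile_force_eq[OF l s] f[OF W_H1vec[OF u]] l by simp
  also have "\<dots> = 2 * mu * l - 2 * mu * a" using a by simp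
  also have "\<dots> = 2 * mu * l + 2 * mu * l * c / (c + 2 * mu)" by (simp add: a_def algebra_simps)
  finally show ?thesis .
qed

section \<open>Convergence of the iteration\<close>

text \<open>The update formula of the algorithm: the coefficient of the homogeneous material that would
produce the force \<open>F\<close>.\<close>

definition identified :: "real \<Rightarrow> real \<Rightarrow> real \<Rightarrow> real"
  where "identified mu l F = (F - 2 * mu * l) * inverse (2 * l - F / (2 * mu))"

lemma identified_const:
  assumes "c \<ge> 0" "mu > 0" "l > 0"
  shows "identified mu l (tensile_force (\<lambda>_. c) (\<lambda>_. mu) l) = c"
proof -
  have p: "c + 2 * mu > 0" using assms by simp
  have F: "tensile_force (\<lambda>_. c) (\<lambda>_. mu) l = 2 * mu * l + 2 * mu * l * c / (c + 2 * mu)"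
    by (rule tensile_force_const[OF assms])
  have "2 * l - tensile_force (\<lambda>_. c) (\<lambda>_. mu) l / (2 * mu) = l - l * c / (c + 2 * mu)"
    unfolding F using assms p by (simp add: add_divide_distrib)
  also have "\<dots> = l * (2 * mu) / (c + 2 * mu)" using p by (simp add: field_simps)
  finally have D: "2 * l - tensile_force (\<lambda>_. c) (\<lambda>_. mu) l / (2 * mu) = l * (2 * mu) / (c + 2 * mu)" .
  have N: "tensile_force (\<lambda>_. c) (\<lambda>_. mu) l - 2 * mu * l = c * (l * (2 * mu) / (c + 2 * mu))"
    unfolding F by simp
  have nz: "l * (2 * mu) / (c + 2 * mu) \<noteq> 0" using assms p by simp
  have "c * q * inverse q = c" if "q \<noteq> 0" for q :: real using that by simp
  from this[OF nz] show ?thesis unfolding identified_def D N .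
qed

text \<open>The formula equals \<open>2 mu (F - 2 mu l) / (4 mu l - F)\<close>, which increases up to its pole at \<open>4 mu l\<close>.\<close>

lemma identified_mono:
  assumes mu: "mu > 0" and l: "l > 0" and le: "F \<le> G" and G: "G < 4 * mu * l"
  shows "identified mu l F \<le> identified mu l G"
proof -
  have eq: "identified mu l H = 2 * mu * ((H - 2 * mu * l) / (4 * mu * l - H))" if "H < 4 * mu * l" for H
  proof -
    have D: "2 * l - H / (2 * mu) = (4 * mu * l - H) / (2 * mu)" using mu by (simp add: field_simps)
    show ?thesis unfolding identified_def D inverse_divide by simp
  qed
  have "(F - 2 * mu * l) * (4 * mu * l - G) \<le> (G - 2 * mu * l) * (4 * mu * l - F)"
  proof -
    have "(G - 2 * mu * l) * (4 * mu * l - F) - (F - 2 * mu * l) * (4 * mu * l - G) = (G - F) * (2 * mu * l)"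
      by (simp add: algebra_simps)
    moreover have "0 \<le> (G - F) * (2 * mu * l)" using le mu l by simp
    ultimately show ?thesis by linarith
  qed
  then have "(F - 2 * mu * l) / (4 * mu * l - F) \<le> (G - 2 * mu * l) / (4 * mu * l - G)"
    using le G by (simp add: divide_le_eq le_divide_eq)
  then show ?thesis
    unfolding eq[OF le_less_trans[OF le G]] eq[OF G] using mu by (intro mult_left_mono) auto
qed

lemma cell_lam_cases:
  assumes "x \<in> Omega"
  obtains "\<And>d. cell_lam r1 r2 lc lm d x = lc" | "\<And>d. cell_lam r1 r2 lc lm d x = lm"
    | "\<And>d. cell_lam r1 r2 lc lm d x = d"
proof -
  consider "x \<in> cell_cer r1" | "x \<in> cell_met r1 r2" | "x \<notin> cell_cer r1" "x \<notin> cell_met r1 r2" by blast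
  then show thesis
  proof cases
    case 1
    then have "cell_lam r1 r2 lc lm d x = lc" for d
      by (simp add: cell_lam_def cell_met_def cell_dummy_def cell_cer_def)
    then show thesis by (rule that(1))
  next
    case 2
    then have "cell_lam r1 r2 lc lm d x = lm" for d
      by (simp add: cell_lam_def cell_met_def cell_dummy_def cell_cer_def)
    then show thesis by (rule that(2))
  next
    case 3
    then have "cell_lam r1 r2 lc lm d x = d" for d
      using assms by (simp add: cell_lam_def cell_dummy_def)
    then show thesis by (rule that(3))
  qed
qed

lemma cell_lam_measurable: "cell_lam r1 r2 lc lm d \<in> borel_measurable OM"
proof (rule measurable_restrict_space1)
  have [measurable]: "cell_cer r1 \<in> sets borel" "cell_met r1 r2 \<in> sets borel" "cell_dummy r1 r2 \<in> sets borel"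
    by (auto simp: cell_cer_def cell_met_def cell_dummy_def)
  show "cell_lam r1 r2 lc lm d \<in> borel_measurable lborel"
    unfolding cell_lam_def[abs_def] by measurable
qed

lemma cell_lam_range:
  assumes "x \<in> Omega" "lm \<le> lc" "lm \<le> d" "d \<le> lc"
  shows "lm \<le> cell_lam r1 r2 lc lm d x" "cell_lam r1 r2 lc lm d x \<le> lc"
  using assms by (cases rule: cell_lam_cases[OF assms(1), of r1 r2 lc lm]; simp)+

lemma cell_lam_mono:
  assumes "x \<in> Omega" "d \<le> d'"
  shows "cell_lam r1 r2 lc lm d x \<le> cell_lam r1 r2 lc lm d' x"
  using assms by (cases rule: cell_lam_cases[OF assms(1), of r1 r2 lc lm]; simp)

lemma embedded_cell_areas:
  assumes "embedded_cell_geometry Om_m Om_c r1 r2"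
  shows "measure lebesgue Om_c + measure lebesgue Om_m = 1"
proof -
  have s: "Om_m \<in> sets lebesgue" "Om_c \<in> sets lebesgue" and d: "Om_c \<inter> Om_m = {}" and u: "Om_c \<union> Om_m = Omega"
    using assms by (auto simp: embedded_cell_geometry_def)
  have O: "emeasure lebesgue Omega = 1" by (simp add: emeasure_Omega)
  have "emeasure lebesgue Om_c \<le> emeasure lebesgue Omega" "emeasure lebesgue Om_m \<le> emeasure lebesgue Omega"
    by (rule emeasure_mono; use u in auto)+
  then have "emeasure lebesgue Om_c \<noteq> \<infinity>" "emeasure lebesgue Om_m \<noteq> \<infinity>"
    unfolding O by (auto simp: top_unique)
  then have "measure lebesgue (Om_c \<union> Om_m) = measure lebesgue Om_c + measure lebesgue Om_m"
    by (intro measure_Union s d)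
  then show ?thesis unfolding u using O by (simp add: measure_def)
qed

text \<open>The first step decides the direction: by monotonicity of \<open>T\<close> the comparison of \<open>d 0\<close> with \<open>d 1\<close>
is inherited by all later pairs.\<close>

lemma monotone_iteration_converges:
  fixes T :: "real \<Rightarrow> real" and d :: "nat \<Rightarrow> real"
  assumes T: "\<And>x. x \<in> {a..b} \<Longrightarrow> T x \<in> {a..b}"
    and mono: "\<And>x y. x \<in> {a..b} \<Longrightarrow> y \<in> {a..b} \<Longrightarrow> x \<le> y \<Longrightarrow> T x \<le> T y"
    and d0: "d 0 \<in> {a..b}" and dS: "\<And>n. d (Suc n) = T (d n)"
  shows "\<exists>L\<in>{a..b}. monoseq d \<and> d \<longlonglongrightarrow> L"
proof -
  have dn: "d n \<in> {a..b}" for n by (induction n) (simp_all only: d0 dS T)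
  have m: "monoseq d"
  proof (cases "d 0 \<le> d 1")
    case True
    have "d n \<le> d (Suc n)" for n
    proof (induction n)
      case (Suc n)
      then show ?case unfolding dS[of "Suc n"] using mono[OF dn dn Suc.IH] by (simp only: dS[of n, symmetric])
    qed (use True in simp)
    from lift_Suc_mono_le[of d, OF this] show ?thesis by (intro monoI1) blast
  next
    case False
    have "d (Suc n) \<le> d n" for n
    proof (induction n)
      case (Suc n)
      then show ?case unfolding dS[of "Suc n"] using mono[OF dn dn Suc.IH] by (simp only: dS[of n, symmetric])
    qed (use False in simp)
    from lift_Suc_antimono_le[of d, OF this] show ?thesis by (intro monoI2) blast
  qed
  have "Bseq d"
  proof (rule BseqI'[of _ "max \<bar>a\<bar> \<bar>b\<bar>"])
    show "norm (d n) \<le> max \<bar>a\<bar> \<bar>b\<bar>" for n using dn[of n] by auto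
  qed
  then obtain L where L: "d \<longlonglongrightarrow> L"
    using Bseq_monoseq_convergent[OF _ m] by (auto simp: convergent_def)
  have "L \<in> {a..b}"
    by (rule closed_sequentially[OF closed_atLeastAtMost dn L])
  with m L show ?thesis by blast
qed

theorem theorem5p10:
  fixes lam_met mu D_c l r1 r2 :: real and Om_m Om_c :: "(real ^ 2) set"
  assumes "lam_met > 0" and "mu > 0" and "l > 0"
    and "D_c \<ge> 0"
    and "embedded_cell_geometry Om_m Om_c r1 r2"
  shows "\<exists>eps0>0. \<forall>eps\<in>{0<..<eps0}.
    \<exists>L\<in>{lam_met..lam_cer lam_met D_c eps}.
      monoseq (lam_dummy Om_m Om_c r1 r2 lam_met D_c mu l eps) \<and>
      lam_dummy Om_m Om_c r1 r2 lam_met D_c mu l eps \<longlonglongrightarrow> L"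
proof (intro exI[of _ "1::real"] conjI ballI zero_less_one)
  fix eps :: real
  assume eps: "eps \<in> {0<..<1}"
  let ?lc = "lam_cer lam_met D_c eps"
  let ?I = "{lam_met..?lc}"
  let ?lam = "cell_lam r1 r2 ?lc lam_met"
  let ?F = "\<lambda>d. tensile_force (?lam d) (\<lambda>_. mu) l"
  let ?T = "\<lambda>d. identified mu l (?F d)"
  have le: "lam_met \<le> ?lc" using eps assms(4) by (simp add: lam_cer_def)
  have mat: "material (?lam d) mu ?lc" if "d \<in> ?I" for d
    using that le assms(1,2) cell_lam_range[of _ lam_met ?lc d r1 r2]
    by unfold_locales (auto simp: cell_lam_measurable intro: order_trans[of 0 lam_met])
  have matc: "material (\<lambda>_. c) mu ?lc" if "c \<in> ?I" for c
    using that assms(1,2) by unfold_locales auto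
  have lower: "tensile_force (\<lambda>_. lam_met) (\<lambda>_. mu) l \<le> ?F d"
    and upper: "?F d \<le> tensile_force (\<lambda>_. ?lc) (\<lambda>_. mu) l" if d: "d \<in> ?I" for d
    by (rule tensile_force_mono[OF matc mat[OF d] assms(3)] tensile_force_mono[OF mat[OF d] matc assms(3)];
        use d le cell_lam_range[of _ lam_met ?lc d r1 r2] in auto)+
  have c0: "0 \<le> ?lc" using le assms(1) by simp
  \<comment> \<open>the forces of constant coefficients stay below the pole of the update formula\<close>
  have bound: "tensile_force (\<lambda>_. ?lc) (\<lambda>_. mu) l < 4 * mu * l"
  proof -
    have "?lc / (?lc + 2 * mu) < 1" using c0 assms(2) by simp
    then have "2 * mu * l * (?lc / (?lc + 2 * mu)) < 2 * mu * l * 1"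
      using assms(2,3) by (intro mult_strict_left_mono) auto
    moreover have "4 * mu * l = 2 * mu * l + 2 * mu * l" by simp
    ultimately show ?thesis
      unfolding tensile_force_const[OF c0 assms(2,3)]
      by (simp only: times_divide_eq_right mult_1_right add_less_cancel_left)
  qed
  show "\<exists>L\<in>?I. monoseq (lam_dummy Om_m Om_c r1 r2 lam_met D_c mu l eps) \<and>
      lam_dummy Om_m Om_c r1 r2 lam_met D_c mu l eps \<longlonglongrightarrow> L"
  proof (rule monotone_iteration_converges[where T = ?T])
    fix d assume d: "d \<in> ?I"
    have "identified mu l (tensile_force (\<lambda>_. lam_met) (\<lambda>_. mu) l) \<le> ?T d"
      by (rule identified_mono[OF assms(2,3) lower[OF d]]) (rule le_less_trans[OF upper[OF d] bound])
    moreover have "?T d \<le> identified mu l (tensile_force (\<lambda>_. ?lc) (\<lambda>_. mu) l)"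
      by (rule identified_mono[OF assms(2,3) upper[OF d] bound])
    ultimately show "?T d \<in> ?I"
      using identified_const[OF _ assms(2,3)] c0 assms(1) by simp
  next
    fix d e assume d: "d \<in> ?I" and e: "e \<in> ?I" and "d \<le> e"
    then have "?F d \<le> ?F e"
      by (intro tensile_force_mono[OF mat[OF d] mat[OF e] assms(3)] cell_lam_mono)
    then show "?T d \<le> ?T e"
      by (rule identified_mono[OF assms(2,3)]) (rule le_less_trans[OF upper[OF e] bound])
  next
    define p where "p = measure lebesgue Om_c"
    have p: "0 \<le> p" "measure lebesgue Om_m = 1 - p"
      using embedded_cell_areas[OF assms(5)] by (simp_all add: p_def)
    have p1: "p \<le> 1" using p(2) measure_nonneg[of lebesgue Om_m] by linarith
    have "lam_dummy Om_m Om_c r1 r2 lam_met D_c mu l eps 0 = lam_met + p * (?lc - lam_met)"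
      unfolding lam_dummy.simps p(2) p_def[symmetric] by (simp add: algebra_simps)
    moreover have "0 \<le> p * (?lc - lam_met)" using p(1) le by simp
    moreover have "p * (?lc - lam_met) \<le> 1 * (?lc - lam_met)"
      using p1 le by (intro mult_right_mono) auto
    ultimately show "lam_dummy Om_m Om_c r1 r2 lam_met D_c mu l eps 0 \<in> ?I" by simp
  next
    show "lam_dummy Om_m Om_c r1 r2 lam_met D_c mu l eps (Suc n) =
        ?T (lam_dummy Om_m Om_c r1 r2 lam_met D_c mu l eps n)" for n
      by (simp add: identified_def Let_def)
  qed
qed

end
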